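(* Let $(X,\rho,\mu)$ be a space of homogeneous type (with the standing assumptions listed in the context), $q\in(1,\infty)$, and $\omega$ be a weight. Then $\omega\in A^+_q(0)$ if and only if the parabolic maximal operator $\mathcal M^+$ is bounded from $L^q(X\times\mathbb R,\omega)$ to $L^{q,\infty}(X\times\mathbb R,\omega)$.
   Context: Setting. $(X,\rho)$ is a quasi-metric space: $\rho:X\times X\to[0,\infty)$, $\rho(x,y)=0$ iff $x=y$, $\rho(x,y)=\rho(y,x)$, and $\rho(x,y)\le K_0[\rho(x,z)+\rho(z,y)]$ for all $x,y,z\in X$, with a constant $K_0\in[1,\infty)$. Balls are $B(x,r)=\{y\in X:\rho(x,y)<r\}$. $\mu$ is a nonnegative measure on a $\sigma$-algebra containing the balls which is doubling: $\mu(B(x,2r))\le C_\mu\mu(B(x,r))$ for all $x\in X$, $r\in(0,\infty)$; then $(X,\rho,\mu)$ is called a space of homogeneous type. Standing assumptions: (a) for each $x$ the balls $\{B(x,r)\}_{r>0}$ form a basis of open neighborhoods of $x$; (b) $\mu$ is Borel regular (open sets are measurable and every $A\subset X$ lies in a Borel set $E$ with $\mu(A)=\mu(E)$); (c) $0<\mu(B(x,r))<\infty$ for all balls; (d) $\operatorname{diam}(X)=\infty$ and $\mu(\{x\})=0$ for all $x$; (e) monotone geodesic property: there is a constant $\widetilde K>0$ such that for all $s\in(0,\infty)$ and $x,y\in X$ with $\rho(x,y)\ge s$ there are $m\in\mathbb N$ and points $x_0=x,x_1,\dots,x_m=y$ with $\rho(x_i,x_{i+1})\le\widetilde K s$ and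 $\rho(x_{i+1},x_m)\le\rho(x_i,x_m)-s$ for $i=0,\dots,m-1$. Fix $p\in(1,\infty)$. $X\times\mathbb R$ carries the quasi-metric $d((x,t),(y,s))=\max\{\rho(x,y),|t-s|^{1/p}\}$ and the product measure $\lambda=\mu\times m$, $m$ being Lebesgue measure on $\mathbb R$; the same basic assumptions (a)-(d) are made for $(X\times\mathbb R,d,\lambda)$. All integrals are with respect to $\lambda$, and $⨍_E f:=\frac1{\lambda(E)}\int_E f$ denotes the average. Weights. For $x\in X$, $t\in\mathbb R$, $l\in(0,\infty)$ put $R=R(x,t,l)=B(x,l)\times(t-l^p,t+l^p)$, $R^-=B(x,l)\times(t-l^p,t)$, $R^+=B(x,l)\times(t,t+l^p)$ (parabolic cylinders and their halves). A weight is a real-valued, $\lambda$-almost everywhere positive, locally integrable function on $X\times\mathbb R$ (integrable on some cylinder $R(x,t,r)$ around each point). For $q\in(1,\infty)$, with $1/q+1/q'=1$, a weight $\omega$ belongs to $A^+_q(0)$ if $\sup_{R}\left[⨍_{R^-}\omega\right]\left[⨍_{R^+}\omega^{1-q'}\right]^{q-1}<\infty$, the supremum being over all parabolic cylinders $R(x,t,l)$. Adjacent dyadic systems and parabolic rectangles. Fix $\delta\in(0,1)$ with $96K_0^6\delta\le1$ and constants $0<c_0\le C_0<\infty$ with $12K_0^3C_0\delta\le c_0$; let $c_1=(3K_0^2)^{-1}c_0$, $C_1=2K_0C_0$. Fix (they exist by a theorem of Hytönen and Kairema) $K\in\mathbb N$ and, for $\tau\in\{1,\dots,K\}$, points $\{z^{k,\tau}_\alpha\}$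 and families $\mathfrak D^\tau=\{Q^{k,\tau}_\alpha: k\in\mathbb Z,\alpha\in I_{k,\tau}\}$ of subsets of $X$ (dyadic cubes) such that for each $\tau$: $\rho(z^{k,\tau}_\alpha,z^{k,\tau}_\beta)\ge c_0\delta^k$ for $\alpha\ne\beta$ and $\min_\alpha\rho(x,z^{k,\tau}_\alpha)<C_0\delta^k$ for all $x\in X$; if $l\ge k$, then either $Q^{l,\tau}_\beta\subset Q^{k,\tau}_\alpha$ or they are disjoint; for each $k$, $X$ is the disjoint union of $Q^{k,\tau}_\alpha$, $\alpha\in I_{k,\tau}$; $B(z^{k,\tau}_\alpha,c_1\delta^k)\subset Q^{k,\tau}_\alpha\subset B(z^{k,\tau}_\alpha,C_1\delta^k)$; if $l\ge k$ and $Q^{l,\tau}_\beta\subset Q^{k,\tau}_\alpha$, then $B(z^{l,\tau}_\beta,C_1\delta^l)\subset B(z^{k,\tau}_\alpha,C_1\delta^k)$; moreover there is a constant $C_*>0$ such that every ball $B(x,r)$ is contained in some $Q^{k,\tau}_\alpha$ (for some $\tau$) with $\operatorname{diam}(Q^{k,\tau}_\alpha)\le C_*r$. A parabolic rectangle is $P=P(\tau,k,\alpha,t)=Q^{k,\tau}_\alpha\times(t-\delta^{kp},t+\delta^{kp})$, with upper half $P^+=Q^{k,\tau}_\alpha\times(t,t+\delta^{kp})$. Maximal function. For $f\in L^1_{\rm loc}(X\times\mathbb R)$, $\mathcal M^{+}f(x,t)=\sup ⨍_{P^+}|f|$, the supremum being over all $\tau,k,\alpha$ with $(x,t)\in P=P(\tau,k,\alpha,t)$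 (i.e. $x\in Q^{k,\tau}_\alpha$; the same $t$). Spaces. $\|f\|_{L^q(X\times\mathbb R,\omega)}=(\int|f|^q\omega)^{1/q}$ and $\|f\|_{L^{q,\infty}(X\times\mathbb R,\omega)}=\sup_{\xi>0}\xi\,[\omega(\{|f|>\xi\})]^{1/q}$, where $\omega(E)=\int_E\omega$. *)

theory Defs
  imports "HOL-Analysis.Analysis"
begin

text \<open>The underlying set \<open>X\<close> is the whole type \<open>'a\<close>; the quasi-metric is an explicit function,
  so that the definitions below can be used both for \<open>X\<close> and for \<open>X \<times> \<real>\<close>.\<close>

definition quasi_metric :: "('a \<Rightarrow> 'a \<Rightarrow> real) \<Rightarrow> real \<Rightarrow> bool" where
  "quasi_metric \<rho> K\<^sub>0 \<longleftrightarrow>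
     1 \<le> K\<^sub>0 \<and>
     (\<forall>x y. 0 \<le> \<rho> x y) \<and>
     (\<forall>x y. \<rho> x y = 0 \<longleftrightarrow> x = y) \<and>
     (\<forall>x y. \<rho> x y = \<rho> y x) \<and>
     (\<forall>x y z. \<rho> x y \<le> K\<^sub>0 * (\<rho> x z + \<rho> z y))"

definition qball :: "('a \<Rightarrow> 'a \<Rightarrow> real) \<Rightarrow> 'a \<Rightarrow> real \<Rightarrow> 'a set" where
  "qball \<rho> x r = {y. \<rho> x y < r}"

definition qdiam :: "('a \<Rightarrow> 'a \<Rightarrow> real) \<Rightarrow> 'a set \<Rightarrow> ennreal" where
  "qdiam \<rho> A = (SUP (x, y) \<in> A \<times> A. ennreal (\<rho> x y))"

definition qopen :: "('a \<Rightarrow> 'a \<Rightarrow> real) \<Rightarrow> 'a set \<Rightarrow> bool" where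
  "qopen \<rho> U \<longleftrightarrow> (\<forall>x\<in>U. \<exists>r>0. qball \<rho> x r \<subseteq> U)"

definition qborel_sets :: "('a \<Rightarrow> 'a \<Rightarrow> real) \<Rightarrow> 'a set set" where
  "qborel_sets \<rho> = sigma_sets UNIV {U. qopen \<rho> U}"

definition doubling_measure :: "('a \<Rightarrow> 'a \<Rightarrow> real) \<Rightarrow> 'a measure \<Rightarrow> bool" where
  "doubling_measure \<rho> \<mu> \<longleftrightarrow>
     (\<exists>C::real. \<forall>x. \<forall>r>0. emeasure \<mu> (qball \<rho> x (2 * r)) \<le> ennreal C * emeasure \<mu> (qball \<rho> x r))"

definition homogeneous_type :: "('a \<Rightarrow> 'a \<Rightarrow> real) \<Rightarrow> real \<Rightarrow> 'a measure \<Rightarrow> bool" where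
  "homogeneous_type \<rho> K\<^sub>0 \<mu> \<longleftrightarrow>
     quasi_metric \<rho> K\<^sub>0 \<and> space \<mu> = UNIV \<and>
     (\<forall>x r. qball \<rho> x r \<in> sets \<mu>) \<and> doubling_measure \<rho> \<mu>"

text \<open>A set is open when it contains a ball around each of its points, so the balls around \<open>x\<close>
  form a basis of open neighbourhoods of \<open>x\<close> exactly when they are themselves open.
  The measure of a possibly non-measurable set is its outer measure.\<close>

definition balls_open :: "('a \<Rightarrow> 'a \<Rightarrow> real) \<Rightarrow> bool" where
  "balls_open \<rho> \<longleftrightarrow> (\<forall>x. \<forall>r>0. qopen \<rho> (qball \<rho> x r))"

definition borel_regular :: "('a \<Rightarrow> 'a \<Rightarrow> real) \<Rightarrow> 'a measure \<Rightarrow> bool" where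
  "borel_regular \<rho> \<mu> \<longleftrightarrow>
     (\<forall>U. qopen \<rho> U \<longrightarrow> U \<in> sets \<mu>) \<and>
     (\<forall>A. \<exists>E\<in>qborel_sets \<rho>. A \<subseteq> E \<and> outer_measure_of \<mu> A = emeasure \<mu> E)"

definition basic_assumptions :: "('a \<Rightarrow> 'a \<Rightarrow> real) \<Rightarrow> 'a measure \<Rightarrow> bool" where
  "basic_assumptions \<rho> \<mu> \<longleftrightarrow>
     balls_open \<rho> \<and>
     borel_regular \<rho> \<mu> \<and>
     (\<forall>x. \<forall>r>0. 0 < emeasure \<mu> (qball \<rho> x r) \<and> emeasure \<mu> (qball \<rho> x r) < \<infinity>) \<and>
     qdiam \<rho> UNIV = \<infinity> \<and>
     (\<forall>x. emeasure \<mu> {x} = 0)"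

definition monotone_geodesic :: "('a \<Rightarrow> 'a \<Rightarrow> real) \<Rightarrow> bool" where
  "monotone_geodesic \<rho> \<longleftrightarrow>
     (\<exists>K'>0. \<forall>s>0. \<forall>x y. \<rho> x y \<ge> s \<longrightarrow>
        (\<exists>(m::nat) \<xi>. \<xi> 0 = x \<and> \<xi> m = y \<and>
           (\<forall>i<m. \<rho> (\<xi> i) (\<xi> (Suc i)) \<le> K' * s \<and> \<rho> (\<xi> (Suc i)) (\<xi> m) \<le> \<rho> (\<xi> i) (\<xi> m) - s)))"

definition par_dist :: "real \<Rightarrow> ('a \<Rightarrow> 'a \<Rightarrow> real) \<Rightarrow> 'a \<times> real \<Rightarrow> 'a \<times> real \<Rightarrow> real" where
  "par_dist p \<rho> = (\<lambda>(x, t) (y, s). max (\<rho> x y) (\<bar>t - s\<bar> powr (1 / p)))"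

definition par_measure :: "'a measure \<Rightarrow> ('a \<times> real) measure" where
  "par_measure \<mu> = \<mu> \<Otimes>\<^sub>M lebesgue"

definition cyl :: "real \<Rightarrow> ('a \<Rightarrow> 'a \<Rightarrow> real) \<Rightarrow> 'a \<Rightarrow> real \<Rightarrow> real \<Rightarrow> ('a \<times> real) set" where
  "cyl p \<rho> x t l = qball \<rho> x l \<times> {t - l powr p<..<t + l powr p}"

definition cyl_minus :: "real \<Rightarrow> ('a \<Rightarrow> 'a \<Rightarrow> real) \<Rightarrow> 'a \<Rightarrow> real \<Rightarrow> real \<Rightarrow> ('a \<times> real) set" where
  "cyl_minus p \<rho> x t l = qball \<rho> x l \<times> {t - l powr p<..<t}"

definition cyl_plus :: "real \<Rightarrow> ('a \<Rightarrow> 'a \<Rightarrow> real) \<Rightarrow> 'a \<Rightarrow> real \<Rightarrow> real \<Rightarrow> ('a \<times> real) set" where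
  "cyl_plus p \<rho> x t l = qball \<rho> x l \<times> {t<..<t + l powr p}"

text \<open>Averages and norms take values in \<open>[0, \<infinity>]\<close>, since for instance \<open>\<omega> powr (1 - q')\<close> need not be
  integrable on a cylinder. The power \<open>x\<^sup>a\<close> of \<open>x \<in> [0, \<infinity>]\<close> is only used for \<open>a > 0\<close>.\<close>

definition ennpow :: "ennreal \<Rightarrow> real \<Rightarrow> ennreal" where
  "ennpow x a = (if x = \<infinity> then \<infinity> else ennreal (enn2real x powr a))"

definition avg :: "'b measure \<Rightarrow> 'b set \<Rightarrow> ('b \<Rightarrow> real) \<Rightarrow> ennreal" where
  "avg M E g = (\<integral>\<^sup>+z\<in>E. ennreal (g z) \<partial>M) / emeasure M E"

definition weight :: "real \<Rightarrow> ('a \<Rightarrow> 'a \<Rightarrow> real) \<Rightarrow> 'a measure \<Rightarrow> ('a \<times> real \<Rightarrow> real) \<Rightarrow> bool" where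
  "weight p \<rho> \<mu> \<omega> \<longleftrightarrow>
     \<omega> \<in> borel_measurable (par_measure \<mu>) \<and>
     (AE z in par_measure \<mu>. 0 < \<omega> z) \<and>
     (\<forall>x t. \<exists>r>0. set_integrable (par_measure \<mu>) (cyl p \<rho> x t r) \<omega>)"

definition conj_exp :: "real \<Rightarrow> real" where
  "conj_exp q = q / (q - 1)"

definition A_plus :: "real \<Rightarrow> ('a \<Rightarrow> 'a \<Rightarrow> real) \<Rightarrow> 'a measure \<Rightarrow> real \<Rightarrow> ('a \<times> real \<Rightarrow> real) set" where
  "A_plus p \<rho> \<mu> q = {\<omega>. weight p \<rho> \<mu> \<omega> \<and>
     (SUP (x, t, l) \<in> UNIV \<times> UNIV \<times> {0<..}.
        avg (par_measure \<mu>) (cyl_minus p \<rho> x t l) \<omega> *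
        ennpow (avg (par_measure \<mu>) (cyl_plus p \<rho> x t l) (\<lambda>z. \<omega> z powr (1 - conj_exp q))) (q - 1)) < \<infinity>}"

text \<open>In the dyadic systems, \<open>I k \<tau>\<close> is the index set of the generation-\<open>k\<close> cubes \<open>Q k \<tau> \<alpha>\<close> of the
  \<open>\<tau>\<close>-th system, with reference points \<open>z k \<tau> \<alpha>\<close>. The cubes are required to be measurable, as is
  implicit in forming averages over rectangles.\<close>

definition adjacent_dyadic_systems ::
  "('a \<Rightarrow> 'a \<Rightarrow> real) \<Rightarrow> real \<Rightarrow> 'a measure \<Rightarrow> real \<Rightarrow> real \<Rightarrow> real \<Rightarrow> nat \<Rightarrow>
   (int \<Rightarrow> nat \<Rightarrow> 'i set) \<Rightarrow> (int \<Rightarrow> nat \<Rightarrow> 'i \<Rightarrow> 'a) \<Rightarrow> (int \<Rightarrow> nat \<Rightarrow> 'i \<Rightarrow> 'a set) \<Rightarrow> bool" where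
  "adjacent_dyadic_systems \<rho> K\<^sub>0 \<mu> \<delta> c\<^sub>0 C\<^sub>0 K I z Q \<longleftrightarrow>
     0 < \<delta> \<and> \<delta> < 1 \<and> 96 * K\<^sub>0 ^ 6 * \<delta> \<le> 1 \<and>
     0 < c\<^sub>0 \<and> c\<^sub>0 \<le> C\<^sub>0 \<and> 12 * K\<^sub>0 ^ 3 * C\<^sub>0 * \<delta> \<le> c\<^sub>0 \<and>
     (let c\<^sub>1 = c\<^sub>0 / (3 * K\<^sub>0\<^sup>2); C\<^sub>1 = 2 * K\<^sub>0 * C\<^sub>0 in
       (\<forall>\<tau>\<in>{1..K}.
         (\<forall>k. \<forall>\<alpha>\<in>I k \<tau>. Q k \<tau> \<alpha> \<in> sets \<mu>) \<and>
         (\<forall>k. \<forall>\<alpha>\<in>I k \<tau>. \<forall>\<beta>\<in>I k \<tau>. \<alpha> \<noteq> \<beta> \<longrightarrow> \<rho> (z k \<tau> \<alpha>) (z k \<tau> \<beta>) \<ge> c\<^sub>0 * \<delta> powi k) \<and>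
         (\<forall>k x. \<exists>\<alpha>\<in>I k \<tau>. \<rho> x (z k \<tau> \<alpha>) < C\<^sub>0 * \<delta> powi k) \<and>
         (\<forall>k l. k \<le> l \<longrightarrow> (\<forall>\<alpha>\<in>I k \<tau>. \<forall>\<beta>\<in>I l \<tau>.
             Q l \<tau> \<beta> \<subseteq> Q k \<tau> \<alpha> \<or> Q l \<tau> \<beta> \<inter> Q k \<tau> \<alpha> = {})) \<and>
         (\<forall>k. disjoint_family_on (Q k \<tau>) (I k \<tau>) \<and> (\<Union>\<alpha>\<in>I k \<tau>. Q k \<tau> \<alpha>) = UNIV) \<and>
         (\<forall>k. \<forall>\<alpha>\<in>I k \<tau>.
             qball \<rho> (z k \<tau> \<alpha>) (c\<^sub>1 * \<delta> powi k) \<subseteq> Q k \<tau> \<alpha> \<and>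
             Q k \<tau> \<alpha> \<subseteq> qball \<rho> (z k \<tau> \<alpha>) (C\<^sub>1 * \<delta> powi k)) \<and>
         (\<forall>k l. k \<le> l \<longrightarrow> (\<forall>\<alpha>\<in>I k \<tau>. \<forall>\<beta>\<in>I l \<tau>. Q l \<tau> \<beta> \<subseteq> Q k \<tau> \<alpha> \<longrightarrow>
             qball \<rho> (z l \<tau> \<beta>) (C\<^sub>1 * \<delta> powi l) \<subseteq> qball \<rho> (z k \<tau> \<alpha>) (C\<^sub>1 * \<delta> powi k)))) \<and>
       (\<exists>C>0. \<forall>x. \<forall>r>0. \<exists>\<tau>\<in>{1..K}. \<exists>k. \<exists>\<alpha>\<in>I k \<tau>.
          qball \<rho> x r \<subseteq> Q k \<tau> \<alpha> \<and> qdiam \<rho> (Q k \<tau> \<alpha>) \<le> ennreal (C * r)))"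

definition rect_plus :: "real \<Rightarrow> real \<Rightarrow> (int \<Rightarrow> nat \<Rightarrow> 'i \<Rightarrow> 'a set) \<Rightarrow> nat \<Rightarrow> int \<Rightarrow> 'i \<Rightarrow> real \<Rightarrow> ('a \<times> real) set" where
  "rect_plus p \<delta> Q \<tau> k \<alpha> t = Q k \<tau> \<alpha> \<times> {t<..<t + \<delta> powr (real_of_int k * p)}"

definition max_plus ::
  "real \<Rightarrow> 'a measure \<Rightarrow> real \<Rightarrow> nat \<Rightarrow> (int \<Rightarrow> nat \<Rightarrow> 'i set) \<Rightarrow> (int \<Rightarrow> nat \<Rightarrow> 'i \<Rightarrow> 'a set) \<Rightarrow>
   ('a \<times> real \<Rightarrow> real) \<Rightarrow> 'a \<times> real \<Rightarrow> ennreal" where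
  "max_plus p \<mu> \<delta> K I Q f = (\<lambda>(x, t).
     SUP (\<tau>, k, \<alpha>) \<in> {(\<tau>, k, \<alpha>). \<tau> \<in> {1..K} \<and> \<alpha> \<in> I k \<tau> \<and> x \<in> Q k \<tau> \<alpha>}.
       avg (par_measure \<mu>) (rect_plus p \<delta> Q \<tau> k \<alpha> t) (\<lambda>z. \<bar>f z\<bar>))"

definition Lq_norm :: "'b measure \<Rightarrow> ('b \<Rightarrow> real) \<Rightarrow> real \<Rightarrow> ('b \<Rightarrow> real) \<Rightarrow> ennreal" where
  "Lq_norm M \<omega> q f = ennpow (\<integral>\<^sup>+z. ennreal (\<bar>f z\<bar> powr q * \<omega> z) \<partial>M) (1 / q)"

definition Lq_space :: "'b measure \<Rightarrow> ('b \<Rightarrow> real) \<Rightarrow> real \<Rightarrow> ('b \<Rightarrow> real) set" where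
  "Lq_space M \<omega> q = {f \<in> borel_measurable M. Lq_norm M \<omega> q f < \<infinity>}"

definition weak_Lq_norm :: "'b measure \<Rightarrow> ('b \<Rightarrow> real) \<Rightarrow> real \<Rightarrow> ('b \<Rightarrow> ennreal) \<Rightarrow> ennreal" where
  "weak_Lq_norm M \<omega> q g =
     (SUP \<xi>\<in>{0::real<..}. ennreal \<xi> * ennpow (\<integral>\<^sup>+z\<in>{z \<in> space M. ennreal \<xi> < g z}. ennreal (\<omega> z) \<partial>M) (1 / q))"

definition bounded_Lq_weak_Lq ::
  "'b measure \<Rightarrow> ('b \<Rightarrow> real) \<Rightarrow> real \<Rightarrow> (('b \<Rightarrow> real) \<Rightarrow> 'b \<Rightarrow> ennreal) \<Rightarrow> bool" where
  "bounded_Lq_weak_Lq M \<omega> q T \<longleftrightarrow>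
     (\<exists>C::real. \<forall>f\<in>Lq_space M \<omega> q. weak_Lq_norm M \<omega> q (T f) \<le> ennreal C * Lq_norm M \<omega> q f)"

end

(* Sufficiency. For a cell P = Q x (t - h, t + h) with halves lower P and upper P, the A_q condition
   gives omega(lower P) <= C xi^(-q) * (integral over F of |f|^q omega) whenever F is a part of upper P
   carrying a fixed share of the mass xi * lambda(P); instead of Hoelder's inequality this uses the
   pointwise bound f <= c sigma + c^(1-q) f^q omega with sigma = omega^(1-q') and an optimal constant c.
   The set {M f > xi} is, up to a null set, a countable union of lower halves of cells whose average
   exceeds xi, because the times in an exceptional set are isolated from the right. For a finite
   subfamily one passes to stopping cells (the parent average is at most xi) and then to a subfamily
   S without redundant lower halves. Among the elements of S, cells of one level overlap at most
   twice, and a cell meeting a coarser one must cross an end of its time interval; as the heights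
   decay at least by 1/96 per level, the crossing cells have a small total volume. This gives a
   Carleson packing condition, hence parts F(P) of the upper halves with bounded overlap which keep
   half of the mass, and the estimates can be summed.

   Necessity. By the monotone geodesic property annuli are nonempty, so every ball B(x, l) lies in a
   cube of comparable size whose rectangle over any point of R^- contains R^+. Testing the weak type
   inequality on sigma truncated to R^+ gives the A_q condition. *)

theory Submission
  imports Defs
begin

section \<open>Packing of dyadic space-time cells\<close>

text \<open>Time is what prevents a classical dyadic selection. The cubes in the space variable are
  nested, but the central time of a rectangle is an arbitrary real, so two cells over nested cubes
  may overlap without either containing the other, and choosing maximal cells does not make the
  family disjoint. Partial overlap in time happens only near the two ends of the coarser interval,
  in strips as thin as the finer one; their share of the coarser volume decays like
  \<open>\<eta> ^ j\<close> after \<open>j\<close> levels. The second obstacle is that the weight is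
  counted on lower halves while the mass of the function sits on upper halves. Thinning makes the
  lower halves sparse, but the upper ones may still pile up. A packing condition speaks of volumes
  only, and it carries over to the upper halves because the two halves of a cell are translates by
  the height of the cell. This is why packing, and not disjointness, is the property to aim
  at.\<close>

lemma countable_right_cover:
  fixes T :: "real set" and h :: real
  assumes "0 < h"
  obtains T\<^sub>0 N where "T\<^sub>0 \<subseteq> T" "countable T\<^sub>0" "countable N" "T \<subseteq> N \<union> (\<Union>t\<in>T\<^sub>0. {t - h<..<t})"
proof -
  define \<U> where "\<U> = (\<lambda>t. {t - h<..<t}) ` T"
  have "\<And>U. U \<in> \<U> \<Longrightarrow> open U" by (auto simp: \<U>_def)
  then obtain \<F> where \<F>: "\<F> \<subseteq> \<U>" "countable \<F>" "\<Union>\<F> = \<Union>\<U>"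
    by (rule Lindelof)
  then obtain T\<^sub>0 where T\<^sub>0: "T\<^sub>0 \<subseteq> T" "countable T\<^sub>0" "\<F> = (\<lambda>t. {t - h<..<t}) ` T\<^sub>0"
    using countable_subset_image[of \<F> "\<lambda>t. {t - h<..<t}" T] unfolding \<U>_def by blast
  have U: "(\<Union>t\<in>T. {t - h<..<t}) = (\<Union>t\<in>T\<^sub>0. {t - h<..<t})" using \<F>(3) T\<^sub>0(3) by (simp add: \<U>_def)
  define N where "N = T - (\<Union>t\<in>T\<^sub>0. {t - h<..<t})"
  have far: "s + h \<le> t" if "s \<in> N" "t \<in> N" "s < t" for s t
  proof (rule ccontr)
    assume "\<not> s + h \<le> t"
    then have "s \<in> (\<Union>t\<in>T. {t - h<..<t})" using that by (intro UN_I[of t]) (auto simp: N_def)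
    then show False using that(1) unfolding U by (simp add: N_def)
  qed
  \<comment> \<open>Points at mutual distance at least \<open>h\<close> fall into different cells of
    the lattice of step \<open>h\<close>, so the integer part numbers them.\<close>
  have "inj_on (\<lambda>s. \<lfloor>s / h\<rfloor>) N"
  proof (rule linorder_inj_onI)
    fix s t assume "s < t" "s \<in> N" "t \<in> N"
    then have "(s + h) / h \<le> t / h" using far[of s t] assms by (intro divide_right_mono) auto
    then have "s / h + 1 \<le> t / h" using assms by (simp add: add_divide_distrib)
    then show "\<lfloor>s / h\<rfloor> \<noteq> \<lfloor>t / h\<rfloor>" by linarith
  qed auto
  then have "countable N" by (rule countableI')
  then show ?thesis using that[of T\<^sub>0 N] T\<^sub>0 N_def by blast
qed

text \<open>Serves twice: with \<open>g = 1\<close> to count volumes of lower halves, and with the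
  weighted power of the function to sum the estimates of the single cells.\<close>

lemma sum_nn_integral_bounded_overlap:
  assumes "finite S" and A: "\<And>i. i \<in> S \<Longrightarrow> A i \<in> sets M" and E: "E \<in> sets M"
    and sub: "\<And>i. i \<in> S \<Longrightarrow> A i \<subseteq> E"
    and ov: "\<And>z. z \<in> E \<Longrightarrow> card {i \<in> S. z \<in> A i} \<le> N"
    and g: "g \<in> borel_measurable M"
  shows "(\<Sum>i\<in>S. \<integral>\<^sup>+z\<in>A i. g z \<partial>M) \<le> of_nat N * (\<integral>\<^sup>+z\<in>E. g z \<partial>M)"
proof -
  have "(\<Sum>i\<in>S. \<integral>\<^sup>+z\<in>A i. g z \<partial>M) = (\<integral>\<^sup>+z. (\<Sum>i\<in>S. g z * indicator (A i) z) \<partial>M)"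
    using A g by (subst nn_integral_sum) auto
  also have "\<dots> \<le> (\<integral>\<^sup>+z. of_nat N * (g z * indicator E z) \<partial>M)"
  proof (rule nn_integral_mono)
    fix z assume "z \<in> space M"
    have "(\<Sum>i\<in>S. indicator (A i) z :: ennreal) = of_nat (card {i \<in> S. z \<in> A i})"
      using \<open>finite S\<close> by (simp add: indicator_def sum.If_cases Int_def)
    also have "\<dots> \<le> of_nat N * indicator E z"
    proof (cases "z \<in> E")
      case False
      then have e: "{i \<in> S. z \<in> A i} = {}" using sub by blast
      show ?thesis unfolding e by simp
    qed (use ov in simp)
    finally have "(\<Sum>i\<in>S. indicator (A i) z :: ennreal) \<le> of_nat N * indicator E z" .
    then have "g z * (\<Sum>i\<in>S. indicator (A i) z) \<le> g z * (of_nat N * indicator E z)"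
      by (rule mult_left_mono) simp
    then show "(\<Sum>i\<in>S. g z * indicator (A i) z) \<le> of_nat N * (g z * indicator E z)"
      by (simp add: sum_distrib_left mult_ac)
  qed
  also have "\<dots> = of_nat N * (\<integral>\<^sup>+z\<in>E. g z \<partial>M)"
    using g E by (intro nn_integral_cmult) auto
  finally show ?thesis .
qed

lemma sum_UN_le:
  fixes f :: "'b \<Rightarrow> real"
  assumes "finite S" "\<And>i. i \<in> S \<Longrightarrow> finite (A i)" "\<And>i x. i \<in> S \<Longrightarrow> x \<in> A i \<Longrightarrow> 0 \<le> f x"
  shows "(\<Sum>x\<in>(\<Union>i\<in>S. A i). f x) \<le> (\<Sum>i\<in>S. \<Sum>x\<in>A i. f x)"
  using assms
proof (induction S rule: finite_induct)
  case (insert i S)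
  have "(\<Sum>x\<in>(\<Union>j\<in>insert i S. A j). f x) \<le> (\<Sum>x\<in>A i. f x) + (\<Sum>x\<in>(\<Union>j\<in>S. A j). f x)"
    using insert.prems insert.hyps by (simp add: sum_Un) (intro sum_nonneg, auto)
  then show ?case using insert by fastforce
qed simp

text \<open>Take a subfamily that is minimal under inclusion among those with the full union: a
  member covered by the others could still be dropped.\<close>

lemma finite_minimal_subfamily:
  assumes "finite F"
  obtains S where "S \<subseteq> F" "(\<Union>i\<in>S. A i) = (\<Union>i\<in>F. A i)" "\<And>i. i \<in> S \<Longrightarrow> \<not> A i \<subseteq> (\<Union>j\<in>S - {i}. A j)"
proof -
  define W where "W = {S. S \<subseteq> F \<and> (\<Union>i\<in>S. A i) = (\<Union>i\<in>F. A i)}"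
  have "finite W" "W \<noteq> {}" using assms by (auto simp: W_def)
  then obtain S where S: "S \<in> W" "\<And>S'. S' \<in> W \<Longrightarrow> \<not> S' \<subset> S"
    using finite_has_minimal[of W] by (metis order_less_le)
  have "\<not> A i \<subseteq> (\<Union>j\<in>S - {i}. A j)" if i: "i \<in> S" for i
  proof
    assume "A i \<subseteq> (\<Union>j\<in>S - {i}. A j)"
    then have "(\<Union>j\<in>S - {i}. A j) = (\<Union>j\<in>S. A j)" by blast
    then have "S - {i} \<in> W" using S(1) by (auto simp: W_def)
    then show False using S(2) i by blast
  qed
  then show ?thesis using that S(1) by (auto simp: W_def)
qed

text \<open>The time axis carries the completed measure. A countable cover by sets of finite
  \<open>lborel\<close> measure serves for it too, and sigma-finiteness of this second factor gives
  the volume of products.\<close>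

lemma sigma_finite_lebesgue: "sigma_finite_measure (lebesgue :: real measure)"
proof
  obtain A :: "real set set" where A: "countable A" "A \<subseteq> sets lborel" "\<Union>A = space lborel" "\<forall>a\<in>A. emeasure lborel a \<noteq> \<infinity>"
    using lborel.sigma_finite_countable by auto
  then show "\<exists>A::real set set. countable A \<and> A \<subseteq> sets lebesgue \<and> \<Union>A = space lebesgue \<and> (\<forall>a\<in>A. emeasure lebesgue a \<noteq> \<infinity>)"
    by (intro exI[of _ A]) (auto simp: emeasure_completion)
qed

lemma emeasure_times_lebesgue:
  assumes "A \<in> sets N" "B \<in> sets (lebesgue :: real measure)"
  shows "emeasure (N \<Otimes>\<^sub>M lebesgue) (A \<times> B) = emeasure N A * emeasure lebesgue B"
  using assms by (intro sigma_finite_measure.emeasure_pair_measure_Times sigma_finite_lebesgue)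

text \<open>One of the adjacent systems with the quasi-metric stripped away. Here
  \<open>\<eta>\<close> stands for \<open>\<delta> powr p\<close>, the factor by which heights
  shrink per level, and \<open>parent_vol\<close> is the only trace of doubling.\<close>

locale dyadic_grid =
  fixes \<mu> :: "'a measure" and I :: "int \<Rightarrow> 'i set" and Q :: "int \<Rightarrow> 'i \<Rightarrow> 'a set"
    and \<eta> D :: real
  assumes space_mu: "space \<mu> = UNIV"
    and cube_sets: "\<And>k a. a \<in> I k \<Longrightarrow> Q k a \<in> sets \<mu>"
    and cube_pos: "\<And>k a. a \<in> I k \<Longrightarrow> 0 < emeasure \<mu> (Q k a)"
    and cube_finite: "\<And>k a. a \<in> I k \<Longrightarrow> emeasure \<mu> (Q k a) < \<infinity>"
    and nested: "\<And>k l a b. k \<le> l \<Longrightarrow> a \<in> I k \<Longrightarrow> b \<in> I l \<Longrightarrow> Q l b \<inter> Q k a \<noteq> {} \<Longrightarrow> Q l b \<subseteq> Q k a"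
    and disjoint: "\<And>k. disjoint_family_on (Q k) (I k)"
    and cover: "\<And>k x. \<exists>a\<in>I k. x \<in> Q k a"
    and index_countable: "\<And>k. countable (I k)"
    and eta: "0 < \<eta>" "\<eta> \<le> 1 / 96"
    and D_pos: "0 < D"
    and parent_vol: "\<And>k a b. a \<in> I k \<Longrightarrow> b \<in> I (k - 1) \<Longrightarrow> Q k a \<subseteq> Q (k - 1) b \<Longrightarrow>
          measure \<mu> (Q (k - 1) b) * \<eta> powi (k - 1) \<le> D * (measure \<mu> (Q k a) * \<eta> powi k)"
begin

abbreviation M :: "('a \<times> real) measure" where "M \<equiv> \<mu> \<Otimes>\<^sub>M lebesgue"

text \<open>A cell is a triple of level, cube index and central time. The time ranges over all
  reals, so cells over one cube slide continuously.\<close>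

definition cells :: "(int \<times> 'i \<times> real) set" where
  "cells = {(k, a, t). a \<in> I k}"

definition upper :: "int \<times> 'i \<times> real \<Rightarrow> ('a \<times> real) set" where
  "upper = (\<lambda>(k, a, t). Q k a \<times> {t<..<t + \<eta> powi k})"

definition lower :: "int \<times> 'i \<times> real \<Rightarrow> ('a \<times> real) set" where
  "lower = (\<lambda>(k, a, t). Q k a \<times> {t - \<eta> powi k<..<t})"

text \<open>The volume of one half of the cell, common to \<open>upper\<close> and
  \<open>lower\<close>, and not that of the whole cell.\<close>

definition vol :: "int \<times> 'i \<times> real \<Rightarrow> real" where
  "vol = (\<lambda>(k, a, t). measure \<mu> (Q k a) * \<eta> powi k)"

abbreviation level :: "int \<times> 'i \<times> real \<Rightarrow> int" where "level \<equiv> fst"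

text \<open>This form has two uses: comparison with a single other member shows that no lower half
  contains another, and comparison with two members limits the overlap within one level.\<close>

definition irredundant :: "(int \<times> 'i \<times> real) set \<Rightarrow> bool" where
  "irredundant S \<longleftrightarrow> finite S \<and> S \<subseteq> cells \<and> (\<forall>P\<in>S. \<not> lower P \<subseteq> (\<Union>P'\<in>S - {P}. lower P'))"

lemma eta_powi_pos [simp]: "0 < \<eta> powi k"
  using eta by simp

lemma emeasure_cube: "a \<in> I k \<Longrightarrow> emeasure \<mu> (Q k a) = ennreal (measure \<mu> (Q k a))"
  using cube_finite by (simp add: emeasure_eq_ennreal_measure less_top)

lemma measure_cube_pos: "a \<in> I k \<Longrightarrow> 0 < measure \<mu> (Q k a)"
  using cube_pos[of a k] emeasure_cube[of a k] by (simp add: zero_less_measure_iff)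

lemma upper_sets [measurable]: "P \<in> cells \<Longrightarrow> upper P \<in> sets M"
  by (auto simp: cells_def upper_def intro!: cube_sets)

lemma lower_sets [measurable]: "P \<in> cells \<Longrightarrow> lower P \<in> sets M"
  by (auto simp: cells_def lower_def intro!: cube_sets)

lemma emeasure_cube_times:
  assumes "a \<in> I k" "s \<le> t"
  shows "emeasure M (Q k a \<times> {s<..<t}) = ennreal (measure \<mu> (Q k a) * (t - s))"
  using assms by (simp add: emeasure_times_lebesgue cube_sets emeasure_cube ennreal_mult)

lemma emeasure_upper: "P \<in> cells \<Longrightarrow> emeasure M (upper P) = ennreal (vol P)"
  using eta_powi_pos[of "fst P"] by (auto simp: cells_def upper_def vol_def emeasure_cube_times less_imp_le)

lemma emeasure_lower: "P \<in> cells \<Longrightarrow> emeasure M (lower P) = ennreal (vol P)"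
  using eta_powi_pos[of "fst P"] by (auto simp: cells_def lower_def vol_def emeasure_cube_times less_imp_le)

lemma vol_pos: "P \<in> cells \<Longrightarrow> 0 < vol P"
  by (auto simp: cells_def vol_def measure_cube_pos)

lemma vol_nonneg: "P \<in> cells \<Longrightarrow> 0 \<le> vol P"
  using vol_pos by (meson less_imp_le)

lemma irredundant_finite: "irredundant S \<Longrightarrow> finite S"
  and irredundant_cells: "irredundant S \<Longrightarrow> P \<in> S \<Longrightarrow> P \<in> cells"
  by (auto simp: irredundant_def)

lemma irredundant_subset:
  assumes "irredundant S" "S' \<subseteq> S"
  shows "irredundant S'"
proof -
  have "(\<Union>P'\<in>S' - {P}. lower P') \<subseteq> (\<Union>P'\<in>S - {P}. lower P')" for P using assms(2) by blast
  then have "\<not> lower P \<subseteq> (\<Union>P'\<in>S' - {P}. lower P')" if "P \<in> S'" for P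
    using that assms order_trans unfolding irredundant_def by blast
  moreover have "finite S'" using assms finite_subset unfolding irredundant_def by blast
  ultimately show ?thesis using assms unfolding irredundant_def by blast
qed

lemma irredundant_not_subset:
  "irredundant S \<Longrightarrow> P \<in> S \<Longrightarrow> P' \<in> S \<Longrightarrow> P \<noteq> P' \<Longrightarrow> \<not> lower P \<subseteq> lower P'"
  unfolding irredundant_def by blast

text \<open>Of three intervals of equal length with a common point, the middle one lies in the union
  of the other two.\<close>
lemma overlap_same_level:
  assumes S: "irredundant S"
  shows "card {P \<in> S. level P = k \<and> z \<in> lower P} \<le> 2"
proof (rule ccontr)
  let ?T = "{P \<in> S. level P = k \<and> z \<in> lower P}"
  assume "\<not> card ?T \<le> 2"
  obtain x s where z: "z = (x, s)" by (cases z)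
  obtain a where a: "a \<in> I k" "x \<in> Q k a" using cover by blast
  \<comment> \<open>Cubes of one level are disjoint, so all these cells stand over the cube of
    \<open>x\<close> and differ only in their times.\<close>
  have form: "P = (k, a, snd (snd P)) \<and> s < snd (snd P) \<and> snd (snd P) - \<eta> powi k < s" if PT: "P \<in> ?T" for P
  proof -
    obtain b t where P: "P = (k, b, t)" using PT by (metis (mono_tags, lifting) mem_Collect_eq prod.exhaust_sel)
    then have b: "b \<in> I k" "x \<in> Q k b" "s < t" "t - \<eta> powi k < s"
      using that irredundant_cells[OF S, of P] by (auto simp: z cells_def lower_def)
    then have "b = a" using disjoint[of k] a by (auto simp: disjoint_family_on_def)
    then show ?thesis using P b by simp
  qed
  have inj: "inj_on (\<lambda>P. snd (snd P)) ?T"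
  proof (rule inj_onI)
    fix P P' assume "P \<in> ?T" "P' \<in> ?T" "snd (snd P) = snd (snd P')"
    then show "P = P'" using form[of P] form[of P'] by simp
  qed
  define T where "T = (\<lambda>P. snd (snd P)) ` ?T"
  have "finite ?T" using irredundant_finite[OF S] by simp
  then have fin: "finite T" and card: "card T > 2"
    using \<open>\<not> card ?T \<le> 2\<close> card_image[OF inj] by (auto simp: T_def)
  let ?m = "Min T" and ?n = "Max T"
  have "T \<noteq> {}" using card by auto
  have "\<not> T \<subseteq> {?m, ?n}"
    using card card_mono[of "{?m, ?n}" T] card_insert_le_m1[of 2 "{?n}" ?m] by auto
  then obtain t where t: "t \<in> T" "t \<noteq> ?m" "t \<noteq> ?n" by blast
  have mn: "?m < t" "t < ?n" using t fin by (simp_all add: less_le)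
  have S_in: "(k, a, u) \<in> S" if "u \<in> T" for u using that form by (auto simp: T_def)
  have win: "s < u \<and> u - \<eta> powi k < s" if "u \<in> T" for u using that form by (auto simp: T_def)
  have mem: "?m \<in> T" "?n \<in> T" using fin \<open>T \<noteq> {}\<close> by auto
  \<comment> \<open>The common time \<open>s\<close> lies below \<open>?m\<close> and above
    \<open>?n - \<eta> powi k\<close>, so the earliest and the latest interval overlap and leave no
    gap around the middle one.\<close>
  have "lower (k, a, t) \<subseteq> lower (k, a, ?m) \<union> lower (k, a, ?n)"
    using mn win[OF mem(1)] win[OF mem(2)] by (auto simp: lower_def)
  then have "lower (k, a, t) \<subseteq> (\<Union>P'\<in>S - {(k, a, t)}. lower P')"
    using S_in[OF mem(1)] S_in[OF mem(2)] t by blast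
  then show False using S S_in[OF t(1)] by (auto simp: irredundant_def)
qed

section \<open>Crossing cells and the packing condition\<close>

definition crosses :: "int \<times> 'i \<times> real \<Rightarrow> int \<times> 'i \<times> real \<Rightarrow> bool" where
  "crosses = (\<lambda>(l, b, t) (k, a, t'). k < l \<and> Q l b \<subseteq> Q k a \<and>
     (t' \<in> {t - \<eta> powi l<..<t} \<or> t' - \<eta> powi k \<in> {t - \<eta> powi l<..<t}))"

text \<open>An open interval that meets another one without being contained in it has an end of the
  other in its interior. Containment is excluded by irredundancy, since the cubes are already
  nested.\<close>

lemma crossesI:
  assumes S: "irredundant S" and P: "P \<in> S" "P' \<in> S" "level P' < level P" "lower P \<inter> lower P' \<noteq> {}"
  shows "crosses P P'"
proof -
  obtain l b t k a t' where eq: "P = (l, b, t)" "P' = (k, a, t')" by (metis prod_cases3)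
  have mem: "b \<in> I l" "a \<in> I k" using S P irredundant_cells by (auto simp: eq cells_def)
  have "Q l b \<inter> Q k a \<noteq> {}" using P(4) by (auto simp: eq lower_def)
  then have sub: "Q l b \<subseteq> Q k a" using nested[of k l a b] mem P(3) by (auto simp: eq)
  have "P \<noteq> P'" using P(3) by auto
  then have "\<not> lower P \<subseteq> lower P'" by (rule irredundant_not_subset[OF S P(1,2)])
  then have "\<not> {t - \<eta> powi l<..<t} \<subseteq> {t' - \<eta> powi k<..<t'}" using sub by (auto simp: eq lower_def)
  moreover have "{t - \<eta> powi l<..<t} \<inter> {t' - \<eta> powi k<..<t'} \<noteq> {}"
    using P(4) by (auto simp: eq lower_def)
  ultimately have "t' \<in> {t - \<eta> powi l<..<t} \<or> t' - \<eta> powi k \<in> {t - \<eta> powi l<..<t}"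
    by (auto simp: subset_iff)
  then show ?thesis using sub P(3) by (simp add: crosses_def eq)
qed

lemma sum_vol_bounded_overlap:
  assumes "finite S" "S \<subseteq> cells" "E \<in> sets M" "emeasure M E \<le> ennreal m" "0 \<le> m"
    and "\<And>P. P \<in> S \<Longrightarrow> lower P \<subseteq> E"
    and "\<And>z. card {P \<in> S. z \<in> lower P} \<le> N"
  shows "(\<Sum>P\<in>S. vol P) \<le> N * m"
proof -
  have "ennreal (\<Sum>P\<in>S. vol P) = (\<Sum>P\<in>S. ennreal (vol P))"
    using assms(2) by (subst sum_ennreal) (auto intro: vol_nonneg)
  also have "\<dots> = (\<Sum>P\<in>S. \<integral>\<^sup>+z\<in>lower P. 1 \<partial>M)"
    using assms(2) by (intro sum.cong) (auto simp: emeasure_lower)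
  also have "\<dots> \<le> of_nat N * (\<integral>\<^sup>+z\<in>E. 1 \<partial>M)"
    using assms by (intro sum_nn_integral_bounded_overlap) auto
  also have "\<dots> \<le> of_nat N * ennreal m" using assms by (auto intro: mult_left_mono)
  also have "\<dots> = ennreal (N * m)" using assms(5) by (simp add: ennreal_mult ennreal_of_nat_eq_real_of_nat)
  finally show ?thesis using assms(5) by (simp add: ennreal_le_iff)
qed

text \<open>A crossing lower half of level \<open>l\<close> stays within
  \<open>\<eta> powi l\<close> of one of the two ends. The two strips have total height
  \<open>4 * \<eta> powi l\<close>, and overlap at most two within the level doubles this to
  8.\<close>

lemma sum_vol_crossing_level:
  assumes S: "irredundant S" and P': "(k, a, t') \<in> cells" and "k < l"
  shows "(\<Sum>P\<in>{P \<in> S. level P = l \<and> crosses P (k, a, t')}. vol P) \<le> 8 * (measure \<mu> (Q k a) * \<eta> powi l)"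
proof -
  let ?h = "\<eta> powi l" and ?s = "t' - \<eta> powi k"
  let ?A = "Q k a \<times> {t' - ?h<..<t' + ?h}" and ?B = "Q k a \<times> {?s - ?h<..<?s + ?h}"
  let ?m = "measure \<mu> (Q k a) * (2 * ?h)"
  have a: "a \<in> I k" using P' by (simp add: cells_def)
  have hp: "0 < ?h" by simp
  have "emeasure M (?A \<union> ?B) \<le> emeasure M ?A + emeasure M ?B"
    using a by (intro emeasure_subadditive) (auto intro: cube_sets)
  also have "\<dots> = ennreal ?m + ennreal ?m" using hp a by (subst (1 2) emeasure_cube_times) (auto simp: less_imp_le)
  also have "\<dots> = ennreal (2 * ?m)" using hp by (subst ennreal_plus[symmetric]) (auto simp: less_imp_le)
  finally have E: "emeasure M (?A \<union> ?B) \<le> ennreal (2 * ?m)" .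
  have "(\<Sum>P\<in>{P \<in> S. level P = l \<and> crosses P (k, a, t')}. vol P) \<le> real 2 * (2 * ?m)"
  proof (rule sum_vol_bounded_overlap[OF _ _ _ E])
    show "lower P \<subseteq> ?A \<union> ?B" if P: "P \<in> {P \<in> S. level P = l \<and> crosses P (k, a, t')}" for P
    proof -
      obtain b t where "P = (l, b, t)" using P by (metis (mono_tags) mem_Collect_eq prod.exhaust_sel)
      then show ?thesis using P by (auto simp: crosses_def lower_def)
    qed
    show "card {P \<in> {P \<in> S. level P = l \<and> crosses P (k, a, t')}. z \<in> lower P} \<le> 2" for z
      using overlap_same_level[OF irredundant_subset[OF S, of "{P \<in> S. level P = l \<and> crosses P (k, a, t')}"], of l z]
      by (simp cong: conj_cong add: conj_ac)
  qed (use S a in \<open>auto simp: irredundant_def intro!: cube_sets sets.Un pair_measureI mult_nonneg_nonneg less_imp_le[OF hp]\<close>)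
  then show ?thesis by (simp add: mult_ac)
qed

text \<open>Level \<open>k + j\<close> contributes at most \<open>8 * vol P' * \<eta> ^ j\<close>.
  The geometric series sums to \<eta> / (1 - \<eta>), which for \<eta> at most 1/96 is below 1/16,
  and 8 / 16 is the claimed half.\<close>

lemma sum_vol_crossing:
  assumes S: "irredundant S" and P': "P' \<in> cells"
  shows "(\<Sum>P\<in>{P \<in> S. crosses P P'}. vol P) \<le> vol P' / 2"
proof -
  obtain k a t' where eq: "P' = (k, a, t')" by (metis prod_cases3)
  have fin: "finite S" using S by (rule irredundant_finite)
  let ?T = "{P \<in> S. crosses P P'}"
  \<comment> \<open>Any common bound on the finitely many level differences will do; their sum is
    one.\<close>
  define N where "N = (\<Sum>P\<in>?T. nat (level P - k))"
  have lev: "k < level P \<and> level P \<le> k + N" if "P \<in> ?T" for P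
  proof -
    have "nat (level P - k) \<le> N" unfolding N_def using fin that by (intro member_le_sum) auto
    moreover have "k < level P" using that by (auto simp: crosses_def eq)
    ultimately show ?thesis by linarith
  qed
  have "(\<Sum>P\<in>?T. vol P) = (\<Sum>j\<in>{1..N}. \<Sum>P\<in>{P \<in> ?T. nat (level P - k) = j}. vol P)"
    using fin lev by (intro sum.group[symmetric]) fastforce+
  also have "\<dots> \<le> (\<Sum>j\<in>{1..N}. 8 * vol P' * \<eta> ^ j)"
  proof (rule sum_mono)
    fix j assume j: "j \<in> {1..N}"
    have "{P \<in> ?T. nat (level P - k) = j} = {P \<in> S. level P = k + int j \<and> crosses P (k, a, t')}"
      using j by (auto simp: eq crosses_def)
    moreover have "(\<Sum>P\<in>{P \<in> S. level P = k + int j \<and> crosses P (k, a, t')}. vol P)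
        \<le> 8 * (measure \<mu> (Q k a) * \<eta> powi (k + int j))"
      using j P' by (intro sum_vol_crossing_level[OF S]) (auto simp: eq)
    moreover have "\<eta> powi (k + int j) = \<eta> powi k * \<eta> ^ j" using eta by (simp add: power_int_add)
    ultimately show "(\<Sum>P\<in>{P \<in> ?T. nat (level P - k) = j}. vol P) \<le> 8 * vol P' * \<eta> ^ j"
      by (simp add: eq vol_def mult_ac)
  qed
  also have "\<dots> = 8 * vol P' * (\<Sum>j\<in>{1..N}. \<eta> ^ j)" by (simp add: sum_distrib_left)
  also have "\<dots> \<le> 8 * vol P' * (1 / 16)"
  proof (rule mult_left_mono)
    have "(\<Sum>j\<in>{1..N}. \<eta> ^ j) = \<eta> * (\<Sum>j<N. \<eta> ^ j)"
      by (simp add: sum_distrib_left sum.atLeast1_atMost_eq)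
    also have "\<dots> \<le> \<eta> * (\<Sum>j. \<eta> ^ j)"
      using eta by (intro mult_left_mono sum_le_suminf) auto
    also have "\<dots> = \<eta> / (1 - \<eta>)" using eta by (simp add: suminf_geometric)
    also have "\<dots> \<le> 1 / 16" using eta by (simp add: field_simps)
    finally show "(\<Sum>j\<in>{1..N}. \<eta> ^ j) \<le> 1 / 16" .
  qed (use vol_nonneg[OF P'] in simp)
  finally show ?thesis by simp
qed

text \<open>Cells that meet no coarser lower half overlap at most twice; every other cell is charged to
  a coarser one which it crosses, and the charged volumes are at most half of the total.\<close>
lemma carleson_packing:
  assumes S: "irredundant S" and E: "E \<in> sets M" "emeasure M E \<le> ennreal m" "0 \<le> m"
    and sub: "\<And>P. P \<in> S \<Longrightarrow> lower P \<subseteq> E"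
  shows "(\<Sum>P\<in>S. vol P) \<le> 4 * m"
proof -
  have fin: "finite S" and cells: "\<And>P. P \<in> S \<Longrightarrow> P \<in> cells"
    using S by (auto intro: irredundant_finite irredundant_cells)
  define S0 where "S0 = {P \<in> S. \<forall>P'\<in>S. level P' < level P \<longrightarrow> lower P \<inter> lower P' = {}}"
  have "S \<subseteq> S0 \<union> (\<Union>P'\<in>S. {P \<in> S. crosses P P'})"
  proof
    fix P assume "P \<in> S"
    then show "P \<in> S0 \<union> (\<Union>P'\<in>S. {P \<in> S. crosses P P'})"
      using crossesI[OF S, of P] unfolding S0_def by blast
  qed
  then have "(\<Sum>P\<in>S. vol P) \<le> (\<Sum>P\<in>S0 \<union> (\<Union>P'\<in>S. {P \<in> S. crosses P P'}). vol P)"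
    using fin cells by (intro sum_mono2) (auto simp: S0_def intro: vol_nonneg)
  also have "\<dots> \<le> (\<Sum>P\<in>S0. vol P) + (\<Sum>P\<in>(\<Union>P'\<in>S. {P \<in> S. crosses P P'}). vol P)"
    using fin cells by (subst sum_Un) (auto simp: S0_def intro!: sum_nonneg vol_nonneg)
  also have "(\<Sum>P\<in>(\<Union>P'\<in>S. {P \<in> S. crosses P P'}). vol P) \<le> (\<Sum>P'\<in>S. \<Sum>P\<in>{P \<in> S. crosses P P'}. vol P)"
    using fin cells by (intro sum_UN_le) (auto intro: vol_nonneg)
  also have "\<dots> \<le> (\<Sum>P'\<in>S. vol P' / 2)"
    using cells by (intro sum_mono sum_vol_crossing[OF S])
  also have "(\<Sum>P\<in>S0. vol P) \<le> real 2 * m"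
  proof (rule sum_vol_bounded_overlap[OF _ _ E])
    show "card {P \<in> S0. z \<in> lower P} \<le> 2" for z
    proof (cases "{P \<in> S0. z \<in> lower P} = {}")
      case False
      then obtain P0 where P0: "P0 \<in> S0" "z \<in> lower P0" by blast
      \<comment> \<open>Two members of \<open>S0\<close> through \<open>z\<close> have lower halves
        that meet, so neither can be finer than the other.\<close>
      have "{P \<in> S0. z \<in> lower P} \<subseteq> {P \<in> S. level P = level P0 \<and> z \<in> lower P}"
      proof
        fix P assume P: "P \<in> {P \<in> S0. z \<in> lower P}"
        then have "\<not> level P0 < level P" "\<not> level P < level P0" using P0 unfolding S0_def by blast+
        then show "P \<in> {P \<in> S. level P = level P0 \<and> z \<in> lower P}" using P by (simp add: S0_def)
      qed
      then have "card {P \<in> S0. z \<in> lower P} \<le> card {P \<in> S. level P = level P0 \<and> z \<in> lower P}"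
        using fin by (intro card_mono) auto
      also have "\<dots> \<le> 2" by (rule overlap_same_level[OF S])
      finally show ?thesis .
    next
      case True
      show ?thesis unfolding True by simp
    qed
  qed (use fin cells sub in \<open>auto simp: S0_def\<close>)
  \<comment> \<open>The total is at most \<open>2 * m\<close> plus half of itself; being a finite
    sum, it can be absorbed.\<close>
  finally show ?thesis by (simp flip: sum_divide_distrib)
qed

text \<open>Transfers the packing from lower to upper halves. If an upper half of the level of
  \<open>P0\<close> or finer meets \<open>upper P0\<close>, the lower half of that cell lies over
  the same cube and starts less than two heights of \<open>P0\<close> before the time of
  \<open>P0\<close>. It is thus contained in a box of volume \<open>3 * vol P0\<close>, and packing
  multiplies this by 4.\<close>

lemma sum_vol_finer:
  assumes S: "irredundant S" and P0: "P0 \<in> cells"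
  shows "(\<Sum>P\<in>{P \<in> S. level P0 \<le> level P \<and> upper P \<inter> upper P0 \<noteq> {}}. vol P) \<le> 12 * vol P0"
proof -
  let ?T = "{P \<in> S. level P0 \<le> level P \<and> upper P \<inter> upper P0 \<noteq> {}}"
  obtain k a t where eq: "P0 = (k, a, t)" by (metis prod_cases3)
  have a: "a \<in> I k" using P0 by (simp add: cells_def eq)
  let ?E = "Q k a \<times> {t - 2 * \<eta> powi k<..<t + \<eta> powi k}"
  have hp: "0 < \<eta> powi k" by simp
  have "(\<Sum>P\<in>?T. vol P) \<le> 4 * (3 * vol P0)"
  proof (rule carleson_packing)
    show "irredundant ?T" by (rule irredundant_subset[OF S]) auto
    show "?E \<in> sets M" using a by (auto intro: cube_sets)
    show "emeasure M ?E \<le> ennreal (3 * vol P0)"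
      using a hp by (subst emeasure_cube_times) (auto simp: eq vol_def less_imp_le algebra_simps)
    show "0 \<le> 3 * vol P0" using vol_nonneg[OF P0] by simp
    show "lower P \<subseteq> ?E" if "P \<in> ?T" for P
    proof -
      obtain l b s where P: "P = (l, b, s)" by (metis prod_cases3)
      have b: "b \<in> I l" using that irredundant_cells[OF S] by (auto simp: P cells_def)
      have kl: "k \<le> l" using that by (simp add: eq P)
      have "Q l b \<subseteq> Q k a" using that nested[OF kl a b] by (auto simp: eq P upper_def)
      moreover have "\<eta> powi l \<le> \<eta> powi k" using kl eta by (intro power_int_decreasing) auto
      moreover have "\<exists>u. s < u \<and> u < s + \<eta> powi l \<and> t < u \<and> u < t + \<eta> powi k"
        using that by (auto simp: eq P upper_def)
      ultimately show ?thesis by (auto simp: P lower_def)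
    qed
  qed
  then show ?thesis by simp
qed

end

section \<open>Parts of bounded overlap and stopping cells\<close>

text \<open>Let \<sigma> be the dual weight \<open>w powr (1 - conj_exp q)\<close>. If
  \<open>f\<close> exceeds c \<sigma>, raise this to the power \<open>q - 1\<close>: since \<sigma>
  to this power is \<open>1 / w\<close>, the result says that the second term alone dominates
  \<open>f\<close>.\<close>

lemma young_duality:
  fixes f w c q :: real
  assumes "0 \<le> f" "0 < w" "1 < q" "0 < c"
  shows "f \<le> c * w powr (1 - conj_exp q) + c powr (1 - q) * (f powr q * w)"
proof (cases "f \<le> c * w powr (1 - conj_exp q)")
  case True
  then show ?thesis using assms by (smt (verit) mult_nonneg_nonneg powr_ge_zero)
next
  case False
  have e: "(1 - conj_exp q) * (q - 1) = -1" using assms(3) by (simp add: conj_exp_def field_simps)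
  have f: "0 < f" using False assms by (smt (verit) mult_nonneg_nonneg powr_ge_zero)
  have "(c * w powr (1 - conj_exp q)) powr (q - 1) \<le> f powr (q - 1)"
    using False assms by (intro powr_mono2) auto
  then have "c powr (q - 1) * w powr (-1) \<le> f powr (q - 1)"
    using assms by (simp add: powr_mult powr_powr e)
  then have "c powr (q - 1) \<le> f powr (q - 1) * w"
    using assms by (simp add: powr_minus field_simps)
  then have "c powr (1 - q) * f * c powr (q - 1) \<le> c powr (1 - q) * f * (f powr (q - 1) * w)"
    using f by (intro mult_left_mono) auto
  moreover have "c powr (1 - q) * c powr (q - 1) = 1" using assms by (simp flip: powr_add)
  moreover have "f * f powr (q - 1) = f powr q" using f by (simp add: powr_mult_base)
  ultimately have "f \<le> c powr (1 - q) * (f powr q * w)" by (simp add: mult_ac) (metis mult.assoc mult.commute mult.right_neutral)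
  then show ?thesis using assms by (smt (verit) mult_nonneg_nonneg powr_ge_zero)
qed

context dyadic_grid
begin

text \<open>Chebyshev's inequality for the overlap function: the part of an upper half that is covered by
  more than \<open>N\<close> finer upper halves carries at most half of the mass.\<close>
lemma bounded_overlap_parts:
  fixes f :: "'a \<times> real \<Rightarrow> ennreal"
  assumes S: "irredundant S" and f: "f \<in> borel_measurable M" and xi: "0 < \<xi>"
    and lo: "\<And>P. P \<in> S \<Longrightarrow> ennreal (\<xi> * vol P) \<le> (\<integral>\<^sup>+z\<in>upper P. f z \<partial>M)"
    and hi: "\<And>P. P \<in> S \<Longrightarrow> (\<integral>\<^sup>+z\<in>upper P. f z \<partial>M) \<le> ennreal (D * \<xi> * vol P)"
    and N: "24 * D \<le> real N"
  obtains F where "\<And>P. P \<in> S \<Longrightarrow> F P \<in> sets M" "\<And>P. P \<in> S \<Longrightarrow> F P \<subseteq> upper P"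
    "\<And>z. card {P \<in> S. z \<in> F P} \<le> N"
    "\<And>P. P \<in> S \<Longrightarrow> ennreal (\<xi> * vol P / 2) \<le> (\<integral>\<^sup>+z\<in>F P. f z \<partial>M)"
proof -
  have fin: "finite S" and cells: "\<And>P. P \<in> S \<Longrightarrow> P \<in> cells"
    using S by (auto intro: irredundant_finite irredundant_cells)
  \<comment> \<open>The count includes \<open>P\<close> itself and all cells of its level; coarser
    cells are left out, as the packing bound controls finer ones only.\<close>
  define n where "n = (\<lambda>P z. card {P' \<in> S. level P \<le> level P' \<and> z \<in> upper P'})"
  define F where "F = (\<lambda>P. {z \<in> upper P. n P z \<le> N})"
  have n_meas: "{z \<in> space M. n P z \<le> N} \<in> sets M" for P
  proof -
    have n_eq: "real (n P z) = (\<Sum>P'\<in>{P' \<in> S. level P \<le> level P'}. indicator (upper P') z)" for z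
      using fin by (simp add: n_def indicator_def sum.If_cases Int_def conj_ac)
    have "(\<lambda>z. real (n P z)) \<in> borel_measurable M"
      unfolding n_eq using cells by (intro borel_measurable_sum borel_measurable_indicator upper_sets) auto
    then have "{z \<in> space M. real (n P z) \<le> real N} \<in> sets M" by measurable
    then show ?thesis by simp
  qed
  have F_meas: "F P \<in> sets M" if "P \<in> S" for P
  proof -
    have "F P = upper P \<inter> {z \<in> space M. n P z \<le> N}"
      using sets.sets_into_space[OF upper_sets[OF cells[OF that]]] by (auto simp: F_def)
    then show ?thesis using n_meas upper_sets[OF cells[OF that]] by auto
  qed
  have overlap: "card {P \<in> S. z \<in> F P} \<le> N" for z
  proof (cases "{P \<in> S. z \<in> F P} = {}")
    case True
    show ?thesis unfolding True by simp
  next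
    case False
    \<comment> \<open>Among the cells whose part contains \<open>z\<close> take a coarsest one: its
      counter \<open>n P0 z\<close> already sees all the others.\<close>
    then obtain P0 where P0: "P0 \<in> S" "z \<in> F P0" and min: "\<And>P. P \<in> S \<Longrightarrow> z \<in> F P \<Longrightarrow> level P0 \<le> level P"
      using ex_min_if_finite[of "level ` {P \<in> S. z \<in> F P}"] fin
      by (auto simp: not_less image_iff)
    have "{P \<in> S. z \<in> F P} \<subseteq> {P' \<in> S. level P0 \<le> level P' \<and> z \<in> upper P'}"
      using min by (auto simp: F_def)
    then have "card {P \<in> S. z \<in> F P} \<le> n P0 z"
      unfolding n_def using fin by (intro card_mono) auto
    also have "\<dots> \<le> N" using P0 by (simp add: F_def)
    finally show ?thesis .
  qed
  have mass: "ennreal (\<xi> * vol P / 2) \<le> (\<integral>\<^sup>+z\<in>F P. f z \<partial>M)" if P: "P \<in> S" for P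
  proof -
    let ?T = "{P' \<in> S. level P \<le> level P' \<and> upper P' \<inter> upper P \<noteq> {}}"
    define G where "G = upper P - F P"
    have G_meas: "G \<in> sets M" using upper_sets[OF cells[OF P]] F_meas[OF P] by (auto simp: G_def)
    have vP: "0 \<le> vol P" using vol_nonneg[OF cells[OF P]] .
    \<comment> \<open>Every point of the discarded set \<open>G\<close> lies in more than
      \<open>N\<close> of the upper halves in \<open>?T\<close>, so \<open>N\<close> times its mass
      is at most the sum of their masses.\<close>
    have "of_nat N * (\<integral>\<^sup>+z\<in>G. f z \<partial>M) = (\<integral>\<^sup>+z. of_nat N * (f z * indicator G z) \<partial>M)"
      using f G_meas by (intro nn_integral_cmult[symmetric]) auto
    also have "\<dots> \<le> (\<integral>\<^sup>+z. (\<Sum>P'\<in>?T. f z * indicator (upper P') z) \<partial>M)"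
    proof (rule nn_integral_mono)
      fix z
      have "of_nat N * indicator G z \<le> (\<Sum>P'\<in>?T. indicator (upper P') z :: ennreal)"
      proof (cases "z \<in> G")
        case True
        then have z: "z \<in> upper P" "N < n P z" by (auto simp: G_def F_def)
        have "{P' \<in> S. level P \<le> level P' \<and> z \<in> upper P'} = {P' \<in> ?T. z \<in> upper P'}"
          using z(1) by auto
        then have "n P z = card {P' \<in> ?T. z \<in> upper P'}" by (simp add: n_def)
        then have "N \<le> card {P' \<in> ?T. z \<in> upper P'}" using z(2) by simp
        then have "(of_nat N :: ennreal) \<le> of_nat (card {P' \<in> ?T. z \<in> upper P'})" by simp
        also have "\<dots> = (\<Sum>P'\<in>?T. indicator (upper P') z)"
          using fin by (simp add: indicator_def sum.If_cases Int_def conj_ac)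
        finally show ?thesis using True by simp
      qed simp
      then have "f z * (of_nat N * indicator G z) \<le> f z * (\<Sum>P'\<in>?T. indicator (upper P') z)"
        by (rule mult_left_mono) simp
      then show "of_nat N * (f z * indicator G z) \<le> (\<Sum>P'\<in>?T. f z * indicator (upper P') z)"
        by (simp add: sum_distrib_left mult_ac)
    qed
    also have "\<dots> = (\<Sum>P'\<in>?T. \<integral>\<^sup>+z\<in>upper P'. f z \<partial>M)"
      using f cells by (intro nn_integral_sum) auto
    also have "\<dots> \<le> (\<Sum>P'\<in>?T. ennreal (D * \<xi> * vol P'))" by (intro sum_mono hi) simp
    also have "\<dots> = ennreal (\<Sum>P'\<in>?T. D * \<xi> * vol P')"
      using D_pos xi cells by (intro sum_ennreal mult_nonneg_nonneg vol_nonneg) auto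
    also have "\<dots> = ennreal (D * \<xi> * (\<Sum>P'\<in>?T. vol P'))" by (simp add: sum_distrib_left)
    also have "\<dots> \<le> ennreal (D * \<xi> * (12 * vol P))"
      using D_pos xi sum_vol_finer[OF S cells[OF P]] by (intro ennreal_leI mult_left_mono) auto
    \<comment> \<open>Origin of the threshold \<open>24 * D\<close>: a factor 12 from the packing of
      finer cells, and a factor 2 because only half of the mass may be lost.\<close>
    also have "\<dots> \<le> ennreal (N * (\<xi> * vol P / 2))"
    proof (rule ennreal_leI)
      have "24 * D * (\<xi> * vol P / 2) \<le> N * (\<xi> * vol P / 2)"
        using N xi vP by (intro mult_right_mono) auto
      then show "D * \<xi> * (12 * vol P) \<le> N * (\<xi> * vol P / 2)" by simp
    qed
    finally have NG: "of_nat N * (\<integral>\<^sup>+z\<in>G. f z \<partial>M) \<le> ennreal (N * (\<xi> * vol P / 2))" .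
    have "0 < real N" using N D_pos by linarith
    have "(\<integral>\<^sup>+z\<in>G. f z \<partial>M) \<le> (\<integral>\<^sup>+z\<in>upper P. f z \<partial>M)"
      by (intro nn_integral_mono) (auto simp: G_def indicator_def)
    also have "\<dots> < \<infinity>" using hi[OF P] by (simp add: le_less_trans)
    finally obtain g where g: "(\<integral>\<^sup>+z\<in>G. f z \<partial>M) = ennreal g" "0 \<le> g"
      by (cases "\<integral>\<^sup>+z\<in>G. f z \<partial>M") auto
    have "ennreal (N * g) \<le> ennreal (N * (\<xi> * vol P / 2))"
      using NG g by (simp add: ennreal_mult ennreal_of_nat_eq_real_of_nat)
    then have "N * g \<le> N * (\<xi> * vol P / 2)" using xi vP by (subst (asm) ennreal_le_iff) auto
    then have g_le: "g \<le> \<xi> * vol P / 2" using \<open>0 < real N\<close> by simp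
    have "(\<integral>\<^sup>+z\<in>upper P. f z \<partial>M) = (\<integral>\<^sup>+z. f z * indicator (F P) z + f z * indicator G z \<partial>M)"
      by (intro nn_integral_cong) (auto simp: G_def F_def indicator_def)
    also have "\<dots> = (\<integral>\<^sup>+z\<in>F P. f z \<partial>M) + ennreal g"
      using f F_meas[OF P] G_meas by (subst nn_integral_add) (auto simp: g)
    finally have sum: "ennreal (\<xi> * vol P) \<le> (\<integral>\<^sup>+z\<in>F P. f z \<partial>M) + ennreal g" using lo[OF P] by simp
    show ?thesis
    proof (cases "\<integral>\<^sup>+z\<in>F P. f z \<partial>M")
      case (real r)
      then have "\<xi> * vol P \<le> r + g" using sum g(2) by (simp flip: ennreal_plus)
      then show ?thesis using real g_le by (auto intro!: ennreal_leI)
    qed simp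
  qed
  show ?thesis using that[of F] F_meas overlap mass by (auto simp: F_def)
qed

text \<open>The stopping cell is the last one, going up the chain of ancestors with the same time, before
  the average first drops to at most \<open>\<xi>\<close>; it does so because the volumes grow geometrically.\<close>
lemma stopping_ancestor:
  fixes f :: "'a \<times> real \<Rightarrow> ennreal"
  assumes P: "P \<in> cells" and xi: "0 < \<xi>" and fin: "(\<integral>\<^sup>+z. f z \<partial>M) < \<infinity>"
    and good: "ennreal (\<xi> * vol P) < (\<integral>\<^sup>+z\<in>upper P. f z \<partial>M)"
  obtains P' where "P' \<in> cells" "lower P \<subseteq> lower P'" "ennreal (\<xi> * vol P') < (\<integral>\<^sup>+z\<in>upper P'. f z \<partial>M)"
    "(\<integral>\<^sup>+z\<in>upper P'. f z \<partial>M) \<le> ennreal (D * \<xi> * vol P')"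
proof -
  obtain k a t where eq: "P = (k, a, t)" by (metis prod_cases3)
  have a: "a \<in> I k" using P by (simp add: cells_def eq)
  obtain x where x: "x \<in> Q k a" using cube_pos[OF a] by (metis all_not_in_conv emeasure_empty less_irrefl)
  have "\<forall>l. \<exists>c. c \<in> I l \<and> x \<in> Q l c" using cover by blast
  then obtain b where b: "\<And>l. b l \<in> I l" "\<And>l. x \<in> Q l (b l)" by (auto dest!: choice)
  \<comment> \<open>All ancestors keep the time \<open>t\<close>, at which both halves start, so the
    upper halves and the lower halves both increase along the chain.\<close>
  define C where "C = (\<lambda>n::nat. (k - int n, b (k - int n), t))"
  have C_cells: "C n \<in> cells" for n using b by (simp add: C_def cells_def)
  have "b k = a" using disjoint[of k] a b[of k] x by (auto simp: disjoint_family_on_def)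
  then have C0: "C 0 = P" by (simp add: C_def eq)
  have sub: "Q l (b l) \<subseteq> Q j (b j)" if "j \<le> l" for j l
    using nested[OF that b(1) b(1)] b(2) by blast
  have pow: "\<eta> powi l \<le> \<eta> powi j" if "j \<le> l" for j l
    using that eta by (intro power_int_decreasing) auto
  obtain B where B: "(\<integral>\<^sup>+z. f z \<partial>M) = ennreal B" "0 \<le> B" using fin by (cases "\<integral>\<^sup>+z. f z \<partial>M") auto
  have vol_C: "vol P * (1 / \<eta>) ^ n \<le> vol (C n)" for n
  proof -
    have "vol P * (1 / \<eta>) ^ n = measure \<mu> (Q k a) * \<eta> powi (k - int n)"
      using eta by (simp add: vol_def eq power_int_diff power_divide)
    also have "measure \<mu> (Q k a) \<le> measure \<mu> (Q (k - int n) (b (k - int n)))"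
      using sub[of "k - int n" k] \<open>b k = a\<close> cube_finite[OF b(1)] cube_sets b(1) a
      by (intro measure_mono_fmeasurable) (auto intro!: fmeasurableI)
    finally show ?thesis using less_imp_le[OF eta_powi_pos] by (simp add: vol_def C_def mult_right_mono)
  qed
  define bad where "bad = (\<lambda>n. (\<integral>\<^sup>+z\<in>upper (C n). f z \<partial>M) \<le> ennreal (\<xi> * vol (C n)))"
  have "\<exists>n. bad n"
  proof -
    \<comment> \<open>Each step up multiplies the height by \<open>1 / \<eta>\<close> and does not
      shrink the cube, so \<open>\<xi> * vol (C n)\<close> finally exceeds the total mass
      \<open>B\<close>.\<close>
    have "1 < 1 / \<eta>" using eta by (simp add: field_simps)
    then obtain n where "B / (\<xi> * vol P) < (1 / \<eta>) ^ n" using real_arch_pow by blast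
    then have "B < \<xi> * (vol P * (1 / \<eta>) ^ n)" using xi vol_pos[OF P] by (simp add: divide_less_eq mult_ac)
    also have "\<dots> \<le> \<xi> * vol (C n)" using vol_C xi by simp
    finally have "ennreal B \<le> ennreal (\<xi> * vol (C n))" by (intro ennreal_leI) simp
    moreover have "(\<integral>\<^sup>+z\<in>upper (C n). f z \<partial>M) \<le> ennreal B"
      unfolding B(1)[symmetric] by (intro nn_integral_mono) (auto simp: indicator_def)
    ultimately show ?thesis unfolding bad_def by (meson order_trans)
  qed
  moreover have "\<not> bad 0" using good by (simp add: bad_def C0 not_le)
  ultimately obtain m where m: "\<not> bad m" "bad (Suc m)"
    using ex_least_nat_less[of bad] by blast
  show ?thesis
  proof (rule that[of "C m"])
    show "C m \<in> cells" by (rule C_cells)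
    show "lower P \<subseteq> lower (C m)"
      using sub[of "k - int m" k] pow[of "k - int m" k] \<open>b k = a\<close> by (fastforce simp: lower_def C_def eq)
    show "ennreal (\<xi> * vol (C m)) < (\<integral>\<^sup>+z\<in>upper (C m). f z \<partial>M)" using m(1) by (simp add: bad_def not_le)
    \<comment> \<open>The parent contains the upper half of \<open>C m\<close> and has average at
      most \<xi>, so the mass of \<open>C m\<close> is bounded through the volume of the parent, at
      the cost of \<open>D\<close>.\<close>
    have "upper (C m) \<subseteq> upper (C (Suc m))"
      using sub[of "k - int (Suc m)" "k - int m"] pow[of "k - int (Suc m)" "k - int m"]
      by (fastforce simp: upper_def C_def)
    then have "(\<integral>\<^sup>+z\<in>upper (C m). f z \<partial>M) \<le> (\<integral>\<^sup>+z\<in>upper (C (Suc m)). f z \<partial>M)"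
      by (intro nn_integral_mono) (auto simp: indicator_def)
    also have "\<dots> \<le> ennreal (\<xi> * vol (C (Suc m)))" using m(2) by (simp add: bad_def)
    also have "\<dots> \<le> ennreal (\<xi> * (D * vol (C m)))"
    proof (intro ennreal_leI mult_left_mono)
      show "vol (C (Suc m)) \<le> D * vol (C m)"
        using parent_vol[OF b(1) b(1), of "k - int m"] sub[of "k - int m - 1" "k - int m"]
        by (simp add: vol_def C_def diff_diff_eq add.commute)
    qed (use xi in simp)
    finally show "(\<integral>\<^sup>+z\<in>upper (C m). f z \<partial>M) \<le> ennreal (D * \<xi> * vol (C m))" by (simp add: mult_ac)
  qed
qed

end

section \<open>Weak type estimate on one dyadic grid\<close>

text \<open>The one-sided condition on cells, with denominators cleared. The dual mass
  \<open>s\<close> is recorded as a positive real so that later computations take place in the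
  reals.\<close>

locale weighted_dyadic_grid = dyadic_grid \<mu> I Q \<eta> D
  for \<mu> :: "'a measure" and I :: "int \<Rightarrow> 'i set" and Q \<eta> D +
  fixes \<omega> :: "'a \<times> real \<Rightarrow> real" and q A :: real
  assumes weight_measurable: "\<omega> \<in> borel_measurable M"
    and weight_pos: "AE z in M. 0 < \<omega> z"
    and q: "1 < q" and A: "0 \<le> A"
    and one_sided: "\<And>P. P \<in> cells \<Longrightarrow> \<exists>s>0.
          (\<integral>\<^sup>+z\<in>upper P. ennreal (\<omega> z powr (1 - conj_exp q)) \<partial>M) = ennreal s \<and>
          (\<integral>\<^sup>+z\<in>lower P. ennreal (\<omega> z) \<partial>M) \<le> ennreal (A * vol P powr q / s powr (q - 1))"
begin

text \<open>The mass on \<open>F\<close> is at least \<open>2 * m\<close>. The choice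
  \<open>c = m / s\<close> lets the dual term of \<open>young_duality\<close> use up at most
  \<open>m\<close>, so the term with the weight accounts for the remaining \<open>m\<close>. The
  resulting power of \<open>s\<close> is the one in the one-sided condition and cancels.\<close>

lemma lower_weight_bound:
  assumes P: "P \<in> cells" and xi: "0 < \<xi>" and f: "f \<in> borel_measurable M"
    and F: "F \<in> sets M" "F \<subseteq> upper P"
    and mass: "ennreal (\<xi> * vol P / 2) \<le> (\<integral>\<^sup>+z\<in>F. ennreal \<bar>f z\<bar> \<partial>M)"
  shows "(\<integral>\<^sup>+z\<in>lower P. ennreal (\<omega> z) \<partial>M)
    \<le> ennreal (A * (4 / \<xi>) powr q) * (\<integral>\<^sup>+z\<in>F. ennreal (\<bar>f z\<bar> powr q * \<omega> z) \<partial>M)"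
proof -
  obtain s where s: "0 < s" "(\<integral>\<^sup>+z\<in>upper P. ennreal (\<omega> z powr (1 - conj_exp q)) \<partial>M) = ennreal s"
      "(\<integral>\<^sup>+z\<in>lower P. ennreal (\<omega> z) \<partial>M) \<le> ennreal (A * vol P powr q / s powr (q - 1))"
    using one_sided[OF P] by blast
  define m where "m = \<xi> * vol P / 4"
  have m: "0 < m" using xi vol_pos[OF P] by (simp add: m_def)
  define c where "c = m / s"
  have c: "0 < c" using m s(1) by (simp add: c_def)
  let ?\<sigma> = "\<lambda>z. \<omega> z powr (1 - conj_exp q)" and ?g = "\<lambda>z. \<bar>f z\<bar> powr q * \<omega> z"
  note [measurable] = weight_measurable f F(1)
  have "ennreal (2 * m) \<le> (\<integral>\<^sup>+z\<in>F. ennreal \<bar>f z\<bar> \<partial>M)" using mass by (simp add: m_def)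
  also have "\<dots> \<le> (\<integral>\<^sup>+z. ennreal c * (ennreal (?\<sigma> z) * indicator F z)
      + ennreal (c powr (1 - q)) * (ennreal (?g z) * indicator F z) \<partial>M)"
  proof (rule nn_integral_mono_AE)
    show "AE z in M. ennreal \<bar>f z\<bar> * indicator F z \<le> ennreal c * (ennreal (?\<sigma> z) * indicator F z)
      + ennreal (c powr (1 - q)) * (ennreal (?g z) * indicator F z)"
      using weight_pos
    proof eventually_elim
      case (elim z)
      have "ennreal \<bar>f z\<bar> \<le> ennreal (c * ?\<sigma> z + c powr (1 - q) * ?g z)"
        using young_duality[of "\<bar>f z\<bar>" "\<omega> z" q c] elim q c by (intro ennreal_leI) simp
      also have "\<dots> = ennreal c * ennreal (?\<sigma> z) + ennreal (c powr (1 - q)) * ennreal (?g z)"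
        using c elim by (simp add: ennreal_mult)
      finally show ?case by (simp add: indicator_def)
    qed
  qed
  also have "\<dots> = ennreal c * (\<integral>\<^sup>+z\<in>F. ennreal (?\<sigma> z) \<partial>M) + ennreal (c powr (1 - q)) * (\<integral>\<^sup>+z\<in>F. ennreal (?g z) \<partial>M)"
    by (subst nn_integral_add) (simp_all add: nn_integral_cmult)
  also have "(\<integral>\<^sup>+z\<in>F. ennreal (?\<sigma> z) \<partial>M) \<le> ennreal s"
    unfolding s(2)[symmetric] using F(2) by (intro nn_integral_mono) (auto simp: indicator_def)
  also have "ennreal c * ennreal s = ennreal m" using c s(1) by (simp add: c_def flip: ennreal_mult)
  finally have le: "ennreal (2 * m) \<le> ennreal m + ennreal (c powr (1 - q)) * (\<integral>\<^sup>+z\<in>F. ennreal (?g z) \<partial>M)"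
    by (simp add: mult_left_mono add_right_mono)
  have "ennreal (m * c powr (q - 1)) \<le> (\<integral>\<^sup>+z\<in>F. ennreal (?g z) \<partial>M)"
  proof (cases "\<integral>\<^sup>+z\<in>F. ennreal (?g z) \<partial>M")
    case (real r)
    have "2 * m \<le> m + c powr (1 - q) * r"
      using le real m by (simp flip: ennreal_mult ennreal_plus)
    then have "c powr (q - 1) * m \<le> c powr (q - 1) * (c powr (1 - q) * r)"
      by (intro mult_left_mono) auto
    also have "\<dots> = r" using c by (simp flip: powr_add mult.assoc)
    finally show ?thesis using real by (auto simp: mult.commute intro!: ennreal_leI)
  qed simp
  then have "ennreal (A * (4 / \<xi>) powr q) * ennreal (m * c powr (q - 1))
      \<le> ennreal (A * (4 / \<xi>) powr q) * (\<integral>\<^sup>+z\<in>F. ennreal (?g z) \<partial>M)"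
    by (rule mult_left_mono) simp
  moreover have "A * (4 / \<xi>) powr q * (m * c powr (q - 1)) = A * vol P powr q / s powr (q - 1)"
  proof -
    have "m * c powr (q - 1) = m powr q / s powr (q - 1)"
      using m s(1) by (simp add: c_def powr_divide powr_mult_base)
    moreover have "(4 / \<xi>) powr q * m powr q = vol P powr q"
      using xi vol_pos[OF P] by (simp add: m_def flip: powr_mult)
    ultimately show ?thesis by (simp add: mult.assoc)
  qed
  ultimately show ?thesis using s(3) A m by (simp flip: ennreal_mult)
qed

definition overlap_bound :: nat where "overlap_bound = nat \<lceil>24 * D\<rceil>"

text \<open>The factor \<open>4 powr q\<close> stems from \<open>m\<close> being a quarter of
  \<open>\<xi> * vol P\<close>: one half is lost in passing to \<open>F\<close>, another to the dual
  term.\<close>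

definition weak_constant :: real where "weak_constant = overlap_bound * (A * 4 powr q)"

lemma finite_family_integrable:
  assumes S: "finite S" "S \<subseteq> cells" and xi: "0 < \<xi>" and f: "f \<in> borel_measurable M"
    and fin: "(\<integral>\<^sup>+z. ennreal \<bar>f z\<bar> \<partial>M) < \<infinity>"
    and good: "\<And>P. P \<in> S \<Longrightarrow> ennreal (\<xi> * vol P) < (\<integral>\<^sup>+z\<in>upper P. ennreal \<bar>f z\<bar> \<partial>M)"
  shows "(\<integral>\<^sup>+z\<in>(\<Union>P\<in>S. lower P). ennreal (\<omega> z) \<partial>M)
    \<le> ennreal (weak_constant / \<xi> powr q) * (\<integral>\<^sup>+z. ennreal (\<bar>f z\<bar> powr q * \<omega> z) \<partial>M)"
proof -
  note [measurable] = weight_measurable f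
  have "\<forall>P\<in>S. \<exists>P'. P' \<in> cells \<and> lower P \<subseteq> lower P' \<and> ennreal (\<xi> * vol P') < (\<integral>\<^sup>+z\<in>upper P'. ennreal \<bar>f z\<bar> \<partial>M) \<and>
     (\<integral>\<^sup>+z\<in>upper P'. ennreal \<bar>f z\<bar> \<partial>M) \<le> ennreal (D * \<xi> * vol P')"
  proof
    fix P assume P: "P \<in> S"
    then have "P \<in> cells" using S by blast
    show "\<exists>P'. P' \<in> cells \<and> lower P \<subseteq> lower P' \<and> ennreal (\<xi> * vol P') < (\<integral>\<^sup>+z\<in>upper P'. ennreal \<bar>f z\<bar> \<partial>M) \<and>
     (\<integral>\<^sup>+z\<in>upper P'. ennreal \<bar>f z\<bar> \<partial>M) \<le> ennreal (D * \<xi> * vol P')"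
      by (rule stopping_ancestor[OF \<open>P \<in> cells\<close> xi fin good[OF P]]) blast
  qed
  then obtain anc where anc: "\<And>P. P \<in> S \<Longrightarrow> anc P \<in> cells" "\<And>P. P \<in> S \<Longrightarrow> lower P \<subseteq> lower (anc P)"
     "\<And>P. P \<in> S \<Longrightarrow> ennreal (\<xi> * vol (anc P)) < (\<integral>\<^sup>+z\<in>upper (anc P). ennreal \<bar>f z\<bar> \<partial>M)"
     "\<And>P. P \<in> S \<Longrightarrow> (\<integral>\<^sup>+z\<in>upper (anc P). ennreal \<bar>f z\<bar> \<partial>M) \<le> ennreal (D * \<xi> * vol (anc P))"
    unfolding bchoice_iff by blast
  \<comment> \<open>Only the union of the lower halves matters for the left-hand side, so redundant
    ancestors can be discarded; the packing bounds need exactly this.\<close>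
  obtain R where R: "R \<subseteq> anc ` S" "(\<Union>P\<in>R. lower P) = (\<Union>P\<in>anc ` S. lower P)"
      "\<And>P. P \<in> R \<Longrightarrow> \<not> lower P \<subseteq> (\<Union>P'\<in>R - {P}. lower P')"
    by (rule finite_minimal_subfamily[OF finite_imageI[OF S(1), of anc], where A = lower]) (rule that)
  have finR: "finite R" using R(1) S(1) finite_surj by blast
  have irr: "irredundant R"
    using R finR anc(1) by (auto simp: irredundant_def)
  have cells: "P \<in> cells" if "P \<in> R" for P using irr that by (rule irredundant_cells)
  have N: "24 * D \<le> real overlap_bound" using D_pos by (simp add: overlap_bound_def)
  have lo: "ennreal (\<xi> * vol P) \<le> (\<integral>\<^sup>+z\<in>upper P. ennreal \<bar>f z\<bar> \<partial>M)" if "P \<in> R" for P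
  proof -
    obtain P' where "P' \<in> S" "P = anc P'" using \<open>P \<in> R\<close> R(1) by blast
    then show ?thesis using anc(3) by (simp add: less_imp_le)
  qed
  have hi: "(\<integral>\<^sup>+z\<in>upper P. ennreal \<bar>f z\<bar> \<partial>M) \<le> ennreal (D * \<xi> * vol P)" if "P \<in> R" for P
  proof -
    obtain P' where "P' \<in> S" "P = anc P'" using \<open>P \<in> R\<close> R(1) by blast
    then show ?thesis using anc(4) by simp
  qed
  have "(\<lambda>z. ennreal \<bar>f z\<bar>) \<in> borel_measurable M" by simp
  then obtain F where F: "\<And>P. P \<in> R \<Longrightarrow> F P \<in> sets M" "\<And>P. P \<in> R \<Longrightarrow> F P \<subseteq> upper P"
    "\<And>z. card {P \<in> R. z \<in> F P} \<le> overlap_bound"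
    "\<And>P. P \<in> R \<Longrightarrow> ennreal (\<xi> * vol P / 2) \<le> (\<integral>\<^sup>+z\<in>F P. ennreal \<bar>f z\<bar> \<partial>M)"
    by (rule bounded_overlap_parts[OF irr _ xi lo hi N]) (assumption, assumption, rule that)
  have "(\<integral>\<^sup>+z\<in>(\<Union>P\<in>S. lower P). ennreal (\<omega> z) \<partial>M) \<le> (\<integral>\<^sup>+z. (\<Sum>P\<in>R. ennreal (\<omega> z) * indicator (lower P) z) \<partial>M)"
  proof (rule nn_integral_mono)
    fix z
    show "ennreal (\<omega> z) * indicator (\<Union>P\<in>S. lower P) z \<le> (\<Sum>P\<in>R. ennreal (\<omega> z) * indicator (lower P) z)"
    proof (cases "z \<in> (\<Union>P\<in>S. lower P)")
      case True
      then have "z \<in> (\<Union>P\<in>anc ` S. lower P)" using anc(2) by blast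
      then have "z \<in> (\<Union>P\<in>R. lower P)" unfolding R(2) .
      then obtain P where "P \<in> R" "z \<in> lower P" by blast
      then show ?thesis using finR member_le_sum[of P R "\<lambda>P. ennreal (\<omega> z) * indicator (lower P) z"] True by simp
    qed simp
  qed
  also have "\<dots> = (\<Sum>P\<in>R. \<integral>\<^sup>+z\<in>lower P. ennreal (\<omega> z) \<partial>M)"
    using cells by (intro nn_integral_sum) auto
  also have "\<dots> \<le> (\<Sum>P\<in>R. ennreal (A * (4 / \<xi>) powr q) * (\<integral>\<^sup>+z\<in>F P. ennreal (\<bar>f z\<bar> powr q * \<omega> z) \<partial>M))"
    using cells F by (intro sum_mono lower_weight_bound xi f)
  also have "\<dots> = ennreal (A * (4 / \<xi>) powr q) * (\<Sum>P\<in>R. \<integral>\<^sup>+z\<in>F P. ennreal (\<bar>f z\<bar> powr q * \<omega> z) \<partial>M)"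
    by (simp add: sum_distrib_left)
  also have "\<dots> \<le> ennreal (A * (4 / \<xi>) powr q) * (of_nat overlap_bound * (\<integral>\<^sup>+z\<in>space M. ennreal (\<bar>f z\<bar> powr q * \<omega> z) \<partial>M))"
    using finR F(1,3) sets.sets_into_space[OF F(1)]
    by (intro mult_left_mono sum_nn_integral_bounded_overlap) auto
  also have "(\<integral>\<^sup>+z\<in>space M. ennreal (\<bar>f z\<bar> powr q * \<omega> z) \<partial>M) = (\<integral>\<^sup>+z. ennreal (\<bar>f z\<bar> powr q * \<omega> z) \<partial>M)"
    by (intro nn_integral_cong) simp
  also have "ennreal (A * (4 / \<xi>) powr q) * (of_nat overlap_bound * (\<integral>\<^sup>+z. ennreal (\<bar>f z\<bar> powr q * \<omega> z) \<partial>M))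
      = ennreal (weak_constant / \<xi> powr q) * (\<integral>\<^sup>+z. ennreal (\<bar>f z\<bar> powr q * \<omega> z) \<partial>M)"
    using A xi by (simp add: weak_constant_def powr_divide ennreal_of_nat_eq_real_of_nat mult_ac flip: ennreal_mult mult.assoc)
  finally show ?thesis .
qed

text \<open>Stopping needs finite total mass, but a function in the weighted space may fail to be
  integrable. It is truncated in height and restricted to the union \<open>U\<close> of the upper
  halves, a set of finite measure. Monotone convergence keeps the strict inequality on every
  cell.\<close>

lemma finite_family:
  assumes S: "finite S" "S \<subseteq> cells" and xi: "0 < \<xi>" and f: "f \<in> borel_measurable M"
    and good: "\<And>P. P \<in> S \<Longrightarrow> ennreal (\<xi> * vol P) < (\<integral>\<^sup>+z\<in>upper P. ennreal \<bar>f z\<bar> \<partial>M)"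
  shows "(\<integral>\<^sup>+z\<in>(\<Union>P\<in>S. lower P). ennreal (\<omega> z) \<partial>M)
    \<le> ennreal (weak_constant / \<xi> powr q) * (\<integral>\<^sup>+z. ennreal (\<bar>f z\<bar> powr q * \<omega> z) \<partial>M)"
proof -
  note [measurable] = weight_measurable f
  define U where "U = (\<Union>P\<in>S. upper P)"
  have U [measurable]: "U \<in> sets M" using S by (auto simp: U_def intro!: sets.finite_UN upper_sets)
  define g where "g = (\<lambda>n::nat. \<lambda>z. min \<bar>f z\<bar> n * indicator U z)"
  have g_nonneg: "0 \<le> g n z" for n z by (simp add: g_def)
  have g_meas [measurable]: "g n \<in> borel_measurable M" for n unfolding g_def by measurable
  have g_mono: "g m z \<le> g n z" if "m \<le> n" for m n z
    using that by (auto simp: g_def indicator_def min_def)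
  have SUP_g: "(SUP n. ennreal (g n z)) = ennreal \<bar>f z\<bar>" if "z \<in> U" for z
  proof (rule antisym)
    show "(SUP n. ennreal (g n z)) \<le> ennreal \<bar>f z\<bar>"
      by (intro SUP_least ennreal_leI) (auto simp: g_def indicator_def)
    obtain n :: nat where "\<bar>f z\<bar> \<le> n" using real_arch_simple by blast
    then have "ennreal \<bar>f z\<bar> = ennreal (g n z)" using that by (simp add: g_def)
    then show "ennreal \<bar>f z\<bar> \<le> (SUP n. ennreal (g n z))" using SUP_upper[of n UNIV "\<lambda>n. ennreal (g n z)"] by simp
  qed
  have "\<exists>n. ennreal (\<xi> * vol P) < (\<integral>\<^sup>+z\<in>upper P. ennreal (g n z) \<partial>M)" if P: "P \<in> S" for P
  proof -
    have [measurable]: "upper P \<in> sets M" using P S by auto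
    have "(\<integral>\<^sup>+z\<in>upper P. ennreal \<bar>f z\<bar> \<partial>M) = (\<integral>\<^sup>+z. (SUP n. ennreal (g n z) * indicator (upper P) z) \<partial>M)"
    proof (intro nn_integral_cong)
      fix z
      show "ennreal \<bar>f z\<bar> * indicator (upper P) z = (SUP n. ennreal (g n z) * indicator (upper P) z)"
      proof (cases "z \<in> upper P")
        case True
        then have "z \<in> U" using P by (auto simp: U_def)
        then show ?thesis using True SUP_g[of z] by simp
      qed simp
    qed
    also have "\<dots> = (SUP n. \<integral>\<^sup>+z\<in>upper P. ennreal (g n z) \<partial>M)"
      by (intro nn_integral_monotone_convergence_SUP)
        (auto simp: incseq_def le_fun_def intro!: mult_right_mono ennreal_leI g_mono)
    finally show ?thesis using good[OF P] by (simp add: less_SUP_iff)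
  qed
  then obtain n where n: "\<And>P. P \<in> S \<Longrightarrow> ennreal (\<xi> * vol P) < (\<integral>\<^sup>+z\<in>upper P. ennreal (g (n P) z) \<partial>M)"
    by metis
  \<comment> \<open>There are finitely many cells, so one truncation height serves them all.\<close>
  define m where "m = Max (n ` S)"
  have good_m: "ennreal (\<xi> * vol P) < (\<integral>\<^sup>+z\<in>upper P. ennreal \<bar>g m z\<bar> \<partial>M)" if P: "P \<in> S" for P
  proof -
    have "n P \<le> m" unfolding m_def using S(1) P by (intro Max_ge) auto
    then have "(\<integral>\<^sup>+z\<in>upper P. ennreal (g (n P) z) \<partial>M) \<le> (\<integral>\<^sup>+z\<in>upper P. ennreal \<bar>g m z\<bar> \<partial>M)"
      using g_mono g_nonneg by (intro nn_integral_mono mult_right_mono ennreal_leI) auto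
    with n[OF P] show ?thesis by (rule less_le_trans)
  qed
  have "(\<integral>\<^sup>+z. ennreal \<bar>g m z\<bar> \<partial>M) \<le> (\<integral>\<^sup>+z. ennreal m * indicator U z \<partial>M)"
    by (intro nn_integral_mono) (auto simp: g_def indicator_def)
  also have "\<dots> = ennreal m * emeasure M U" by (simp add: nn_integral_cmult_indicator)
  also have "\<dots> < \<infinity>"
  proof -
    have "emeasure M U \<le> (\<Sum>P\<in>S. emeasure M (upper P))"
      unfolding U_def using S by (intro emeasure_subadditive_finite) auto
    also have "\<dots> = (\<Sum>P\<in>S. ennreal (vol P))" using S by (intro sum.cong emeasure_upper) auto
    also have "\<dots> < \<infinity>" using S(1) by (simp add: less_top)
    finally show ?thesis by (simp add: ennreal_mult_less_top)
  qed
  finally have "(\<integral>\<^sup>+z\<in>(\<Union>P\<in>S. lower P). ennreal (\<omega> z) \<partial>M)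
    \<le> ennreal (weak_constant / \<xi> powr q) * (\<integral>\<^sup>+z. ennreal (\<bar>g m z\<bar> powr q * \<omega> z) \<partial>M)"
    using good_m by (intro finite_family_integrable S xi) auto
  also have "\<dots> \<le> ennreal (weak_constant / \<xi> powr q) * (\<integral>\<^sup>+z. ennreal (\<bar>f z\<bar> powr q * \<omega> z) \<partial>M)"
  proof (intro mult_left_mono nn_integral_mono_AE)
    show "AE z in M. ennreal (\<bar>g m z\<bar> powr q * \<omega> z) \<le> ennreal (\<bar>f z\<bar> powr q * \<omega> z)"
      using weight_pos
    proof eventually_elim
      case (elim z)
      have "\<bar>g m z\<bar> \<le> \<bar>f z\<bar>" by (auto simp: g_def indicator_def)
      then show ?case using elim q by (intro ennreal_leI mult_right_mono powr_mono2) auto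
    qed
  qed simp
  finally show ?thesis .
qed

text \<open>The constant does not depend on the finite family, so the bound survives exhaustion:
  continuity from below for the measure with density \<omega>.\<close>

lemma countable_family:
  assumes \<C>: "countable \<C>" "\<C> \<subseteq> cells" and xi: "0 < \<xi>" and f: "f \<in> borel_measurable M"
    and good: "\<And>P. P \<in> \<C> \<Longrightarrow> ennreal (\<xi> * vol P) < (\<integral>\<^sup>+z\<in>upper P. ennreal \<bar>f z\<bar> \<partial>M)"
  shows "(\<integral>\<^sup>+z\<in>(\<Union>P\<in>\<C>. lower P). ennreal (\<omega> z) \<partial>M)
    \<le> ennreal (weak_constant / \<xi> powr q) * (\<integral>\<^sup>+z. ennreal (\<bar>f z\<bar> powr q * \<omega> z) \<partial>M)"
proof (cases "\<C> = {}")
  case False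
  note [measurable] = weight_measurable
  let ?c = "from_nat_into \<C>"
  define H where "H = (\<lambda>n. \<Union>P\<in>?c ` {..n}. lower P)"
  have c: "?c i \<in> \<C>" for i using False by (rule from_nat_into)
  have H_meas: "H n \<in> sets M" for n using c \<C>(2) by (auto simp: H_def intro!: sets.finite_UN lower_sets)
  have UN: "(\<Union>P\<in>\<C>. lower P) = (\<Union>n. H n)"
  proof -
    have "(\<Union>n. H n) = (\<Union>i. lower (?c i))" by (auto simp: H_def)
    also have "\<dots> = (\<Union>P\<in>range ?c. lower P)" by simp
    finally show ?thesis by (simp add: range_from_nat_into[OF False \<C>(1)])
  qed
  have "incseq H" unfolding incseq_def H_def by (intro allI impI UN_mono image_mono) auto
  have dens: "emeasure (density M (\<lambda>z. ennreal (\<omega> z))) E = (\<integral>\<^sup>+z\<in>E. ennreal (\<omega> z) \<partial>M)" if "E \<in> sets M" for E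
    using that by (intro emeasure_density) auto
  have "(\<integral>\<^sup>+z\<in>(\<Union>P\<in>\<C>. lower P). ennreal (\<omega> z) \<partial>M) = (SUP n. \<integral>\<^sup>+z\<in>H n. ennreal (\<omega> z) \<partial>M)"
    using SUP_emeasure_incseq[of H "density M (\<lambda>z. ennreal (\<omega> z))"] H_meas \<open>incseq H\<close>
    by (simp add: dens UN sets.countable_UN image_subset_iff)
  also have "\<dots> \<le> ennreal (weak_constant / \<xi> powr q) * (\<integral>\<^sup>+z. ennreal (\<bar>f z\<bar> powr q * \<omega> z) \<partial>M)"
    unfolding H_def
  proof (intro SUP_least finite_family xi f)
    fix n P assume "P \<in> ?c ` {..n}"
    then have "P \<in> \<C>" using c by blast
    then show "ennreal (\<xi> * vol P) < (\<integral>\<^sup>+z\<in>upper P. ennreal \<bar>f z\<bar> \<partial>M)" by (rule good)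
  qed (use c \<C>(2) in auto)
  finally show ?thesis .
qed simp

text \<open>\<open>G\<close> is a union over uncountably many times, so it is enclosed in a
  measurable set. For each of the countably many cubes, all but countably many good times are
  followed closely by another good time; the exceptional ones fill the null set
  \<open>Z\<close>.\<close>

lemma weak_type:
  assumes xi: "0 < \<xi>" and f: "f \<in> borel_measurable M"
  defines "G \<equiv> {(x, t). \<exists>k. \<exists>a\<in>I k. x \<in> Q k a \<and>
      ennreal (\<xi> * vol (k, a, t)) < (\<integral>\<^sup>+z\<in>upper (k, a, t). ennreal \<bar>f z\<bar> \<partial>M)}"
  shows "\<exists>H\<in>sets M. G \<subseteq> H \<and> (\<integral>\<^sup>+z\<in>H. ennreal (\<omega> z) \<partial>M)
    \<le> ennreal (weak_constant / \<xi> powr q) * (\<integral>\<^sup>+z. ennreal (\<bar>f z\<bar> powr q * \<omega> z) \<partial>M)"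
proof -
  define good where "good = (\<lambda>P. ennreal (\<xi> * vol P) < (\<integral>\<^sup>+z\<in>upper P. ennreal \<bar>f z\<bar> \<partial>M))"
  define J where "J = Sigma UNIV I"
  have "countable J" unfolding J_def by (intro countable_SIGMA index_countable) auto
  define W where "W = (\<lambda>j T0 N. T0 \<subseteq> {t. good (fst j, snd j, t)} \<and> countable T0 \<and> countable N \<and>
      {t. good (fst j, snd j, t)} \<subseteq> N \<union> (\<Union>t\<in>T0. {t - \<eta> powi fst j<..<t}))"
  have "\<exists>T0 N. W j T0 N" for j
    unfolding W_def
    by (rule countable_right_cover[OF eta_powi_pos, of "{t. good (fst j, snd j, t)}" "fst j"]) blast
  then obtain T0 N where "\<And>j. W j (T0 j) (N j)" by metis
  then have TN: "\<And>j. T0 j \<subseteq> {t. good (fst j, snd j, t)}" "\<And>j. countable (T0 j)" "\<And>j. countable (N j)"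
      "\<And>j. {t. good (fst j, snd j, t)} \<subseteq> N j \<union> (\<Union>t\<in>T0 j. {t - \<eta> powi fst j<..<t})"
    unfolding W_def by blast+
  define \<C> where "\<C> = (\<Union>j\<in>J. (\<lambda>t. (fst j, snd j, t)) ` T0 j)"
  define Z where "Z = (\<Union>j\<in>J. Q (fst j) (snd j) \<times> N j)"
  define H where "H = (\<Union>P\<in>\<C>. lower P)"
  have C: "countable \<C>" "\<C> \<subseteq> cells" "\<And>P. P \<in> \<C> \<Longrightarrow> good P"
    using \<open>countable J\<close> TN(1,2) by (auto simp: \<C>_def cells_def J_def subset_iff)
  have Z: "Z \<in> null_sets M" unfolding Z_def
  proof (intro null_sets_UN' \<open>countable J\<close>)
    fix j assume j: "j \<in> J"
    then have "N j \<in> null_sets lebesgue" "Q (fst j) (snd j) \<in> sets \<mu>"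
      using TN(3) by (auto simp: J_def intro!: cube_sets null_sets_completionI countable_imp_null_set_lborel)
    then show "Q (fst j) (snd j) \<times> N j \<in> null_sets M"
      by (auto simp: null_sets_def emeasure_times_lebesgue)
  qed
  have H_meas: "H \<in> sets M" unfolding H_def using C by (intro sets.countable_UN' lower_sets) auto
  have "G \<subseteq> H \<union> Z"
  proof
    fix z assume "z \<in> G"
    then obtain x t k a where z: "z = (x, t)" "a \<in> I k" "x \<in> Q k a" "good (k, a, t)"
      by (auto simp: G_def good_def)
    then have j: "(k, a) \<in> J" by (simp add: J_def)
    then have "t \<in> N (k, a) \<union> (\<Union>t\<in>T0 (k, a). {t - \<eta> powi k<..<t})"
      using subsetD[OF TN(4)[of "(k, a)"], of t] z(4) by simp
    \<comment> \<open>No point at time \<open>t\<close> lies in the lower half of the cell centred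
      at \<open>t\<close>, which is open there. It is caught by the lower half of a slightly later
      good cell over the same cube.\<close>
    then consider "t \<in> N (k, a)" | t' where "t' \<in> T0 (k, a)" "t \<in> {t' - \<eta> powi k<..<t'}" by blast
    then show "z \<in> H \<union> Z"
    proof cases
      case 1
      then show ?thesis using j z by (force simp: Z_def)
    next
      case 2
      then have "(k, a, t') \<in> \<C>" "z \<in> lower (k, a, t')"
        using j z by (force simp: \<C>_def, simp add: lower_def)
      then show ?thesis by (auto simp: H_def)
    qed
  qed
  moreover have "(\<integral>\<^sup>+z\<in>H \<union> Z. ennreal (\<omega> z) \<partial>M) \<le> (\<integral>\<^sup>+z\<in>H. ennreal (\<omega> z) \<partial>M)"
  proof (rule nn_integral_mono_AE)
    show "AE z in M. ennreal (\<omega> z) * indicator (H \<union> Z) z \<le> ennreal (\<omega> z) * indicator H z"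
      using AE_not_in[OF Z] by eventually_elim (auto simp: indicator_def)
  qed
  moreover have "(\<integral>\<^sup>+z\<in>H. ennreal (\<omega> z) \<partial>M)
      \<le> ennreal (weak_constant / \<xi> powr q) * (\<integral>\<^sup>+z. ennreal (\<bar>f z\<bar> powr q * \<omega> z) \<partial>M)"
    unfolding H_def using C by (intro countable_family xi f) (auto simp: good_def)
  moreover have "H \<union> Z \<in> sets M" using H_meas Z by auto
  ultimately show ?thesis by (meson order_trans)
qed

end

section \<open>Powers and integrals in the extended reals\<close>

lemma ennpow_ennreal: "0 \<le> x \<Longrightarrow> ennpow (ennreal x) a = ennreal (x powr a)"
  by (simp add: ennpow_def)

lemma ennpow_top [simp]: "ennpow top a = top"
  by (simp_all add: ennpow_def)

lemma ennpow_0 [simp]: "ennpow 0 a = 0"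
  by (simp add: ennpow_def)

lemma ennpow_mono: "x \<le> y \<Longrightarrow> 0 \<le> a \<Longrightarrow> ennpow x a \<le> ennpow y a"
  by (cases x; cases y) (auto simp: ennpow_ennreal top_unique intro!: ennreal_leI powr_mono2)

lemma ennpow_ennpow_inverse: "0 < a \<Longrightarrow> ennpow (ennpow x a) (1 / a) = x"
  by (cases x) (auto simp: ennpow_ennreal powr_powr)

lemma ennpow_cmult: "0 < c \<Longrightarrow> ennpow (ennreal c * x) a = ennreal (c powr a) * ennpow x a"
  by (cases x) (auto simp: ennpow_ennreal powr_mult ennreal_mult_top simp flip: ennreal_mult)

lemma ennpow_le_iff:
  assumes "0 < a"
  shows "ennpow x a \<le> y \<longleftrightarrow> x \<le> ennpow y (1 / a)"
proof
  assume "ennpow x a \<le> y"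
  then have "ennpow (ennpow x a) (1 / a) \<le> ennpow y (1 / a)" using assms by (intro ennpow_mono) auto
  then show "x \<le> ennpow y (1 / a)" using assms by (simp add: ennpow_ennpow_inverse)
next
  assume "x \<le> ennpow y (1 / a)"
  then have "ennpow x a \<le> ennpow (ennpow y (1 / a)) a" using assms by (intro ennpow_mono) auto
  then show "ennpow x a \<le> y" using assms ennpow_ennpow_inverse[of "1 / a" y] by simp
qed

lemma mult_le_iff_ennreal:
  assumes "0 < w"
  shows "ennreal w * x \<le> y \<longleftrightarrow> x \<le> y / ennreal w"
  using assms by (cases x; cases y)
    (auto simp: divide_ennreal ennreal_mult_top ennreal_top_divide top_unique field_simps simp flip: ennreal_mult)

lemma less_divide_iff_ennreal:
  assumes "0 < w" "0 \<le> \<xi>"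
  shows "ennreal \<xi> < x / ennreal w \<longleftrightarrow> ennreal (\<xi> * w) < x"
  using mult_le_iff_ennreal[OF assms(1), of "ennreal \<xi>" x] assms
  by (cases x) (auto simp: divide_ennreal ennreal_top_divide ennreal_less_iff field_simps)

lemma set_nn_integral_pos:
  assumes "AE z in M. 0 < g z" "g \<in> borel_measurable M" "E \<in> sets M" "0 < emeasure M E"
  shows "0 < (\<integral>\<^sup>+z\<in>E. ennreal (g z) \<partial>M)"
proof (rule ccontr)
  assume "\<not> 0 < (\<integral>\<^sup>+z\<in>E. ennreal (g z) \<partial>M)"
  then have "(\<integral>\<^sup>+z\<in>E. ennreal (g z) \<partial>M) = 0" by (simp add: not_gr_zero)
  then have "AE z in M. ennreal (g z) * indicator E z = 0"
    using assms(2,3) by (subst (asm) nn_integral_0_iff_AE) auto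
  with assms(1) have "AE z in M. z \<notin> E"
    by eventually_elim (auto simp: indicator_def ennreal_eq_0_iff split: if_splits)
  then have "E \<in> null_sets M" using AE_iff_null_sets[OF assms(3)] by simp
  then show False using assms(4) by auto
qed

text \<open>Within one \<open>B n\<close> the measures of the disjoint pieces have bounded finite
  sums, hence only countably many are nonzero; and each \<open>A i\<close> has positive measure
  within some \<open>B n\<close>. Applied to the cubes of one level, with balls as
  \<open>B n\<close>.\<close>

lemma countable_disjoint_pos_measure:
  assumes fin: "\<And>n::nat. B n \<in> sets M" "\<And>n. emeasure M (B n) < \<infinity>" "(\<Union>n. B n) = space M"
    and A: "\<And>i. i \<in> J \<Longrightarrow> A i \<in> sets M" "\<And>i. i \<in> J \<Longrightarrow> 0 < emeasure M (A i)" "disjoint_family_on A J"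
  shows "countable J"
proof -
  have "countable {i \<in> J. measure M (A i \<inter> B n) \<noteq> 0}" for n
  proof -
    have "(\<lambda>i. measure M (A i \<inter> B n)) summable_on J"
    proof (rule nonneg_bdd_above_summable_on)
      show "bdd_above (sum (\<lambda>i. measure M (A i \<inter> B n)) ` {F. F \<subseteq> J \<and> finite F})"
      proof (rule bdd_aboveI2)
        fix F assume F: "F \<in> {F. F \<subseteq> J \<and> finite F}"
        have fm: "A i \<inter> B n \<in> fmeasurable M" if "i \<in> J" for i
          using that fin A by (intro fmeasurableI) (auto intro: le_less_trans[OF emeasure_mono])
        have "(\<Sum>i\<in>F. measure M (A i \<inter> B n)) = measure M (\<Union>i\<in>F. A i \<inter> B n)"
          using F fm A(3) by (intro measure_UNION'[symmetric])
            (auto simp: disjoint_family_on_def pairwise_def disjnt_def)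
        also have "\<dots> \<le> measure M (B n)"
          using fin F A by (intro measure_mono_fmeasurable fmeasurableI) (auto intro!: sets.Int sets.finite_UN)
        finally show "(\<Sum>i\<in>F. measure M (A i \<inter> B n)) \<le> measure M (B n)" .
      qed
    qed simp
    then show ?thesis by (rule summable_countable_real)
  qed
  moreover have "J \<subseteq> (\<Union>n. {i \<in> J. measure M (A i \<inter> B n) \<noteq> 0})"
  proof
    fix i assume i: "i \<in> J"
    have "\<exists>n. emeasure M (A i \<inter> B n) \<noteq> 0"
    proof (rule ccontr)
      assume "\<not> ?thesis"
      then have "(\<Union>n. A i \<inter> B n) \<in> null_sets M"
        using fin(1) A(1)[OF i] by (intro null_sets_UN) (auto intro!: null_setsI)
      moreover have "(\<Union>n. A i \<inter> B n) = A i" using fin(3) sets.sets_into_space[OF A(1)[OF i]] by auto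
      ultimately show False using A(2)[OF i] by auto
    qed
    then obtain n where n: "emeasure M (A i \<inter> B n) \<noteq> 0" by blast
    have "emeasure M (A i \<inter> B n) \<le> emeasure M (B n)" using fin by (intro emeasure_mono) auto
    then have "emeasure M (A i \<inter> B n) < \<infinity>" using fin(2) by (rule le_less_trans)
    then have "measure M (A i \<inter> B n) \<noteq> 0" using n by (simp add: measure_def enn2real_eq_0_iff less_top)
    then show "i \<in> (\<Union>n. {i \<in> J. measure M (A i \<inter> B n) \<noteq> 0})" using i by blast
  qed
  ultimately show ?thesis by (meson countable_UN countable_subset uncountable_def UNIV_I countableI_type)
qed

section \<open>Geometry of the adjacent dyadic systems\<close>

locale dyadic_parabolic =
  fixes \<rho> :: "'a \<Rightarrow> 'a \<Rightarrow> real" and \<mu> :: "'a measure"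
    and K\<^sub>0 \<delta> c\<^sub>0 C\<^sub>0 p :: real and K :: nat
    and I :: "int \<Rightarrow> nat \<Rightarrow> 'i set"
    and z :: "int \<Rightarrow> nat \<Rightarrow> 'i \<Rightarrow> 'a"
    and Q :: "int \<Rightarrow> nat \<Rightarrow> 'i \<Rightarrow> 'a set"
  assumes homogeneous: "homogeneous_type \<rho> K\<^sub>0 \<mu>"
    and basic: "basic_assumptions \<rho> \<mu>"
    and geodesic: "monotone_geodesic \<rho>"
    and p: "1 < p"
    and systems: "adjacent_dyadic_systems \<rho> K\<^sub>0 \<mu> \<delta> c\<^sub>0 C\<^sub>0 K I z Q"
begin

definition c\<^sub>1 where "c\<^sub>1 = c\<^sub>0 / (3 * K\<^sub>0\<^sup>2)"
definition C\<^sub>1 where "C\<^sub>1 = 2 * K\<^sub>0 * C\<^sub>0"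

abbreviation \<Lambda> :: "('a \<times> real) measure" where "\<Lambda> \<equiv> \<mu> \<Otimes>\<^sub>M lebesgue"

lemma quasi: "1 \<le> K\<^sub>0" "0 \<le> \<rho> x y" "\<rho> x y = 0 \<longleftrightarrow> x = y" "\<rho> x y = \<rho> y x"
    "\<rho> x y \<le> K\<^sub>0 * (\<rho> x w + \<rho> w y)"
proof -
  note H = homogeneous[unfolded homogeneous_type_def quasi_metric_def, THEN conjunct1]
  show "1 \<le> K\<^sub>0" by (rule H[THEN conjunct1])
  show "0 \<le> \<rho> x y" by (rule H[THEN conjunct2, THEN conjunct1, rule_format])
  show "\<rho> x y = 0 \<longleftrightarrow> x = y" by (rule H[THEN conjunct2, THEN conjunct2, THEN conjunct1, rule_format])
  show "\<rho> x y = \<rho> y x"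
    by (rule H[THEN conjunct2, THEN conjunct2, THEN conjunct2, THEN conjunct1, rule_format])
  show "\<rho> x y \<le> K\<^sub>0 * (\<rho> x w + \<rho> w y)"
    by (rule H[THEN conjunct2, THEN conjunct2, THEN conjunct2, THEN conjunct2, rule_format])
qed

lemma quasi_le: "\<rho> x w \<le> a \<Longrightarrow> \<rho> w y \<le> b \<Longrightarrow> \<rho> x y \<le> K\<^sub>0 * (a + b)"
  using quasi(1) quasi(5)[of x y w] by (smt (verit) mult_left_mono)

lemma quasi_less: "\<rho> x w < a \<Longrightarrow> \<rho> w y < b \<Longrightarrow> \<rho> x y < K\<^sub>0 * (a + b)"
  using quasi(1) quasi(5)[of x y w] by (smt (verit) mult_strict_left_mono)

lemma space_mu: "space \<mu> = UNIV" and ball_sets: "qball \<rho> x r \<in> sets \<mu>"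
  using homogeneous unfolding homogeneous_type_def by blast+

lemma ball_pos: "0 < r \<Longrightarrow> 0 < emeasure \<mu> (qball \<rho> x r)"
  and ball_finite: "0 < r \<Longrightarrow> emeasure \<mu> (qball \<rho> x r) < \<infinity>"
  using basic unfolding basic_assumptions_def by blast+

lemma emeasure_ball: "0 < r \<Longrightarrow> emeasure \<mu> (qball \<rho> x r) = ennreal (measure \<mu> (qball \<rho> x r))"
  using ball_finite by (simp add: emeasure_eq_ennreal_measure less_top)

lemma measure_ball_pos: "0 < r \<Longrightarrow> 0 < measure \<mu> (qball \<rho> x r)"
  using ball_pos[of r x] emeasure_ball[of r x] by (simp add: zero_less_measure_iff)

lemma measure_mono_ball:
  "A \<in> sets \<mu> \<Longrightarrow> A \<subseteq> qball \<rho> x r \<Longrightarrow> 0 < r \<Longrightarrow> measure \<mu> A \<le> measure \<mu> (qball \<rho> x r)"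
  using ball_finite by (intro measure_mono_fmeasurable fmeasurableI) (auto intro: ball_sets)

lemma qball_mono: "r \<le> s \<Longrightarrow> qball \<rho> x r \<subseteq> qball \<rho> x s"
  by (auto simp: qball_def)

lemma doubling: "\<exists>C>0. \<forall>x. \<forall>r>0. measure \<mu> (qball \<rho> x (a * r)) \<le> C * measure \<mu> (qball \<rho> x r)"
proof -
  obtain C where "\<And>x r. 0 < r \<Longrightarrow> emeasure \<mu> (qball \<rho> x (2 * r)) \<le> ennreal C * emeasure \<mu> (qball \<rho> x r)"
    using homogeneous unfolding homogeneous_type_def doubling_measure_def by blast
  \<comment> \<open>Replacing \<open>C\<close> by \<open>max 1 C\<close> makes its powers positive,
    as the iteration over powers of 2 requires.\<close>
  then have C1: "emeasure \<mu> (qball \<rho> x (2 * r)) \<le> ennreal (max 1 C) * emeasure \<mu> (qball \<rho> x r)" if "0 < r" for x r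
    using that by (meson ennreal_leI max.cobounded2 mult_right_mono order_trans zero_le)
  have C: "measure \<mu> (qball \<rho> x (2 * r)) \<le> max 1 C * measure \<mu> (qball \<rho> x r)" if "0 < r" for x r
  proof -
    have "ennreal (measure \<mu> (qball \<rho> x (2 * r))) \<le> ennreal (max 1 C * measure \<mu> (qball \<rho> x r))"
      using C1[OF that, of x] that emeasure_ball[of "2 * r" x] emeasure_ball[of r x] by (simp add: ennreal_mult)
    then show ?thesis by (subst (asm) ennreal_le_iff) auto
  qed
  have iter: "measure \<mu> (qball \<rho> x (2 ^ n * r)) \<le> max 1 C ^ n * measure \<mu> (qball \<rho> x r)" if "0 < r" for x r n
  proof (induction n)
    case (Suc n)
    have "measure \<mu> (qball \<rho> x (2 ^ Suc n * r)) \<le> max 1 C * measure \<mu> (qball \<rho> x (2 ^ n * r))"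
      using C[of "2 ^ n * r" x] that by (simp add: mult.assoc)
    also have "\<dots> \<le> max 1 C * (max 1 C ^ n * measure \<mu> (qball \<rho> x r))"
      using Suc by (intro mult_left_mono) auto
    finally show ?case by (simp add: mult.assoc)
  qed simp
  obtain n where n: "a < 2 ^ n" using real_arch_pow[of 2 a] by auto
  have "measure \<mu> (qball \<rho> x (a * r)) \<le> max 1 C ^ n * measure \<mu> (qball \<rho> x r)" if "0 < r" for x r
  proof -
    have "measure \<mu> (qball \<rho> x (a * r)) \<le> measure \<mu> (qball \<rho> x (2 ^ n * r))"
      using that n by (intro measure_mono_ball ball_sets qball_mono mult_right_mono) auto
    then show ?thesis using iter[OF that, of x n] by linarith
  qed
  then show ?thesis by (intro exI[of _ "max 1 C ^ n"]) auto
qed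

lemma constants: "0 < \<delta>" "\<delta> < 1" "\<delta> \<le> 1 / 96" "0 < c\<^sub>1" "0 < C\<^sub>1"
proof -
  note sys = systems[unfolded adjacent_dyadic_systems_def]
  show d: "0 < \<delta>" "\<delta> < 1"
    by (rule sys[THEN conjunct1], rule sys[THEN conjunct2, THEN conjunct1])
  have "96 * K\<^sub>0 ^ 6 * \<delta> \<le> 1" "0 < c\<^sub>0" "c\<^sub>0 \<le> C\<^sub>0"
    by (rule sys[THEN conjunct2, THEN conjunct2, THEN conjunct1],
        rule sys[THEN conjunct2, THEN conjunct2, THEN conjunct2, THEN conjunct1],
        rule sys[THEN conjunct2, THEN conjunct2, THEN conjunct2, THEN conjunct2, THEN conjunct1])
  then show "0 < c\<^sub>1" "0 < C\<^sub>1" using quasi(1) by (auto simp: c\<^sub>1_def C\<^sub>1_def)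
  have "1 \<le> K\<^sub>0 ^ 6" using quasi(1) by simp
  then have "\<delta> \<le> K\<^sub>0 ^ 6 * \<delta>" using d(1) by simp
  then show "\<delta> \<le> 1 / 96" using \<open>96 * K\<^sub>0 ^ 6 * \<delta> \<le> 1\<close> by simp
qed

lemma cube_facts:
  assumes "\<tau> \<in> {1..K}"
  shows cube_sets: "a \<in> I k \<tau> \<Longrightarrow> Q k \<tau> a \<in> sets \<mu>"
    and cube_nested: "k \<le> l \<Longrightarrow> a \<in> I k \<tau> \<Longrightarrow> b \<in> I l \<tau> \<Longrightarrow> Q l \<tau> b \<subseteq> Q k \<tau> a \<or> Q l \<tau> b \<inter> Q k \<tau> a = {}"
    and cube_disjoint: "disjoint_family_on (Q k \<tau>) (I k \<tau>)"
    and cube_cover: "(\<Union>a\<in>I k \<tau>. Q k \<tau> a) = UNIV"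
    and cube_inner: "a \<in> I k \<tau> \<Longrightarrow> qball \<rho> (z k \<tau> a) (c\<^sub>1 * \<delta> powi k) \<subseteq> Q k \<tau> a"
    and cube_outer: "a \<in> I k \<tau> \<Longrightarrow> Q k \<tau> a \<subseteq> qball \<rho> (z k \<tau> a) (C\<^sub>1 * \<delta> powi k)"
proof -
  note sys = systems[unfolded adjacent_dyadic_systems_def Let_def, folded c\<^sub>1_def C\<^sub>1_def,
      THEN conjunct2, THEN conjunct2, THEN conjunct2, THEN conjunct2, THEN conjunct2, THEN conjunct2,
      THEN conjunct1, THEN bspec, OF assms]
  note cubes = sys[THEN conjunct2, THEN conjunct2, THEN conjunct2]
  note partition = cubes[THEN conjunct2, THEN conjunct1, THEN spec, of k]
    and balls = cubes[THEN conjunct2, THEN conjunct2, THEN conjunct1, THEN spec, of k]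
  show "a \<in> I k \<tau> \<Longrightarrow> Q k \<tau> a \<in> sets \<mu>" by (rule sys[THEN conjunct1, rule_format])
  show "k \<le> l \<Longrightarrow> a \<in> I k \<tau> \<Longrightarrow> b \<in> I l \<tau> \<Longrightarrow> Q l \<tau> b \<subseteq> Q k \<tau> a \<or> Q l \<tau> b \<inter> Q k \<tau> a = {}"
    by (rule cubes[THEN conjunct1, rule_format])
  show "disjoint_family_on (Q k \<tau>) (I k \<tau>)" by (rule partition[THEN conjunct1])
  show "(\<Union>a\<in>I k \<tau>. Q k \<tau> a) = UNIV" by (rule partition[THEN conjunct2])
  show "a \<in> I k \<tau> \<Longrightarrow> qball \<rho> (z k \<tau> a) (c\<^sub>1 * \<delta> powi k) \<subseteq> Q k \<tau> a"
    by (rule balls[THEN bspec, THEN conjunct1])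
  show "a \<in> I k \<tau> \<Longrightarrow> Q k \<tau> a \<subseteq> qball \<rho> (z k \<tau> a) (C\<^sub>1 * \<delta> powi k)"
    by (rule balls[THEN bspec, THEN conjunct2])
qed

lemma ball_in_cube: "\<exists>C>0. \<forall>x. \<forall>r>0. \<exists>\<tau>\<in>{1..K}. \<exists>k. \<exists>a\<in>I k \<tau>.
    qball \<rho> x r \<subseteq> Q k \<tau> a \<and> qdiam \<rho> (Q k \<tau> a) \<le> ennreal (C * r)"
  by (rule systems[unfolded adjacent_dyadic_systems_def Let_def,
      THEN conjunct2, THEN conjunct2, THEN conjunct2, THEN conjunct2, THEN conjunct2, THEN conjunct2,
      THEN conjunct2])

lemma center_in_cube:
  assumes "\<tau> \<in> {1..K}" "a \<in> I k \<tau>"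
  shows "z k \<tau> a \<in> Q k \<tau> a"
proof -
  have "\<rho> (z k \<tau> a) (z k \<tau> a) = 0" using quasi(3) by blast
  then have "z k \<tau> a \<in> qball \<rho> (z k \<tau> a) (c\<^sub>1 * \<delta> powi k)"
    using constants by (simp add: qball_def)
  then show ?thesis using cube_inner[OF assms] by blast
qed

lemma delta_pos: "0 < \<delta> powi k" "0 < c\<^sub>1 * \<delta> powi k" "0 < C\<^sub>1 * \<delta> powi k"
  using constants by auto

lemma cube_emeasure:
  assumes "\<tau> \<in> {1..K}" "a \<in> I k \<tau>"
  shows "0 < emeasure \<mu> (Q k \<tau> a)" "emeasure \<mu> (Q k \<tau> a) < \<infinity>"
proof -
  have "emeasure \<mu> (qball \<rho> (z k \<tau> a) (c\<^sub>1 * \<delta> powi k)) \<le> emeasure \<mu> (Q k \<tau> a)"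
    using assms by (intro emeasure_mono cube_inner cube_sets)
  then show "0 < emeasure \<mu> (Q k \<tau> a)"
    using ball_pos[OF delta_pos(2), of "z k \<tau> a" k] by (rule less_le_trans[rotated])
  have "emeasure \<mu> (Q k \<tau> a) \<le> emeasure \<mu> (qball \<rho> (z k \<tau> a) (C\<^sub>1 * \<delta> powi k))"
    using assms by (intro emeasure_mono cube_outer ball_sets)
  then show "emeasure \<mu> (Q k \<tau> a) < \<infinity>"
    using ball_finite[OF delta_pos(3), of "z k \<tau> a" k] by (rule le_less_trans)
qed

text \<open>The inner ball of the cube has radius \<open>c\<^sub>1 * \<delta> powi k\<close>;
  doubling with factor \<open>b / c\<^sub>1\<close> enlarges it to the ball in question.\<close>

lemma measure_ball_le_cube:
  "\<exists>C>0. \<forall>\<tau>\<in>{1..K}. \<forall>k. \<forall>a\<in>I k \<tau>. measure \<mu> (qball \<rho> (z k \<tau> a) (b * \<delta> powi k)) \<le> C * measure \<mu> (Q k \<tau> a)"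
proof -
  obtain C where C: "0 < C" "\<And>x r. 0 < r \<Longrightarrow> measure \<mu> (qball \<rho> x (b / c\<^sub>1 * r)) \<le> C * measure \<mu> (qball \<rho> x r)"
    using doubling[of "b / c\<^sub>1"] by blast
  have "measure \<mu> (qball \<rho> (z k \<tau> a) (b * \<delta> powi k)) \<le> C * measure \<mu> (Q k \<tau> a)"
    if \<tau>: "\<tau> \<in> {1..K}" and a: "a \<in> I k \<tau>" for \<tau> k a
  proof -
    have "measure \<mu> (qball \<rho> (z k \<tau> a) (b * \<delta> powi k)) \<le> C * measure \<mu> (qball \<rho> (z k \<tau> a) (c\<^sub>1 * \<delta> powi k))"
      using C(2)[OF delta_pos(2), of "z k \<tau> a" k] constants by simp
    also have "\<dots> \<le> C * measure \<mu> (Q k \<tau> a)"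
      using cube_emeasure[OF \<tau> a] cube_inner[OF \<tau> a] cube_sets[OF \<tau> a] ball_sets C(1)
      by (intro mult_left_mono measure_mono_fmeasurable fmeasurableI) auto
    finally show ?thesis .
  qed
  then show ?thesis using C(1) by blast
qed

text \<open>The first form is the height in the abstract grid, with
  \<open>\<eta> = \<delta> powr p\<close>; the second is the one to compare with
  \<open>l powr p\<close>.\<close>

lemma height_eq: "\<delta> powr (real_of_int k * p) = (\<delta> powr p) powi k" "\<delta> powr (real_of_int k * p) = (\<delta> powi k) powr p"
proof -
  have "\<delta> powi k = \<delta> powr real_of_int k" "(\<delta> powr p) powi k = (\<delta> powr p) powr real_of_int k"
    using constants by (simp_all add: powr_real_of_int')
  then show "\<delta> powr (real_of_int k * p) = (\<delta> powr p) powi k" "\<delta> powr (real_of_int k * p) = (\<delta> powi k) powr p"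
    by (simp_all add: powr_powr mult.commute)
qed

text \<open>Seen from the centre of the child, the parent lies in a ball of radius comparable to
  \<open>\<delta> powi k\<close>, so doubling bounds its measure. The ratio of the heights adds the
  factor \<open>1 / \<delta> powr p\<close>.\<close>

lemma cube_parent_volume:
  "\<exists>D>0. \<forall>\<tau>\<in>{1..K}. \<forall>k. \<forall>a\<in>I k \<tau>. \<forall>b\<in>I (k - 1) \<tau>. Q k \<tau> a \<subseteq> Q (k - 1) \<tau> b \<longrightarrow>
     measure \<mu> (Q (k - 1) \<tau> b) * (\<delta> powr p) powi (k - 1) \<le> D * (measure \<mu> (Q k \<tau> a) * (\<delta> powr p) powi k)"
proof -
  let ?b = "K\<^sub>0 * (2 * C\<^sub>1) / \<delta>"
  obtain C where C: "0 < C" "\<And>\<tau> k a. \<tau> \<in> {1..K} \<Longrightarrow> a \<in> I k \<tau> \<Longrightarrow>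
      measure \<mu> (qball \<rho> (z k \<tau> a) (?b * \<delta> powi k)) \<le> C * measure \<mu> (Q k \<tau> a)"
    using measure_ball_le_cube[of ?b] by blast
  have "measure \<mu> (Q (k - 1) \<tau> b) * (\<delta> powr p) powi (k - 1) \<le> C / \<delta> powr p * (measure \<mu> (Q k \<tau> a) * (\<delta> powr p) powi k)"
    if \<tau>: "\<tau> \<in> {1..K}" and a: "a \<in> I k \<tau>" and b: "b \<in> I (k - 1) \<tau>" and sub: "Q k \<tau> a \<subseteq> Q (k - 1) \<tau> b" for \<tau> k a b
  proof -
    have pos: "0 < ?b * \<delta> powi k" using constants quasi(1) by auto
    have "Q (k - 1) \<tau> b \<subseteq> qball \<rho> (z k \<tau> a) (?b * \<delta> powi k)"
    proof
      fix y assume y: "y \<in> Q (k - 1) \<tau> b"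
      have "z k \<tau> a \<in> Q (k - 1) \<tau> b" using center_in_cube[OF \<tau> a] sub by blast
      then have "\<rho> (z k \<tau> a) (z (k - 1) \<tau> b) < C\<^sub>1 * \<delta> powi (k - 1)" "\<rho> (z (k - 1) \<tau> b) y < C\<^sub>1 * \<delta> powi (k - 1)"
        using cube_outer[OF \<tau> b] y quasi(4) by (auto simp: qball_def)
      then have "\<rho> (z k \<tau> a) y < K\<^sub>0 * (C\<^sub>1 * \<delta> powi (k - 1) + C\<^sub>1 * \<delta> powi (k - 1))" by (rule quasi_less)
      also have "\<dots> = ?b * \<delta> powi k" using constants by (simp add: power_int_diff)
      finally show "y \<in> qball \<rho> (z k \<tau> a) (?b * \<delta> powi k)" by (simp add: qball_def)
    qed
    then have "measure \<mu> (Q (k - 1) \<tau> b) \<le> measure \<mu> (qball \<rho> (z k \<tau> a) (?b * \<delta> powi k))"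
      using cube_sets[OF \<tau> b] pos by (intro measure_mono_ball)
    also have "\<dots> \<le> C * measure \<mu> (Q k \<tau> a)" by (rule C(2)[OF \<tau> a])
    finally have "measure \<mu> (Q (k - 1) \<tau> b) * (\<delta> powr p) powi (k - 1) \<le> C * measure \<mu> (Q k \<tau> a) * (\<delta> powr p) powi (k - 1)"
      using constants by (intro mult_right_mono) auto
    then show ?thesis using constants by (simp add: power_int_diff mult_ac)
  qed
  then show ?thesis using C(1) constants by (intro exI[of _ "C / \<delta> powr p"]) auto
qed

lemma cube_index_countable:
  assumes \<tau>: "\<tau> \<in> {1..K}"
  shows "countable (I k \<tau>)"
proof -
  fix x0 :: 'a
  have ex: "\<exists>n::nat. \<rho> x0 y < real n + 1" for y
  proof -
    obtain n :: nat where "\<rho> x0 y \<le> real n" using real_arch_simple by blast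
    then have "\<rho> x0 y < real n + 1" by simp
    then show ?thesis by blast
  qed
  show ?thesis
  proof (rule countable_disjoint_pos_measure[where B = "\<lambda>n. qball \<rho> x0 (real n + 1)" and A = "Q k \<tau>"])
    show "qball \<rho> x0 (real n + 1) \<in> sets \<mu>" for n by (rule ball_sets)
    show "emeasure \<mu> (qball \<rho> x0 (real n + 1)) < \<infinity>" for n by (intro ball_finite) simp
    show "(\<Union>n::nat. qball \<rho> x0 (real n + 1)) = space \<mu>" using ex by (auto simp: space_mu qball_def)
    show "disjoint_family_on (Q k \<tau>) (I k \<tau>)" using \<tau> by (rule cube_disjoint)
  qed (use \<tau> in \<open>auto intro: cube_sets cube_emeasure\<close>)
qed

text \<open>A single \<open>D\<close> serves all systems, so that the weak type constant will not
  depend on \<tau>.\<close>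

lemma dyadic_grid:
  "\<exists>D. \<forall>\<tau>\<in>{1..K}. dyadic_grid \<mu> (\<lambda>k. I k \<tau>) (\<lambda>k. Q k \<tau>) (\<delta> powr p) D"
proof -
  obtain D where D: "0 < D" "\<And>\<tau> k a b. \<tau> \<in> {1..K} \<Longrightarrow> a \<in> I k \<tau> \<Longrightarrow> b \<in> I (k - 1) \<tau> \<Longrightarrow> Q k \<tau> a \<subseteq> Q (k - 1) \<tau> b \<Longrightarrow>
     measure \<mu> (Q (k - 1) \<tau> b) * (\<delta> powr p) powi (k - 1) \<le> D * (measure \<mu> (Q k \<tau> a) * (\<delta> powr p) powi k)"
    using cube_parent_volume by blast
  have "dyadic_grid \<mu> (\<lambda>k. I k \<tau>) (\<lambda>k. Q k \<tau>) (\<delta> powr p) D" if \<tau>: "\<tau> \<in> {1..K}" for \<tau>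
  proof
    show "\<exists>a\<in>I k \<tau>. x \<in> Q k \<tau> a" for k x using cube_cover[OF \<tau>, of k] by blast
    show "Q l \<tau> b \<subseteq> Q k \<tau> a" if "k \<le> l" "a \<in> I k \<tau>" "b \<in> I l \<tau>" "Q l \<tau> b \<inter> Q k \<tau> a \<noteq> {}" for k l a b
      using cube_nested[OF \<tau> that(1-3)] that(4) by blast
    have "\<delta> powr p \<le> \<delta> powr 1" using constants p by (intro powr_mono') auto
    then show "\<delta> powr p \<le> 1 / 96" using constants by simp
    show "0 < \<delta> powr p" using constants by simp
    show "space \<mu> = UNIV" by (rule space_mu)
    show "Q k \<tau> a \<in> sets \<mu>" if "a \<in> I k \<tau>" for k a using \<tau> that by (rule cube_sets)
    show "0 < emeasure \<mu> (Q k \<tau> a)" if "a \<in> I k \<tau>" for k a using \<tau> that by (rule cube_emeasure)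
    show "emeasure \<mu> (Q k \<tau> a) < \<infinity>" if "a \<in> I k \<tau>" for k a using \<tau> that by (rule cube_emeasure)
    show "disjoint_family_on (Q k \<tau>) (I k \<tau>)" for k using \<tau> by (rule cube_disjoint)
    show "countable (I k \<tau>)" for k using \<tau> by (rule cube_index_countable)
    show "0 < D" by (rule D(1))
    show "measure \<mu> (Q (k - 1) \<tau> b) * (\<delta> powr p) powi (k - 1) \<le> D * (measure \<mu> (Q k \<tau> a) * (\<delta> powr p) powi k)"
      if "a \<in> I k \<tau>" "b \<in> I (k - 1) \<tau>" "Q k \<tau> a \<subseteq> Q (k - 1) \<tau> b" for k a b
      using \<tau> that by (rule D(2))
  qed
  then show ?thesis by blast
qed

text \<open>Walking along a monotone chain towards \<open>x\<close>, the last point at distance at least \<open>s\<close> is still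
  within a fixed multiple of \<open>s\<close>, since the next step is short.\<close>
lemma annulus_nonempty: "\<exists>L\<ge>1. \<forall>x. \<forall>s>0. \<exists>y. s \<le> \<rho> x y \<and> \<rho> x y \<le> L * s"
proof -
  obtain K' where K': "0 < K'" and chain: "\<forall>s>0. \<forall>x y. s \<le> \<rho> x y \<longrightarrow>
      (\<exists>(m::nat) \<xi>. \<xi> 0 = x \<and> \<xi> m = y \<and>
           (\<forall>i<m. \<rho> (\<xi> i) (\<xi> (Suc i)) \<le> K' * s \<and> \<rho> (\<xi> (Suc i)) (\<xi> m) \<le> \<rho> (\<xi> i) (\<xi> m) - s))"
    using geodesic[unfolded monotone_geodesic_def] by (elim exE conjE) (rule that)
  have "\<exists>y. s \<le> \<rho> x y \<and> \<rho> x y \<le> K\<^sub>0 * (K' + 1) * s" if s: "0 < s" for x s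
  proof -
    have "\<exists>w. s \<le> \<rho> x w"
    proof (rule ccontr)
      assume "\<not> ?thesis"
      \<comment> \<open>If all points were close to \<open>x\<close>, the quasi-triangle inequality
        would bound the diameter of the whole space.\<close>
      then have near: "\<rho> u v \<le> K\<^sub>0 * (s + s)" for u v
      proof -
        have "\<rho> x u \<le> s" "\<rho> x v \<le> s" using \<open>\<not> (\<exists>w. s \<le> \<rho> x w)\<close> by (auto simp: not_le less_imp_le)
        then show ?thesis using quasi_le[of u x s v s] quasi(4)[of u x] by simp
      qed
      have "qdiam \<rho> UNIV \<le> ennreal (K\<^sub>0 * (s + s))"
        unfolding qdiam_def using near by (auto intro!: SUP_least ennreal_leI)
      then show False using basic unfolding basic_assumptions_def by (simp add: top_unique)
    qed
    then obtain w where "s \<le> \<rho> w x" using quasi(4) by metis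
    then obtain m :: nat and \<xi> where \<xi>: "\<xi> 0 = w" "\<xi> m = x" and
      step: "\<And>i. i < m \<Longrightarrow> \<rho> (\<xi> i) (\<xi> (Suc i)) \<le> K' * s"
      using chain[rule_format, OF s, of w x] by blast
    have "\<rho> x x < s" using s quasi(3)[of x x] by simp
    then have m: "\<rho> (\<xi> m) x < s" "\<not> \<rho> (\<xi> 0) x < s" using \<xi> \<open>s \<le> \<rho> w x\<close> by auto
    obtain i where i: "i < m" "\<not> \<rho> (\<xi> i) x < s" "\<rho> (\<xi> (Suc i)) x < s"
      using ex_least_nat_less[of "\<lambda>i. \<rho> (\<xi> i) x < s" m] m by blast
    have "\<rho> (\<xi> i) x \<le> K\<^sub>0 * (K' * s + s)"
      using quasi_le[OF step[OF i(1)], of x s] i(3) by simp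
    then have "\<rho> x (\<xi> i) \<le> K\<^sub>0 * (K' + 1) * s" "s \<le> \<rho> x (\<xi> i)"
      using i(2) quasi(4)[of x "\<xi> i"] by (auto simp: algebra_simps)
    then show ?thesis by blast
  qed
  moreover have "1 \<le> K\<^sub>0 * (K' + 1)" using quasi(1) K' by (smt (verit) mult_le_cancel_left1)
  ultimately show ?thesis by blast
qed

text \<open>Containment of a ball and a bound on the diameter do not by themselves fix the level of
  a cube; points at prescribed distance do. A point of the enlarged ball far from \<open>x\<close>
  shows that the cube is large, so \<open>\<delta> powi k\<close> is at least \<open>2 * l\<close>.
  A point of the inner ball far from the centre shows that the diameter is comparable to
  \<open>\<delta> powi k\<close>, so this is at most a multiple of \<open>l\<close>. The factor 2 in
  the height lets the rectangle over any time of the lower half-cylinder reach the end of the upper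
  one.\<close>

lemma rectangle_over_cylinder:
  "\<exists>E>0. \<forall>x. \<forall>l>0. \<exists>\<tau>\<in>{1..K}. \<exists>k. \<exists>a\<in>I k \<tau>. qball \<rho> x l \<subseteq> Q k \<tau> a \<and>
     2 * l powr p \<le> \<delta> powr (real_of_int k * p) \<and>
     measure \<mu> (Q k \<tau> a) * \<delta> powr (real_of_int k * p) \<le> E * (measure \<mu> (qball \<rho> x l) * l powr p)"
proof -
  obtain L where L: "1 \<le> L" and ann: "\<And>x s. 0 < s \<Longrightarrow> \<exists>y. s \<le> \<rho> x y \<and> \<rho> x y \<le> L * s"
    using annulus_nonempty by blast
  obtain C where C: "0 < C" and cube: "\<And>x r. 0 < r \<Longrightarrow> \<exists>\<tau>\<in>{1..K}. \<exists>k. \<exists>a\<in>I k \<tau>.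
    qball \<rho> x r \<subseteq> Q k \<tau> a \<and> qdiam \<rho> (Q k \<tau> a) \<le> ennreal (C * r)"
    using ball_in_cube by blast
  \<comment> \<open>Chosen so that \<open>N * l / (2 * L) < 2 * K\<^sub>0 * C\<^sub>1 * \<delta>
    powi k\<close> forces \<open>2 * l \<le> \<delta> powi k\<close>. The divisor
    \<open>2 * L\<close> keeps the annulus point within half the radius of the ball.\<close>
  define N where "N = max 1 (8 * L * K\<^sub>0 * C\<^sub>1)"
  \<comment> \<open>Read off from
    \<open>c\<^sub>1 * \<delta> powi k / (2 * L) \<le> C * (N * l)\<close>, the comparison of an
    annulus point in the inner ball with the diameter.\<close>
  define b where "b = 2 * L * C * N / c\<^sub>1"
  have N: "1 \<le> N" "8 * L * K\<^sub>0 * C\<^sub>1 \<le> N" by (auto simp: N_def)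
  have b: "0 < b" using L C N constants by (simp add: b_def)
  obtain E where E: "0 < E" "\<And>x r. 0 < r \<Longrightarrow>
      measure \<mu> (qball \<rho> x (K\<^sub>0 * (2 * C\<^sub>1) * b * r)) \<le> E * measure \<mu> (qball \<rho> x r)"
    using doubling[of "K\<^sub>0 * (2 * C\<^sub>1) * b"] by blast
  have "\<exists>\<tau>\<in>{1..K}. \<exists>k. \<exists>a\<in>I k \<tau>. qball \<rho> x l \<subseteq> Q k \<tau> a \<and>
     2 * l powr p \<le> \<delta> powr (real_of_int k * p) \<and>
     measure \<mu> (Q k \<tau> a) * \<delta> powr (real_of_int k * p) \<le> (E * b powr p) * (measure \<mu> (qball \<rho> x l) * l powr p)"
    if l: "0 < l" for x l
  proof -
    have r: "0 < N * l" using N l by simp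
    obtain \<tau> k a where \<tau>: "\<tau> \<in> {1..K}" and a: "a \<in> I k \<tau>" and sub: "qball \<rho> x (N * l) \<subseteq> Q k \<tau> a"
      and diam: "qdiam \<rho> (Q k \<tau> a) \<le> ennreal (C * (N * l))" using cube[OF r] by blast
    let ?h = "\<delta> powi k" and ?z = "z k \<tau> a"
    have "qball \<rho> x l \<subseteq> qball \<rho> x (N * l)" using N l by (intro qball_mono) simp
    then have sub': "qball \<rho> x l \<subseteq> Q k \<tau> a" using sub by blast
    have "\<rho> x x = 0" using quasi(3) by blast
    then have x: "x \<in> Q k \<tau> a" using sub' l by (auto simp: qball_def)
    have low: "2 * l \<le> ?h"
    proof -
      obtain y where y: "N * l / (2 * L) \<le> \<rho> x y" "\<rho> x y \<le> L * (N * l / (2 * L))"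
        using ann[of "N * l / (2 * L)" x] r L by auto
      have "y \<in> qball \<rho> x (N * l)" using y(2) r L by (simp add: qball_def)
      then have "y \<in> Q k \<tau> a" using sub by blast
      then have "\<rho> x ?z < C\<^sub>1 * ?h" "\<rho> ?z y < C\<^sub>1 * ?h"
        using cube_outer[OF \<tau> a] x quasi(4) by (auto simp: qball_def)
      then have "\<rho> x y < K\<^sub>0 * (C\<^sub>1 * ?h + C\<^sub>1 * ?h)" by (rule quasi_less)
      also have "K\<^sub>0 * (C\<^sub>1 * ?h + C\<^sub>1 * ?h) = 2 * K\<^sub>0 * C\<^sub>1 * ?h" by (simp add: algebra_simps)
      finally have "N * l / (2 * L) < 2 * K\<^sub>0 * C\<^sub>1 * ?h" using y(1) by linarith
      then have "N * l < 4 * L * K\<^sub>0 * C\<^sub>1 * ?h" using L by (simp add: field_simps)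
      moreover have "8 * L * K\<^sub>0 * C\<^sub>1 * l \<le> N * l" using N(2) l by (intro mult_right_mono) auto
      ultimately have "(4 * L * K\<^sub>0 * C\<^sub>1) * (2 * l) < (4 * L * K\<^sub>0 * C\<^sub>1) * ?h" by (simp add: mult_ac)
      moreover have "0 < 4 * L * K\<^sub>0 * C\<^sub>1" using L quasi(1) constants by simp
      ultimately show ?thesis by (metis mult_less_cancel_left_pos less_imp_le)
    qed
    have up: "?h \<le> b * l"
    proof -
      have pos: "0 < c\<^sub>1 * ?h / (2 * L)" using delta_pos(2)[of k] L by simp
      obtain y where y: "c\<^sub>1 * ?h / (2 * L) \<le> \<rho> ?z y" "\<rho> ?z y \<le> L * (c\<^sub>1 * ?h / (2 * L))"
        using ann[OF pos, of ?z] by blast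
      have "y \<in> qball \<rho> ?z (c\<^sub>1 * ?h)" using y(2) L delta_pos(2)[of k] by (simp add: qball_def)
      then have "y \<in> Q k \<tau> a" using cube_inner[OF \<tau> a] by blast
      then have "ennreal (\<rho> ?z y) \<le> qdiam \<rho> (Q k \<tau> a)"
        unfolding qdiam_def using center_in_cube[OF \<tau> a] by (intro SUP_upper2[of "(?z, y)"]) auto
      then have "ennreal (\<rho> ?z y) \<le> ennreal (C * (N * l))" using diam by (rule order_trans)
      then have "\<rho> ?z y \<le> C * (N * l)" using C r by (simp add: ennreal_le_iff)
      then have "c\<^sub>1 * ?h / (2 * L) \<le> C * (N * l)" using y(1) by linarith
      then show ?thesis using L constants by (simp add: b_def field_simps)
    qed
    have "2 * l powr p \<le> 2 powr p * l powr p"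
      using p powr_mono[of 1 p 2] by (intro mult_right_mono) auto
    also have "\<dots> = (2 * l) powr p" using l by (simp add: powr_mult)
    also have "\<dots> \<le> \<delta> powr (real_of_int k * p)"
      unfolding height_eq(2) using low l p by (intro powr_mono2) auto
    finally have h: "2 * l powr p \<le> \<delta> powr (real_of_int k * p)" .
    have "Q k \<tau> a \<subseteq> qball \<rho> x (K\<^sub>0 * (2 * C\<^sub>1) * b * l)"
    proof
      fix y assume "y \<in> Q k \<tau> a"
      then have "\<rho> x ?z < C\<^sub>1 * ?h" "\<rho> ?z y < C\<^sub>1 * ?h"
        using cube_outer[OF \<tau> a] x quasi(4) by (auto simp: qball_def)
      then have "\<rho> x y < K\<^sub>0 * (C\<^sub>1 * ?h + C\<^sub>1 * ?h)" by (rule quasi_less)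
      also have "\<dots> = K\<^sub>0 * (2 * C\<^sub>1) * ?h" by simp
      also have "\<dots> \<le> K\<^sub>0 * (2 * C\<^sub>1) * (b * l)" using up quasi(1) constants by (intro mult_left_mono) auto
      finally show "y \<in> qball \<rho> x (K\<^sub>0 * (2 * C\<^sub>1) * b * l)" by (simp add: qball_def mult.assoc)
    qed
    then have "measure \<mu> (Q k \<tau> a) \<le> measure \<mu> (qball \<rho> x (K\<^sub>0 * (2 * C\<^sub>1) * b * l))"
      using b l quasi(1) constants cube_sets[OF \<tau> a] by (intro measure_mono_ball) auto
    also have "\<dots> \<le> E * measure \<mu> (qball \<rho> x l)" by (rule E(2)[OF l])
    finally have m: "measure \<mu> (Q k \<tau> a) \<le> E * measure \<mu> (qball \<rho> x l)" .
    have "\<delta> powr (real_of_int k * p) \<le> (b * l) powr p"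
      unfolding height_eq(2) using up p delta_pos(1)[of k] by (intro powr_mono2) auto
    also have "\<dots> = b powr p * l powr p" using b l by (simp add: powr_mult)
    finally have "measure \<mu> (Q k \<tau> a) * \<delta> powr (real_of_int k * p) \<le> (E * measure \<mu> (qball \<rho> x l)) * (b powr p * l powr p)"
      using m E(1) by (intro mult_mono) auto
    then show ?thesis using \<tau> a sub' h by (intro bexI[of _ \<tau>] exI[of _ k] bexI[of _ a]) (auto simp: mult_ac)
  qed
  then show ?thesis using E(1) b by (intro exI[of _ "E * b powr p"]) auto
qed

end

section \<open>The class A-plus and the maximal operator\<close>

context dyadic_parabolic
begin

lemma half_cylinder_emeasure:
  assumes "0 < l"
  shows "emeasure \<Lambda> (cyl_minus p \<rho> x t l) = ennreal (measure \<mu> (qball \<rho> x l) * l powr p)"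
    and "emeasure \<Lambda> (cyl_plus p \<rho> x t l) = ennreal (measure \<mu> (qball \<rho> x l) * l powr p)"
  using assms by (simp_all add: cyl_minus_def cyl_plus_def emeasure_times_lebesgue ball_sets emeasure_ball ennreal_mult)

lemma half_cylinder_sets [measurable]:
  "cyl_minus p \<rho> x t l \<in> sets \<Lambda>" "cyl_plus p \<rho> x t l \<in> sets \<Lambda>"
  by (auto simp: cyl_minus_def cyl_plus_def intro!: ball_sets)

lemma half_cylinder_volume_pos: "0 < l \<Longrightarrow> 0 < measure \<mu> (qball \<rho> x l) * l powr p"
  by (simp add: measure_ball_pos)

context
  fixes \<omega> :: "'a \<times> real \<Rightarrow> real" and q :: real
  assumes weight: "weight p \<rho> \<mu> \<omega>" and q: "1 < q"
begin

lemma weight_measurable [measurable]: "\<omega> \<in> borel_measurable \<Lambda>" and weight_pos: "AE w in \<Lambda>. 0 < \<omega> w"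
  using weight unfolding weight_def par_measure_def by blast+

lemma dual_weight_pos: "AE w in \<Lambda>. 0 < \<omega> w powr (1 - conj_exp q)"
  using weight_pos by eventually_elim simp

lemma A_plus_iff: "\<omega> \<in> A_plus p \<rho> \<mu> q \<longleftrightarrow> (\<exists>A\<ge>0. \<forall>x t. \<forall>l>0.
    avg \<Lambda> (cyl_minus p \<rho> x t l) \<omega> *
    ennpow (avg \<Lambda> (cyl_plus p \<rho> x t l) (\<lambda>w. \<omega> w powr (1 - conj_exp q))) (q - 1) \<le> ennreal A)"
  (is "_ \<longleftrightarrow> (\<exists>A\<ge>0. \<forall>x t. \<forall>l>0. ?V x t l \<le> ennreal A)")
proof -
  let ?S = "SUP (x, t, l) \<in> UNIV \<times> UNIV \<times> {0<..}. ?V x t l"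
  have "\<omega> \<in> A_plus p \<rho> \<mu> q \<longleftrightarrow> ?S < \<infinity>"
    using weight by (simp add: A_plus_def par_measure_def)
  also have "\<dots> \<longleftrightarrow> (\<exists>A\<ge>0. ?S \<le> ennreal A)"
  proof
    assume "?S < \<infinity>"
    then show "\<exists>A\<ge>0. ?S \<le> ennreal A" by (cases ?S) auto
  next
    assume "\<exists>A\<ge>0. ?S \<le> ennreal A"
    then show "?S < \<infinity>" by (auto intro: le_less_trans)
  qed
  also have "\<dots> \<longleftrightarrow> (\<exists>A\<ge>0. \<forall>x t. \<forall>l>0. ?V x t l \<le> ennreal A)"
    by (simp add: SUP_le_iff Ball_def)
  finally show ?thesis .
qed

text \<open>Both integrals are positive because the weights are positive almost everywhere; a finite
  product of positive factors then forces each of them to be finite.\<close>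

lemma A_plus_real:
  assumes A: "0 \<le> A" and l: "0 < l" and bound: "avg \<Lambda> (cyl_minus p \<rho> x t l) \<omega> *
    ennpow (avg \<Lambda> (cyl_plus p \<rho> x t l) (\<lambda>w. \<omega> w powr (1 - conj_exp q))) (q - 1) \<le> ennreal A"
  obtains y where "0 < y" "(\<integral>\<^sup>+w\<in>cyl_plus p \<rho> x t l. ennreal (\<omega> w powr (1 - conj_exp q)) \<partial>\<Lambda>) = ennreal y"
    "(\<integral>\<^sup>+w\<in>cyl_minus p \<rho> x t l. ennreal (\<omega> w) \<partial>\<Lambda>)
      \<le> ennreal (A * (measure \<mu> (qball \<rho> x l) * l powr p) powr q / y powr (q - 1))"
proof -
  let ?X = "\<integral>\<^sup>+w\<in>cyl_minus p \<rho> x t l. ennreal (\<omega> w) \<partial>\<Lambda>"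
  let ?Y = "\<integral>\<^sup>+w\<in>cyl_plus p \<rho> x t l. ennreal (\<omega> w powr (1 - conj_exp q)) \<partial>\<Lambda>"
  define v where "v = measure \<mu> (qball \<rho> x l) * l powr p"
  have v: "0 < v" unfolding v_def using l by (rule half_cylinder_volume_pos)
  have em: "emeasure \<Lambda> (cyl_minus p \<rho> x t l) = ennreal v" "emeasure \<Lambda> (cyl_plus p \<rho> x t l) = ennreal v"
    using half_cylinder_emeasure[OF l] by (simp_all add: v_def)
  have X: "0 < ?X" using v by (intro set_nn_integral_pos weight_pos) (auto simp: em)
  have Y: "0 < ?Y" using v by (intro set_nn_integral_pos dual_weight_pos) (auto simp: em)
  have le: "?X / ennreal v * ennpow (?Y / ennreal v) (q - 1) \<le> ennreal A"
    using bound by (simp add: avg_def em)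
  have "?Y \<noteq> top"
  proof
    assume "?Y = top"
    then have "?Y / ennreal v = top" using v by (simp add: ennreal_top_divide)
    moreover have "?X / ennreal v \<noteq> 0" using X v by (cases ?X) (auto simp: divide_ennreal ennreal_top_divide)
    ultimately show False using le by (simp add: ennreal_mult_top top_unique)
  qed
  then obtain y where y: "?Y = ennreal y" "0 < y" using Y by (cases ?Y) auto
  have pw: "ennpow (?Y / ennreal v) (q - 1) = ennreal ((y / v) powr (q - 1))"
    using y v by (simp add: divide_ennreal ennpow_ennreal)
  have "?X \<noteq> top"
  proof
    assume "?X = top"
    then have "?X / ennreal v = top" using v by (simp add: ennreal_top_divide)
    moreover have "(y / v) powr (q - 1) > 0" using y v by simp
    ultimately show False using le unfolding pw by (simp add: ennreal_top_mult top_unique)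
  qed
  then obtain u where u: "?X = ennreal u" "0 < u" using X by (cases ?X) auto
  have "ennreal (u / v * (y / v) powr (q - 1)) \<le> ennreal A"
    using le u v unfolding pw by (subst ennreal_mult) (auto simp: divide_ennreal)
  then have "u / v * (y / v) powr (q - 1) \<le> A" using A by (simp add: ennreal_le_iff)
  then have "u / v * (y powr (q - 1) / v powr (q - 1)) \<le> A" using y v by (simp add: powr_divide)
  then have "u * y powr (q - 1) \<le> A * (v * v powr (q - 1))" using v by (simp add: field_simps)
  also have "v * v powr (q - 1) = v powr q" using v by (simp add: powr_mult_base)
  finally have "u \<le> A * v powr q / y powr (q - 1)" using y by (simp add: field_simps)
  then show ?thesis using that[OF y(2,1)] u by (auto simp: v_def intro!: ennreal_leI)
qed

text \<open>Each half cell sits in the half-cylinder of the same time around the centre of its cube,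
  of radius \<open>b * \<delta> powi k\<close>: \<open>C\<^sub>1 \<le> b\<close> covers the cube and
  \<open>1 \<le> b\<close> the height. Volumes grow by at most \<open>E * b powr p\<close>, which
  enters the new constant to the power \<open>q\<close>.\<close>

lemma weighted_dyadic_grids:
  assumes "\<omega> \<in> A_plus p \<rho> \<mu> q"
  shows "\<exists>D A. \<forall>\<tau>\<in>{1..K}. weighted_dyadic_grid \<mu> (\<lambda>k. I k \<tau>) (\<lambda>k. Q k \<tau>) (\<delta> powr p) D \<omega> q A"
proof -
  obtain A where A: "0 \<le> A" and bound: "\<And>x t l. 0 < l \<Longrightarrow> avg \<Lambda> (cyl_minus p \<rho> x t l) \<omega> *
    ennpow (avg \<Lambda> (cyl_plus p \<rho> x t l) (\<lambda>w. \<omega> w powr (1 - conj_exp q))) (q - 1) \<le> ennreal A"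
    using assms unfolding A_plus_iff by blast
  obtain D where grid: "\<And>\<tau>. \<tau> \<in> {1..K} \<Longrightarrow> dyadic_grid \<mu> (\<lambda>k. I k \<tau>) (\<lambda>k. Q k \<tau>) (\<delta> powr p) D"
    using dyadic_grid by blast
  define b where "b = max 1 C\<^sub>1"
  have b: "1 \<le> b" "C\<^sub>1 \<le> b" by (auto simp: b_def)
  obtain E where E: "0 < E" "\<And>\<tau> k a. \<tau> \<in> {1..K} \<Longrightarrow> a \<in> I k \<tau> \<Longrightarrow>
      measure \<mu> (qball \<rho> (z k \<tau> a) (b * \<delta> powi k)) \<le> E * measure \<mu> (Q k \<tau> a)"
    using measure_ball_le_cube[of b] by blast
  define A' where "A' = A * (E * b powr p) powr q"
  have "weighted_dyadic_grid \<mu> (\<lambda>k. I k \<tau>) (\<lambda>k. Q k \<tau>) (\<delta> powr p) D \<omega> q A'" if \<tau>: "\<tau> \<in> {1..K}" for \<tau>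
  proof -
    interpret dyadic_grid \<mu> "\<lambda>k. I k \<tau>" "\<lambda>k. Q k \<tau>" "\<delta> powr p" D by (rule grid[OF \<tau>])
    have half: "\<exists>s>0. (\<integral>\<^sup>+w\<in>upper P. ennreal (\<omega> w powr (1 - conj_exp q)) \<partial>\<Lambda>) = ennreal s \<and>
       (\<integral>\<^sup>+w\<in>lower P. ennreal (\<omega> w) \<partial>\<Lambda>) \<le> ennreal (A' * vol P powr q / s powr (q - 1))" if P: "P \<in> cells" for P
    proof -
      obtain k a t where eq: "P = (k, a, t)" by (metis prod_cases3)
      have a: "a \<in> I k \<tau>" using P by (simp add: cells_def eq)
      let ?l = "b * \<delta> powi k" and ?c = "z k \<tau> a"
      have l: "0 < ?l" using b constants by auto
      obtain y where y: "0 < y" "(\<integral>\<^sup>+w\<in>cyl_plus p \<rho> ?c t ?l. ennreal (\<omega> w powr (1 - conj_exp q)) \<partial>\<Lambda>) = ennreal y"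
        "(\<integral>\<^sup>+w\<in>cyl_minus p \<rho> ?c t ?l. ennreal (\<omega> w) \<partial>\<Lambda>)
          \<le> ennreal (A * (measure \<mu> (qball \<rho> ?c ?l) * ?l powr p) powr q / y powr (q - 1))"
        by (rule A_plus_real[OF A l bound[OF l]])
      have lp: "?l powr p = b powr p * (\<delta> powr p) powi k"
        using b constants by (simp add: powr_mult flip: height_eq)
      have "(\<delta> powr p) powi k \<le> ?l powr p"
        unfolding lp using mult_right_mono[of 1 "b powr p" "(\<delta> powr p) powi k"] ge_one_powr_ge_zero[of b p] b p
        by simp
      moreover have "Q k \<tau> a \<subseteq> qball \<rho> ?c ?l"
        using cube_outer[OF \<tau> a] qball_mono[of "C\<^sub>1 * \<delta> powi k" ?l ?c] b constants by (auto simp: mult_right_mono)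
      ultimately have sub: "upper P \<subseteq> cyl_plus p \<rho> ?c t ?l" "lower P \<subseteq> cyl_minus p \<rho> ?c t ?l"
        by (auto simp: upper_def lower_def eq cyl_plus_def cyl_minus_def)
      have "measure \<mu> (qball \<rho> ?c ?l) * ?l powr p \<le> E * measure \<mu> (Q k \<tau> a) * ?l powr p"
        by (intro mult_right_mono E(2)[OF \<tau> a]) simp
      also have "\<dots> = E * b powr p * vol P" unfolding lp by (simp add: vol_def eq)
      finally have v: "measure \<mu> (qball \<rho> ?c ?l) * ?l powr p \<le> E * b powr p * vol P" .
      have Y: "(\<integral>\<^sup>+w\<in>upper P. ennreal (\<omega> w powr (1 - conj_exp q)) \<partial>\<Lambda>) \<le> ennreal y"
        unfolding y(2)[symmetric] using sub by (intro nn_integral_mono) (auto simp: indicator_def)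
      have "0 < (\<integral>\<^sup>+w\<in>upper P. ennreal (\<omega> w powr (1 - conj_exp q)) \<partial>\<Lambda>)"
        using vol_pos[OF P] upper_sets[OF P] by (intro set_nn_integral_pos dual_weight_pos) (auto simp: emeasure_upper[OF P])
      with Y obtain s where s: "0 < s" "s \<le> y" "(\<integral>\<^sup>+w\<in>upper P. ennreal (\<omega> w powr (1 - conj_exp q)) \<partial>\<Lambda>) = ennreal s"
        using y(1) by (cases "\<integral>\<^sup>+w\<in>upper P. ennreal (\<omega> w powr (1 - conj_exp q)) \<partial>\<Lambda>") (auto simp: top_unique ennreal_le_iff)
      have "(\<integral>\<^sup>+w\<in>lower P. ennreal (\<omega> w) \<partial>\<Lambda>) \<le> (\<integral>\<^sup>+w\<in>cyl_minus p \<rho> ?c t ?l. ennreal (\<omega> w) \<partial>\<Lambda>)"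
        using sub by (intro nn_integral_mono) (auto simp: indicator_def)
      also note y(3)
      \<comment> \<open>Shrinking from the cylinder to the cell lowers the dual mass from
        \<open>y\<close> to \<open>s\<close>; as it stands in the denominator, the bound only gets
        weaker.\<close>
      also have "ennreal (A * (measure \<mu> (qball \<rho> ?c ?l) * ?l powr p) powr q / y powr (q - 1))
          \<le> ennreal (A * (E * b powr p * vol P) powr q / s powr (q - 1))"
        using A v s q by (intro ennreal_leI frac_le mult_left_mono powr_mono2) auto
      also have "A * (E * b powr p * vol P) powr q / s powr (q - 1) = A' * vol P powr q / s powr (q - 1)"
        using E(1) vol_nonneg[OF P] by (simp add: A'_def powr_mult)
      finally show ?thesis using s by blast
    qed
    show ?thesis
    proof
      show "0 \<le> A'" using A by (simp add: A'_def)
    qed (fact weight_measurable weight_pos q half)+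
  qed
  then show ?thesis by blast
qed

text \<open>A strict lower bound on a supremum is attained by a single rectangle, which leads from
  the operator to the cells.\<close>

lemma max_plus_less_iff:
  assumes grid: "\<And>\<tau>. \<tau> \<in> {1..K} \<Longrightarrow> dyadic_grid \<mu> (\<lambda>k. I k \<tau>) (\<lambda>k. Q k \<tau>) (\<delta> powr p) D" and xi: "0 \<le> \<xi>"
  shows "ennreal \<xi> < max_plus p \<mu> \<delta> K I Q f (x, t) \<longleftrightarrow> (\<exists>\<tau>\<in>{1..K}. \<exists>k. \<exists>a\<in>I k \<tau>. x \<in> Q k \<tau> a \<and>
    ennreal (\<xi> * (measure \<mu> (Q k \<tau> a) * (\<delta> powr p) powi k)) <
      (\<integral>\<^sup>+w\<in>Q k \<tau> a \<times> {t<..<t + (\<delta> powr p) powi k}. ennreal \<bar>f w\<bar> \<partial>\<Lambda>))"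
proof -
  have step: "ennreal \<xi> < avg \<Lambda> (rect_plus p \<delta> Q \<tau> k a t) (\<lambda>w. \<bar>f w\<bar>) \<longleftrightarrow>
      ennreal (\<xi> * (measure \<mu> (Q k \<tau> a) * (\<delta> powr p) powi k)) <
      (\<integral>\<^sup>+w\<in>Q k \<tau> a \<times> {t<..<t + (\<delta> powr p) powi k}. ennreal \<bar>f w\<bar> \<partial>\<Lambda>)"
    if \<tau>: "\<tau> \<in> {1..K}" and a: "a \<in> I k \<tau>" for \<tau> k a
  proof -
    interpret dyadic_grid \<mu> "\<lambda>k. I k \<tau>" "\<lambda>k. Q k \<tau>" "\<delta> powr p" D by (rule grid[OF \<tau>])
    have P: "(k, a, t) \<in> cells" using a by (simp add: cells_def)
    have rect: "rect_plus p \<delta> Q \<tau> k a t = upper (k, a, t)"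
      by (simp add: rect_plus_def upper_def height_eq(1))
    have "ennreal \<xi> < avg \<Lambda> (upper (k, a, t)) (\<lambda>w. \<bar>f w\<bar>) \<longleftrightarrow>
       ennreal (\<xi> * vol (k, a, t)) < (\<integral>\<^sup>+w\<in>upper (k, a, t). ennreal \<bar>f w\<bar> \<partial>\<Lambda>)"
      unfolding avg_def emeasure_upper[OF P] using vol_pos[OF P] xi by (rule less_divide_iff_ennreal)
    then show ?thesis unfolding rect by (simp add: vol_def upper_def)
  qed
  have "ennreal \<xi> < max_plus p \<mu> \<delta> K I Q f (x, t) \<longleftrightarrow> (\<exists>\<tau>\<in>{1..K}. \<exists>k. \<exists>a\<in>I k \<tau>. x \<in> Q k \<tau> a \<and>
      ennreal \<xi> < avg \<Lambda> (rect_plus p \<delta> Q \<tau> k a t) (\<lambda>w. \<bar>f w\<bar>))"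
    unfolding max_plus_def par_measure_def by (simp add: less_SUP_iff Bex_def conj_assoc)
  also have "\<dots> \<longleftrightarrow> (\<exists>\<tau>\<in>{1..K}. \<exists>k. \<exists>a\<in>I k \<tau>. x \<in> Q k \<tau> a \<and>
      ennreal (\<xi> * (measure \<mu> (Q k \<tau> a) * (\<delta> powr p) powi k)) <
      (\<integral>\<^sup>+w\<in>Q k \<tau> a \<times> {t<..<t + (\<delta> powr p) powi k}. ennreal \<bar>f w\<bar> \<partial>\<Lambda>))"
    by (intro bex_cong refl ex_cong1 conj_cong step)
  finally show ?thesis .
qed

section \<open>Sufficiency: summing over the adjacent systems\<close>

lemma bounded_of_A_plus:
  assumes "\<omega> \<in> A_plus p \<rho> \<mu> q"
  shows "bounded_Lq_weak_Lq (par_measure \<mu>) \<omega> q (max_plus p \<mu> \<delta> K I Q)"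
proof -
  obtain D A where wgrid: "\<And>\<tau>. \<tau> \<in> {1..K} \<Longrightarrow>
      weighted_dyadic_grid \<mu> (\<lambda>k. I k \<tau>) (\<lambda>k. Q k \<tau>) (\<delta> powr p) D \<omega> q A"
    using weighted_dyadic_grids[OF assms] by blast
  have grid: "\<And>\<tau>. \<tau> \<in> {1..K} \<Longrightarrow> dyadic_grid \<mu> (\<lambda>k. I k \<tau>) (\<lambda>k. Q k \<tau>) (\<delta> powr p) D"
    using wgrid by (rule weighted_dyadic_grid.axioms)
  define W where "W = weighted_dyadic_grid.weak_constant D q A"
  \<comment> \<open>One contribution \<open>W\<close> for each of the \<open>K\<close> systems; the
    lower bound 1 makes the constant positive, as needed to take it out of the power
    \<open>1 / q\<close>.\<close>
  define c where "c = max 1 (K * W)"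
  have c: "0 < c" "K * W \<le> c" by (auto simp: c_def)
  have "weak_Lq_norm \<Lambda> \<omega> q (max_plus p \<mu> \<delta> K I Q f) \<le> ennreal (c powr (1 / q)) * Lq_norm \<Lambda> \<omega> q f"
    if f: "f \<in> borel_measurable \<Lambda>" for f
    unfolding weak_Lq_norm_def
  proof (rule SUP_least)
    fix \<xi> :: real assume "\<xi> \<in> {0<..}"
    then have xi: "0 < \<xi>" by simp
    let ?X = "\<integral>\<^sup>+w. ennreal (\<bar>f w\<bar> powr q * \<omega> w) \<partial>\<Lambda>"
    let ?G = "{w \<in> space \<Lambda>. ennreal \<xi> < max_plus p \<mu> \<delta> K I Q f w}"
    define G\<^sub>\<tau> where "G\<^sub>\<tau> = (\<lambda>\<tau>. {(x, t). \<exists>k. \<exists>a\<in>I k \<tau>. x \<in> Q k \<tau> a \<and>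
        ennreal (\<xi> * (measure \<mu> (Q k \<tau> a) * (\<delta> powr p) powi k)) <
        (\<integral>\<^sup>+w\<in>Q k \<tau> a \<times> {t<..<t + (\<delta> powr p) powi k}. ennreal \<bar>f w\<bar> \<partial>\<Lambda>)})"
    have "\<forall>\<tau>\<in>{1..K}. \<exists>H. H \<in> sets \<Lambda> \<and> G\<^sub>\<tau> \<tau> \<subseteq> H \<and>
        (\<integral>\<^sup>+w\<in>H. ennreal (\<omega> w) \<partial>\<Lambda>) \<le> ennreal (W / \<xi> powr q) * ?X"
    proof
      fix \<tau> assume \<tau>: "\<tau> \<in> {1..K}"
      interpret weighted_dyadic_grid \<mu> "\<lambda>k. I k \<tau>" "\<lambda>k. Q k \<tau>" "\<delta> powr p" D \<omega> q A by (rule wgrid[OF \<tau>])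
      show "\<exists>H. H \<in> sets \<Lambda> \<and> G\<^sub>\<tau> \<tau> \<subseteq> H \<and>
        (\<integral>\<^sup>+w\<in>H. ennreal (\<omega> w) \<partial>\<Lambda>) \<le> ennreal (W / \<xi> powr q) * ?X"
        using weak_type[OF xi f] unfolding G\<^sub>\<tau>_def W_def vol_def upper_def Bex_def[of "sets \<Lambda>"] by simp
    qed
    then obtain H where H: "\<And>\<tau>. \<tau> \<in> {1..K} \<Longrightarrow> H \<tau> \<in> sets \<Lambda>" "\<And>\<tau>. \<tau> \<in> {1..K} \<Longrightarrow> G\<^sub>\<tau> \<tau> \<subseteq> H \<tau>"
      "\<And>\<tau>. \<tau> \<in> {1..K} \<Longrightarrow> (\<integral>\<^sup>+w\<in>H \<tau>. ennreal (\<omega> w) \<partial>\<Lambda>) \<le> ennreal (W / \<xi> powr q) * ?X"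
      unfolding bchoice_iff by blast
    have G: "\<exists>\<tau>\<in>{1..K}. w \<in> H \<tau>" if "w \<in> ?G" for w
    proof -
      obtain x t where w: "w = (x, t)" by (cases w)
      have "ennreal \<xi> < max_plus p \<mu> \<delta> K I Q f (x, t)" using that by (simp add: w)
      from iffD1[OF max_plus_less_iff[OF grid less_imp_le[OF xi]] this]
      obtain \<tau> where \<tau>: "\<tau> \<in> {1..K}" "w \<in> G\<^sub>\<tau> \<tau>"
        unfolding G\<^sub>\<tau>_def w by blast
      then show ?thesis using H(2) by blast
    qed
    \<comment> \<open>The integral is monotone in the integrand whether or not \<open>?G\<close> is
      measurable, so the measurable sets \<open>H \<tau>\<close> suffice.\<close>
    have "(\<integral>\<^sup>+w\<in>?G. ennreal (\<omega> w) \<partial>\<Lambda>) \<le> (\<integral>\<^sup>+w. (\<Sum>\<tau>\<in>{1..K}. ennreal (\<omega> w) * indicator (H \<tau>) w) \<partial>\<Lambda>)"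
    proof (rule nn_integral_mono)
      fix w
      show "ennreal (\<omega> w) * indicator ?G w \<le> (\<Sum>\<tau>\<in>{1..K}. ennreal (\<omega> w) * indicator (H \<tau>) w)"
      proof (cases "w \<in> ?G")
        case True
        then obtain \<tau> where "\<tau> \<in> {1..K}" "w \<in> H \<tau>" using G by blast
        then show ?thesis
          using True member_le_sum[of \<tau> "{1..K}" "\<lambda>\<tau>. ennreal (\<omega> w) * indicator (H \<tau>) w"] by simp
      qed simp
    qed
    also have "\<dots> = (\<Sum>\<tau>\<in>{1..K}. \<integral>\<^sup>+w\<in>H \<tau>. ennreal (\<omega> w) \<partial>\<Lambda>)"
      using H(1) by (intro nn_integral_sum) auto
    also have "\<dots> \<le> (\<Sum>\<tau>\<in>{1..K}. ennreal (W / \<xi> powr q) * ?X)" by (intro sum_mono H(3))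
    also have "\<dots> = ennreal (real K) * ennreal (W / \<xi> powr q) * ?X"
      by (simp add: ennreal_of_nat_eq_real_of_nat mult.assoc)
    also have "ennreal (real K) * ennreal (W / \<xi> powr q) \<le> ennreal (c / \<xi> powr q)"
      using c(2) xi by (subst ennreal_mult'[symmetric]) (auto intro!: ennreal_leI divide_right_mono)
    finally have main: "(\<integral>\<^sup>+w\<in>?G. ennreal (\<omega> w) \<partial>\<Lambda>) \<le> ennreal (c / \<xi> powr q) * ?X"
      by (simp add: mult_right_mono)
    have "ennreal \<xi> * ennpow (\<integral>\<^sup>+w\<in>?G. ennreal (\<omega> w) \<partial>\<Lambda>) (1 / q)
        \<le> ennreal \<xi> * ennpow (ennreal (c / \<xi> powr q) * ?X) (1 / q)"
      using q by (intro mult_left_mono ennpow_mono main) auto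
    also have "\<dots> = ennreal (\<xi> * (c / \<xi> powr q) powr (1 / q)) * ennpow ?X (1 / q)"
      using c xi by (simp add: ennpow_cmult ennreal_mult mult.assoc)
    also have "\<xi> * (c / \<xi> powr q) powr (1 / q) = c powr (1 / q)"
      using c xi q by (simp add: powr_divide powr_powr)
    finally show "ennreal \<xi> * ennpow (\<integral>\<^sup>+w\<in>?G. ennreal (\<omega> w) \<partial>\<Lambda>) (1 / q) \<le> ennreal (c powr (1 / q)) * Lq_norm \<Lambda> \<omega> q f"
      by (simp add: Lq_norm_def)
  qed
  then show ?thesis
    unfolding bounded_Lq_weak_Lq_def par_measure_def Lq_space_def by blast
qed

section \<open>Necessity: testing on the truncated dual weight\<close>

lemma A_plus_of_bounded:
  assumes "bounded_Lq_weak_Lq (par_measure \<mu>) \<omega> q (max_plus p \<mu> \<delta> K I Q)"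
  shows "\<omega> \<in> A_plus p \<rho> \<mu> q"
proof -
  obtain C where C: "\<And>f. f \<in> Lq_space \<Lambda> \<omega> q \<Longrightarrow>
      weak_Lq_norm \<Lambda> \<omega> q (max_plus p \<mu> \<delta> K I Q f) \<le> ennreal C * Lq_norm \<Lambda> \<omega> q f"
    using assms unfolding bounded_Lq_weak_Lq_def par_measure_def by blast
  define C' where "C' = max 0 C"
  obtain D where grid: "\<And>\<tau>. \<tau> \<in> {1..K} \<Longrightarrow> dyadic_grid \<mu> (\<lambda>k. I k \<tau>) (\<lambda>k. Q k \<tau>) (\<delta> powr p) D"
    using dyadic_grid by blast
  obtain E where E: "0 < E" and rect: "\<And>x l. 0 < l \<Longrightarrow> \<exists>\<tau>\<in>{1..K}. \<exists>k. \<exists>a\<in>I k \<tau>. qball \<rho> x l \<subseteq> Q k \<tau> a \<and>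
     2 * l powr p \<le> \<delta> powr (real_of_int k * p) \<and>
     measure \<mu> (Q k \<tau> a) * \<delta> powr (real_of_int k * p) \<le> E * (measure \<mu> (qball \<rho> x l) * l powr p)"
    using rectangle_over_cylinder by blast
  define A where "A = (2 * E * C') powr q"
  let ?\<sigma> = "\<lambda>w. \<omega> w powr (1 - conj_exp q)"
  \<comment> \<open>By this identity the \<open>q\<close>-th power of the dual weight times \<omega>
    is the dual weight again, so the norm of the test function is given by its own integral.\<close>
  have e1: "(1 - conj_exp q) * q + 1 = 1 - conj_exp q" and e2: "1 - conj_exp q < 0"
    using q by (simp_all add: conj_exp_def field_simps)
  have "avg \<Lambda> (cyl_minus p \<rho> x t l) \<omega> * ennpow (avg \<Lambda> (cyl_plus p \<rho> x t l) ?\<sigma>) (q - 1) \<le> ennreal A"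
    if l: "0 < l" for x t l
  proof -
    let ?Rm = "cyl_minus p \<rho> x t l" and ?Rp = "cyl_plus p \<rho> x t l"
    define v where "v = measure \<mu> (qball \<rho> x l) * l powr p"
    have v: "0 < v" unfolding v_def using l by (rule half_cylinder_volume_pos)
    have em: "emeasure \<Lambda> ?Rm = ennreal v" "emeasure \<Lambda> ?Rp = ennreal v"
      using half_cylinder_emeasure[OF l] by (simp_all add: v_def)
    obtain \<tau> k a where \<tau>: "\<tau> \<in> {1..K}" and a: "a \<in> I k \<tau>" and sub: "qball \<rho> x l \<subseteq> Q k \<tau> a"
      and h: "2 * l powr p \<le> (\<delta> powr p) powi k"
      and vol: "measure \<mu> (Q k \<tau> a) * (\<delta> powr p) powi k \<le> E * v"
      using rect[OF l, of x] unfolding v_def height_eq(1) by blast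
    \<comment> \<open>The dual weight may have infinite integral on the upper half. Where \<omega>
      exceeds \<open>1 / (real n + 1)\<close> it is bounded, and these sets exhaust the half up to a
      null set.\<close>
    define B where "B = (\<lambda>n::nat. ?Rp \<inter> {w \<in> space \<Lambda>. 1 / (real n + 1) < \<omega> w})"
    have B [measurable]: "B n \<in> sets \<Lambda>" for n unfolding B_def by measurable
    define X where "X = (\<integral>\<^sup>+w\<in>?Rm. ennreal (\<omega> w) \<partial>\<Lambda>)"
    define S where "S = (\<lambda>n. \<integral>\<^sup>+w\<in>B n. ennreal (?\<sigma> w) \<partial>\<Lambda>)"
    have S_fin: "S n < top" for n
    proof -
      have "S n \<le> (\<integral>\<^sup>+w. ennreal ((1 / (real n + 1)) powr (1 - conj_exp q)) * indicator ?Rp w \<partial>\<Lambda>)"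
        unfolding S_def
      proof (intro nn_integral_mono)
        fix w
        show "ennreal (?\<sigma> w) * indicator (B n) w \<le> ennreal ((1 / (real n + 1)) powr (1 - conj_exp q)) * indicator ?Rp w"
          using e2 powr_mono2'[of "1 - conj_exp q" "1 / (real n + 1)" "\<omega> w"]
          by (auto simp: B_def indicator_def intro!: ennreal_leI)
      qed
      also have "\<dots> = ennreal ((1 / (real n + 1)) powr (1 - conj_exp q)) * ennreal v"
        by (simp add: nn_integral_cmult_indicator em)
      also have "\<dots> < top" by (simp add: ennreal_mult_less_top)
      finally show ?thesis .
    qed
    have key: "X \<le> ennreal (A * v powr q / s powr (q - 1))" if s: "S n = ennreal s" "0 < s" for n s
    proof -
      define f where "f = (\<lambda>w. ?\<sigma> w * indicator (B n) w)"
      have f_meas: "f \<in> borel_measurable \<Lambda>" unfolding f_def by measurable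
      have pos: "0 < \<omega> w" if "w \<in> B n" for w
        using that by (auto simp: B_def intro: less_trans[rotated])
      have "\<bar>f w\<bar> powr q * \<omega> w = ?\<sigma> w * indicator (B n) w" for w
      proof (cases "w \<in> B n")
        case True
        have "\<bar>f w\<bar> powr q * \<omega> w = \<omega> w powr ((1 - conj_exp q) * q) * \<omega> w powr 1"
          using True pos[OF True] by (simp add: f_def powr_powr)
        also have "\<dots> = ?\<sigma> w" using e1 by (simp only: powr_add[symmetric])
        finally show ?thesis using True by simp
      qed (simp add: f_def)
      then have "(\<integral>\<^sup>+w. ennreal (\<bar>f w\<bar> powr q * \<omega> w) \<partial>\<Lambda>) = S n"
        unfolding S_def by (intro nn_integral_cong) (simp add: indicator_def)
      then have norm: "Lq_norm \<Lambda> \<omega> q f = ennreal (s powr (1 / q))"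
        using s by (simp add: Lq_norm_def ennpow_ennreal)
      then have "f \<in> Lq_space \<Lambda> \<omega> q" using f_meas by (simp add: Lq_space_def)
      then have "weak_Lq_norm \<Lambda> \<omega> q (max_plus p \<mu> \<delta> K I Q f) \<le> ennreal C * ennreal (s powr (1 / q))"
        using C norm by metis
      also have "\<dots> = ennreal (C' * s powr (1 / q))"
        by (simp add: C'_def max_def ennreal_mult' ennreal_neg)
      finally have weak: "weak_Lq_norm \<Lambda> \<omega> q (max_plus p \<mu> \<delta> K I Q f) \<le> ennreal (C' * s powr (1 / q))" .
      \<comment> \<open>Half of \<open>s / (E * v)\<close>, a lower bound for the average over the
        rectangle; halving makes the inequality strict.\<close>
      define \<xi> where "\<xi> = s / (2 * E * v)"
      have xi: "0 < \<xi>" using s E v by (simp add: \<xi>_def)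
      have "?Rm \<subseteq> {w \<in> space \<Lambda>. ennreal \<xi> < max_plus p \<mu> \<delta> K I Q f w}"
      proof
        fix w assume w: "w \<in> ?Rm"
        obtain y r where yr: "w = (y, r)" by (cases w)
        have y: "y \<in> Q k \<tau> a" and r: "t - l powr p < r" "r < t"
          using w sub by (auto simp: yr cyl_minus_def)
        \<comment> \<open>A rectangle based at a time \<open>r\<close> of the lower half has height
          at least \<open>2 * l powr p\<close>, so it reaches past the upper end of the
          cylinder.\<close>
        have "?Rp \<subseteq> Q k \<tau> a \<times> {r<..<r + (\<delta> powr p) powi k}"
          using sub r h by (auto simp: cyl_plus_def)
        then have "S n \<le> (\<integral>\<^sup>+w\<in>Q k \<tau> a \<times> {r<..<r + (\<delta> powr p) powi k}. ennreal \<bar>f w\<bar> \<partial>\<Lambda>)"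
          unfolding S_def by (intro nn_integral_mono) (auto simp: f_def B_def indicator_def)
        moreover have "ennreal (\<xi> * (measure \<mu> (Q k \<tau> a) * (\<delta> powr p) powi k)) < S n"
        proof -
          have "\<xi> * (measure \<mu> (Q k \<tau> a) * (\<delta> powr p) powi k) \<le> \<xi> * (E * v)"
            using vol xi by (intro mult_left_mono) auto
          also have "\<dots> = s / 2" using E v by (simp add: \<xi>_def)
          also have "\<dots> < s" using s by simp
          finally show ?thesis unfolding s(1) using s(2) by (simp add: ennreal_lessI)
        qed
        ultimately have "ennreal (\<xi> * (measure \<mu> (Q k \<tau> a) * (\<delta> powr p) powi k)) <
            (\<integral>\<^sup>+w\<in>Q k \<tau> a \<times> {r<..<r + (\<delta> powr p) powi k}. ennreal \<bar>f w\<bar> \<partial>\<Lambda>)" by (rule less_le_trans[rotated])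
        then have "ennreal \<xi> < max_plus p \<mu> \<delta> K I Q f (y, r)"
          using max_plus_less_iff[OF grid less_imp_le[OF xi]] \<tau> a y by blast
        then show "w \<in> {w \<in> space \<Lambda>. ennreal \<xi> < max_plus p \<mu> \<delta> K I Q f w}"
          by (simp add: yr space_pair_measure space_mu)
      qed
      then have "X \<le> (\<integral>\<^sup>+w\<in>{w \<in> space \<Lambda>. ennreal \<xi> < max_plus p \<mu> \<delta> K I Q f w}. ennreal (\<omega> w) \<partial>\<Lambda>)"
        unfolding X_def by (intro nn_integral_mono) (auto simp: indicator_def)
      then have "ennreal \<xi> * ennpow X (1 / q) \<le> ennreal \<xi> *
          ennpow (\<integral>\<^sup>+w\<in>{w \<in> space \<Lambda>. ennreal \<xi> < max_plus p \<mu> \<delta> K I Q f w}. ennreal (\<omega> w) \<partial>\<Lambda>) (1 / q)"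
        using q by (intro mult_left_mono ennpow_mono) auto
      also have "\<dots> \<le> weak_Lq_norm \<Lambda> \<omega> q (max_plus p \<mu> \<delta> K I Q f)"
        unfolding weak_Lq_norm_def using xi by (intro SUP_upper) simp
      also note weak
      finally have "ennpow X (1 / q) \<le> ennreal (C' * s powr (1 / q)) / ennreal \<xi>"
        using xi by (simp add: mult_le_iff_ennreal)
      also have "\<dots> = ennreal (C' * s powr (1 / q) / \<xi>)" using xi by (simp add: divide_ennreal C'_def)
      finally have "X \<le> ennpow (ennreal (C' * s powr (1 / q) / \<xi>)) q"
        using ennpow_le_iff[of "1 / q" X] q by simp
      also have "\<dots> = ennreal ((C' * s powr (1 / q) / \<xi>) powr q)"
        using xi by (simp add: ennpow_ennreal C'_def)
      also have "(C' * s powr (1 / q) / \<xi>) powr q = A * v powr q / s powr (q - 1)"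
      proof -
        have "C' * s powr (1 / q) / \<xi> = (2 * E * C') * v * s powr (1 / q) / s"
          by (simp add: \<xi>_def)
        then have "(C' * s powr (1 / q) / \<xi>) powr q = A * v powr q * (s powr (1 / q)) powr q / s powr q"
          using E v s by (simp add: A_def C'_def powr_mult powr_divide)
        also have "(s powr (1 / q)) powr q = s" using s q by (simp add: powr_powr)
        also have "s powr q = s * s powr (q - 1)" using s by (simp add: powr_mult_base)
        finally show ?thesis using s by simp
      qed
      finally show ?thesis .
    qed
    have Y_eq: "(\<integral>\<^sup>+w\<in>?Rp. ennreal (?\<sigma> w) \<partial>\<Lambda>) = (SUP n. S n)"
    proof -
      have "(\<integral>\<^sup>+w\<in>?Rp. ennreal (?\<sigma> w) \<partial>\<Lambda>) = (\<integral>\<^sup>+w. (SUP n. ennreal (?\<sigma> w) * indicator (B n) w) \<partial>\<Lambda>)"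
      proof (rule nn_integral_cong_AE)
        show "AE w in \<Lambda>. ennreal (?\<sigma> w) * indicator ?Rp w = (SUP n. ennreal (?\<sigma> w) * indicator (B n) w)"
          using weight_pos AE_space
        proof eventually_elim
          case (elim w)
          show ?case
          proof (rule antisym)
            obtain n :: nat where "inverse (real (Suc n)) < \<omega> w" using elim(1) reals_Archimedean by blast
            then have "ennreal (?\<sigma> w) * indicator ?Rp w \<le> ennreal (?\<sigma> w) * indicator (B n) w"
              using elim(2) by (auto simp: B_def indicator_def inverse_eq_divide add.commute)
            also have "\<dots> \<le> (SUP n. ennreal (?\<sigma> w) * indicator (B n) w)" by (rule SUP_upper) simp
            finally show "ennreal (?\<sigma> w) * indicator ?Rp w \<le> (SUP n. ennreal (?\<sigma> w) * indicator (B n) w)" .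
          qed (auto intro!: SUP_least simp: B_def indicator_def)
        qed
      qed
      also have "\<dots> = (SUP n. S n)"
        unfolding S_def
      proof (rule nn_integral_monotone_convergence_SUP)
        have "B m \<subseteq> B n" if "m \<le> n" for m n
        proof -
          have "1 / (real n + 1) \<le> 1 / (real m + 1)" using that by (intro divide_left_mono) auto
          then show ?thesis by (auto simp: B_def)
        qed
        then show "incseq (\<lambda>n w. ennreal (?\<sigma> w) * indicator (B n) w)"
          by (auto simp: incseq_def le_fun_def indicator_def)
      qed measurable
      finally show ?thesis .
    qed
    have Y: "0 < (\<integral>\<^sup>+w\<in>?Rp. ennreal (?\<sigma> w) \<partial>\<Lambda>)" using v by (intro set_nn_integral_pos dual_weight_pos) (auto simp: em)
    have X: "0 < X" unfolding X_def using v by (intro set_nn_integral_pos weight_pos) (auto simp: em)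
    \<comment> \<open>One truncation with positive mass already gives finiteness of the weight on
      the lower half, so that \<open>X\<close> can be treated as a positive real.\<close>
    obtain n0 where "0 < S n0" using Y unfolding Y_eq less_SUP_iff by blast
    then obtain s0 where "S n0 = ennreal s0" "0 < s0" using S_fin[of n0] by (cases "S n0") auto
    then have "X < top" using key[of n0 s0] by (auto intro: le_less_trans)
    then obtain u where u: "X = ennreal u" "0 < u" using X by (cases X) auto
    have uv: "0 < u / v" using u v by simp
    \<comment> \<open>With the power moved to the right-hand side, the supremum over
      \<open>n\<close> has to be exchanged only with the division by \<open>v\<close>.\<close>
    have each: "S n / ennreal v \<le> ennpow (ennreal A / ennreal (u / v)) (1 / (q - 1))" for n
    proof (cases "S n = 0")
      case False
      then obtain s where s: "S n = ennreal s" "0 < s" using S_fin[of n] by (cases "S n") (auto simp: less_le)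
      have A0: "0 \<le> A" by (simp add: A_def)
      have "u \<le> A * v powr q / s powr (q - 1)" using key[OF s] A0 unfolding u(1) by (simp add: ennreal_le_iff)
      also have "v powr q = v * v powr (q - 1)" using v by (simp add: powr_mult_base)
      finally have "u / v * (s powr (q - 1) / v powr (q - 1)) \<le> A" using s v by (simp add: field_simps)
      then have "u / v * (s / v) powr (q - 1) \<le> A" using s v by (simp add: powr_divide)
      then have "ennreal (u / v) * ennpow (S n / ennreal v) (q - 1) \<le> ennreal A"
        using s v uv by (simp add: divide_ennreal ennpow_ennreal ennreal_leI flip: ennreal_mult)
      then have "ennpow (S n / ennreal v) (q - 1) \<le> ennreal A / ennreal (u / v)"
        using uv by (simp add: mult_le_iff_ennreal)
      then show ?thesis using q by (simp add: ennpow_le_iff)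
    qed simp
    have "(SUP n. S n) / ennreal v = (SUP n. S n / ennreal v)"
      by (simp add: SUP_divide_ennreal)
    also have "\<dots> \<le> ennpow (ennreal A / ennreal (u / v)) (1 / (q - 1))"
      by (intro SUP_least each)
    finally have "ennreal (u / v) * ennpow ((SUP n. S n) / ennreal v) (q - 1) \<le> ennreal A"
      using q uv by (simp add: mult_le_iff_ennreal ennpow_le_iff)
    then show ?thesis using u v by (simp add: avg_def em Y_eq divide_ennreal flip: X_def)
  qed
  moreover have "0 \<le> A" by (simp add: A_def)
  ultimately show ?thesis unfolding A_plus_iff by blast
qed

end

end

theorem theorem5p9:
  fixes \<rho> :: "'a \<Rightarrow> 'a \<Rightarrow> real" and \<mu> :: "'a measure"
    and K\<^sub>0 \<delta> c\<^sub>0 C\<^sub>0 p q :: real and K :: nat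
    and I :: "int \<Rightarrow> nat \<Rightarrow> 'i set"
    and z :: "int \<Rightarrow> nat \<Rightarrow> 'i \<Rightarrow> 'a"
    and Q :: "int \<Rightarrow> nat \<Rightarrow> 'i \<Rightarrow> 'a set"
    and \<omega> :: "'a \<times> real \<Rightarrow> real"
  assumes "homogeneous_type \<rho> K\<^sub>0 \<mu>"
    and "basic_assumptions \<rho> \<mu>"
    and "monotone_geodesic \<rho>"
    and "1 < p"
    and "basic_assumptions (par_dist p \<rho>) (par_measure \<mu>)"
    and "adjacent_dyadic_systems \<rho> K\<^sub>0 \<mu> \<delta> c\<^sub>0 C\<^sub>0 K I z Q"
    and "1 < q"
    and "weight p \<rho> \<mu> \<omega>"
  shows "\<omega> \<in> A_plus p \<rho> \<mu> q \<longleftrightarrow>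
    bounded_Lq_weak_Lq (par_measure \<mu>) \<omega> q (max_plus p \<mu> \<delta> K I Q)"
proof -
  interpret dyadic_parabolic \<rho> \<mu> K\<^sub>0 \<delta> c\<^sub>0 C\<^sub>0 p K I z Q
    using assms(1-4,6) by (rule dyadic_parabolic.intro)
  show ?thesis using bounded_of_A_plus A_plus_of_bounded assms(7,8) by blast
qed

end
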